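(* Let $p\in(0,\infty)$ and let $\mu$ be a nonnegative Borel measure on the open unit disk $\mathbb{D}$. Then: (a) the identity operator $\mathsf{I}:\mathcal{Q}_p\to\mathcal{T}^\infty_p(\mu)$, $\mathsf{I}f=f$, is bounded if and only if $$\|\mu\|_{\mathcal{LCM}_p}=\sup_{S(I)\subseteq\mathbb{D}}\sqrt{\frac{\mu(S(I))}{|I|^p\left(\log\frac{2}{|I|}\right)^{-2}}}<\infty;$$ (b) the identity operator $\mathsf{I}:\mathcal{Q}_p\to\mathcal{T}^\infty_p(\mu)$ is compact if and only if $$\lim_{|I|\to 0}\frac{\mu(S(I))}{|I|^p\left(\log\frac{2}{|I|}\right)^{-2}}=0.$$
   Context: $\mathbb{D}=\{z\in\mathbb{C}:|z|<1\}$, $\mathbb{T}=\{z\in\mathbb{C}:|z|=1\}$, and $dm$ is Lebesgue area measure on $\mathbb{C}$. For $w\in\mathbb{D}$, $\sigma_w(z)=(w-z)/(1-\bar{w}z)$. For $p\in(0,\infty)$, $\mathcal{Q}_p$ is the space of all holomorphic functions $f$ on $\mathbb{D}$ with $$\|f\|_{\mathcal{Q}_p}=|f(0)|+\sup_{w\in\mathbb{D}}\sqrt{\int_{\mathbb{D}}|f'(z)|^2(1-|\sigma_w(z)|^2)^p\,dm(z)}<\infty.$$ For a subarc $I$ of $\mathbb{T}$, $|I|=(2\pi)^{-1}\int_I|d\xi|$ is its normalized length (so $|I|\le 1$), and $S(I)=\{r\xi\in\mathbb{D}: r\in[1-|I|,1),\ \xi\in I\}$ is the associated Carleson square. Suprema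 over $S(I)\subseteq\mathbb{D}$ are taken over all subarcs $I$ of $\mathbb{T}$ (of positive length), and $\lim_{|I|\to0}$ is a limit uniform over all subarcs $I$ as their length tends to $0$. $\mathcal{T}^\infty_p(\mu)$ is the space of all $\mu$-measurable functions $f$ on $\mathbb{D}$ with $$\|f\|_{\mathcal{T}^\infty_p(\mu)}=\sup_{S(I)\subseteq\mathbb{D}}\sqrt{|I|^{-p}\int_{S(I)}|f|^2\,d\mu}<\infty.$$
   Formalization: In part (b) the measure μ is additionally assumed finite on compact subsets of the disk; without this (b) fails, e.g. for μ equal to infinity times the point mass at 0, where the limit is 0 but the constant 1 is not in the tent space. *)

theory Defs
  imports "HOL-Complex_Analysis.Complex_Analysis"
begin

abbreviation unit_disk :: "complex set" where
  "unit_disk \<equiv> ball 0 1"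

definition disk_involution :: "complex \<Rightarrow> complex \<Rightarrow> complex" where
  "disk_involution w z = (w - z) / (1 - cnj w * z)"

text \<open>Norms take values in \<^typ>\<open>ennreal\<close>, so that the spaces below are the sets of functions of
  finite norm; this needs the square root on $[0,\infty]$.\<close>

definition esqrt :: "ennreal \<Rightarrow> ennreal" where
  "esqrt x = (if x = \<infinity> then \<infinity> else ennreal (sqrt (enn2real x)))"

subsection \<open>The spaces $Q_p$\<close>

text \<open>Functions on the disk are represented by total functions on \<^typ>\<open>complex\<close>; their values
  outside the disk are irrelevant throughout.\<close>

definition Qp_norm :: "real \<Rightarrow> (complex \<Rightarrow> complex) \<Rightarrow> ennreal" where
  "Qp_norm p f = ennreal (cmod (f 0)) +
     (SUP w\<in>unit_disk. esqrt (\<integral>\<^sup>+z\<in>unit_disk.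
        ennreal ((cmod (deriv f z))\<^sup>2 * (1 - (cmod (disk_involution w z))\<^sup>2) powr p) \<partial>lborel))"

definition Qp :: "real \<Rightarrow> (complex \<Rightarrow> complex) set" where
  "Qp p = {f. f holomorphic_on unit_disk \<and> Qp_norm p f < \<infinity>}"

subsection \<open>Arcs and Carleson squares\<close>

text \<open>The normalized length $(2\pi)^{-1}\int_I |d\xi|$.\<close>

definition arc_len :: "complex set \<Rightarrow> real" where
  "arc_len I = measure lborel {t \<in> {0..<2 * pi}. cis t \<in> I} / (2 * pi)"

text \<open>The subarcs (open, closed or half-open, possibly the whole circle) are the connected subsets
  of the circle; degenerate ones are excluded by requiring positive length.\<close>

definition subarc :: "complex set \<Rightarrow> bool" where
  "subarc I \<longleftrightarrow> I \<subseteq> sphere 0 1 \<and> connected I \<and> 0 < arc_len I"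

definition carleson_square :: "complex set \<Rightarrow> complex set" where
  "carleson_square I = {of_real r * \<xi> | r \<xi>. r \<in> {1 - arc_len I..<1} \<and> \<xi> \<in> I}"

subsection \<open>Tent spaces and logarithmic Carleson measures\<close>

text \<open>Being $\mu$-measurable means being measurable for the completion of $\mu$.\<close>

definition tent_norm :: "real \<Rightarrow> complex measure \<Rightarrow> (complex \<Rightarrow> complex) \<Rightarrow> ennreal" where
  "tent_norm p M f = (SUP I\<in>Collect subarc. esqrt (ennreal (arc_len I powr (- p)) *
     (\<integral>\<^sup>+z\<in>carleson_square I. ennreal ((cmod (f z))\<^sup>2) \<partial>completion M)))"

definition tent_space :: "real \<Rightarrow> complex measure \<Rightarrow> (complex \<Rightarrow> complex) set" where
  "tent_space p M = {f \<in> borel_measurable (completion M). tent_norm p M f < \<infinity>}"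

definition log_carleson_ratio :: "real \<Rightarrow> complex measure \<Rightarrow> complex set \<Rightarrow> ennreal" where
  "log_carleson_ratio p M I = emeasure M (carleson_square I) /
     ennreal (arc_len I powr p * ln (2 / arc_len I) powi (- 2))"

definition LCM_norm :: "real \<Rightarrow> complex measure \<Rightarrow> ennreal" where
  "LCM_norm p M = (SUP I\<in>Collect subarc. esqrt (log_carleson_ratio p M I))"

text \<open>The filter of the limit $|I|\to 0$, uniform over all subarcs: a property holds eventually iff
  for some $\delta > 0$ it holds for all subarcs of length less than $\delta$.\<close>

definition shrinking_arcs :: "complex set filter" where
  "shrinking_arcs = inf (filtercomap arc_len (at_right 0)) (principal (Collect subarc))"

lemma eventually_shrinking_arcs:
  "eventually P shrinking_arcs \<longleftrightarrow> (\<exists>\<delta>>0. \<forall>I. subarc I \<and> arc_len I < \<delta> \<longrightarrow> P I)"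
proof
  assume "eventually P shrinking_arcs"
  then obtain Q where Q: "eventually Q (at_right (0::real))"
      "\<And>I. Q (arc_len I) \<Longrightarrow> subarc I \<Longrightarrow> P I"
    unfolding shrinking_arcs_def eventually_inf_principal eventually_filtercomap by auto
  from Q(1) obtain \<delta> where "\<delta> > 0" "\<And>y. 0 < y \<Longrightarrow> y < \<delta> \<Longrightarrow> Q y"
    unfolding eventually_at_right_field by blast
  with Q(2) show "\<exists>\<delta>>0. \<forall>I. subarc I \<and> arc_len I < \<delta> \<longrightarrow> P I"
    unfolding subarc_def by blast
next
  assume "\<exists>\<delta>>0. \<forall>I. subarc I \<and> arc_len I < \<delta> \<longrightarrow> P I"
  then obtain \<delta> where \<delta>: "\<delta> > 0" "\<And>I. subarc I \<Longrightarrow> arc_len I < \<delta> \<Longrightarrow> P I"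
    by blast
  have "eventually (\<lambda>y. y < \<delta>) (at_right 0)"
    using \<delta>(1) unfolding eventually_at_right_field by blast
  then show "eventually P shrinking_arcs"
    unfolding shrinking_arcs_def eventually_inf_principal eventually_filtercomap
    using \<delta>(2) by (intro exI[of _ "\<lambda>y. y < \<delta>"]) simp
qed

subsection \<open>Bounded and compact operators\<close>

text \<open>The (semi)normed spaces are given by a carrier and an \<^typ>\<open>ennreal\<close>-valued (semi)norm; elements
  at distance $0$ are not identified, which affects neither notion.\<close>

definition bounded_operator ::
  "'a set \<Rightarrow> ('a \<Rightarrow> ennreal) \<Rightarrow> 'b set \<Rightarrow> ('b \<Rightarrow> ennreal) \<Rightarrow> ('a \<Rightarrow> 'b) \<Rightarrow> bool" where
  "bounded_operator X nX Y nY T \<longleftrightarrow>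
     T ` X \<subseteq> Y \<and> (\<exists>C\<ge>0. \<forall>x\<in>X. nY (T x) \<le> ennreal C * nX x)"

definition compact_operator ::
  "'a set \<Rightarrow> ('a \<Rightarrow> ennreal) \<Rightarrow> 'b::minus set \<Rightarrow> ('b \<Rightarrow> ennreal) \<Rightarrow> ('a \<Rightarrow> 'b) \<Rightarrow> bool" where
  "compact_operator X nX Y nY T \<longleftrightarrow> T ` X \<subseteq> Y \<and>
     (\<forall>s :: nat \<Rightarrow> 'a. range s \<subseteq> X \<and> (\<exists>B. \<forall>n. nX (s n) \<le> ennreal B) \<longrightarrow>
        (\<exists>y\<in>Y. \<exists>r :: nat \<Rightarrow> nat. strict_mono r \<and> (\<lambda>n. nY (T (s (r n)) - y)) \<longlonglongrightarrow> 0))"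

end

theory Submission
  imports Defs "HOL-Real_Asymp.Real_Asymp"
begin

text \<open>The idea. A function of $Q_p$-norm at most 1 grows at most like the logarithm of the distance to the
circle. Near a point of the circle this growth is attained by
$\<ell>_w(z) = \log(18/(1 - \bar w z))$, and the functions $\<ell>_w$ belong to $Q_p$ with norms
bounded independently of $w$. On a square $S(I)$ whose top is near $w$, the modulus of
$\<ell>_w$ is at least $\log(2/|I|)$, so testing the embedding on $\<ell>_w$ gives the necessity of
$\mu(S(I)) \le C |I|^p / \log^2(2/|I|)$. The content of the theorem is that this condition on single
squares is also sufficient, for every $p > 0$.

Sufficiency. Write $f(z)$ as a telescoping sum of its increments along the radius through $z$, taken at
the heights $2^{-j}$. By the area sub-mean value inequality for $(f')^2$, the square of the $j$-th increment
is at most a constant times the integral $A_j(z)$ of $|f'|^2$ over a disk of size $2^{-j}$ around the point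
of that radius at height $2^{-j}$ (\<open>oscillation_le_local_energy\<close>). For a square $S(I)$ with
$|I|$ comparable to $2^{-m}$, the increments with $j < m$ are each bounded, and together they contribute at
most a multiple of $m + 1$, hence of $\log(2/|I|)$; squared and integrated over $S(I)$ this is what the
hypothesis allows. For $j \ge m$ the Cauchy-Schwarz inequality with the weights $(j+1)^2$, whose inverses are
summable, bounds the squared sum by a multiple of $\sum_j (j+1)^2 A_j(z)$
(\<open>square_le_dyadic_energies\<close>). After integration in $z$ and an exchange of the integrals, a
point of the disk is charged at scale $j$ with the measure of a ball of radius comparable to $2^{-j}$ centred
on the circle, which is at most $K 2^{-jp} / (j+1)^2$ (\<open>single_scale\<close>). The two factors
$(j+1)^2$ cancel: the square of the logarithm in the hypothesis pays exactly for the Cauchy-Schwarz weight.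
What remains is a geometric sum in $j$ of $2^{-jp}$, comparable to the weight $(1-|z|)^p$ in the $Q_p$-norm
(\<open>box_embedding\<close>). The argument is uniform in $p > 0$.

Compactness. If the ratio $\mu(S(I)) \log^2(2/|I|) / |I|^p$ tends to 0, then the part of $\mu$ in a thin
annulus next to the circle satisfies the hypothesis with a small constant
(\<open>vanishing_outer_part\<close>). A bounded sequence in $Q_p$ has a subsequence that converges locally
uniformly to a member of $Q_p$, by Montel's theorem and Fatou's lemma; the difference is uniformly small away
from the annulus, and the embedding inequality with the small constant controls it on the annulus. Conversely,
the functions $\<ell>_w^2 / \log(18/(1-|w|))$ are bounded in $Q_p$, tend to 0 pointwise as $|w|$ tends to 1,
and are still of size comparable to $\log(2/|I|)$ on the square below $w$. A limit in the tent space along a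
subsequence must vanish almost everywhere, so their tent norms tend to 0, and with them the ratios.

Arcs enter through two facts only: two points of an arc $I$ have distance at most $2 \pi |I|$, and the part of
the disk in a ball centred on the circle is contained in a Carleson square of comparable size. Everything else
is formulated with balls of dyadic radius.\<close>

section \<open>Arcs of the circle and their Carleson squares\<close>

text \<open>The graph of the sine lies above its chord over $[0, \pi/2]$ by concavity.\<close>

lemma sin_ge_chord:
  assumes "0 \<le> x" "x \<le> pi / 2"
  shows "2 / pi * x \<le> sin x"
proof -
  have "convex_on {0..pi/2} (\<lambda>x. - sin x)"
    by (rule f''_ge0_imp_convex[where f' = "\<lambda>x. - cos x" and f'' = sin])
      (auto intro!: derivative_eq_intros sin_ge_zero)
  from convex_onD[OF this, of "2 / pi * x" 0 "pi / 2"] assms show ?thesis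
    by (simp add: field_simps)
qed

lemma cmod_cis_diff: "cmod (cis a - cis b) = 2 * \<bar>sin ((a - b) / 2)\<bar>"
proof -
  have "cis a - cis b = cis b * (cis (a - b) - 1)"
    by (simp add: right_diff_distrib cis_mult)
  then have "cmod (cis a - cis b) = cmod (cis (a - b) - 1)"
    by (simp add: norm_mult)
  then show ?thesis using dist_exp_i_1[of "a - b"] by (simp add: cis_conv_exp)
qed

lemma cmod_cis_diff_le: "cmod (cis a - cis b) \<le> \<bar>a - b\<bar>"
  using abs_sin_x_le_abs_x[of "(a - b)/2"] by (simp add: cmod_cis_diff)

lemma unit_circle_cis:
  assumes "cmod \<xi> = 1"
  obtains t where "0 \<le> t" "t < 2 * pi" "\<xi> = cis t"
  using assms Arg2pi[of \<xi>] that[of "Arg2pi \<xi>"] by (simp add: is_Arg_def cis_conv_exp)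

text \<open>A connected set that misses a point $p$ on one side and a point $q$ on the
other side of its two given points is separated by the line through cis $p$ and cis $q$. The affine function
$H$ of the proof vanishes on this line; on the circle it factors into two sines, which makes its signs
visible.\<close>

lemma connected_circle_contains_arc:
  assumes "connected I" "I \<subseteq> sphere 0 1"
    and "cis a \<in> I" "cis b \<in> I" and ab: "0 \<le> a" "a < b" "b < 2 * pi"
  shows "{a<..<b} \<subseteq> {t \<in> {0..<2 * pi}. cis t \<in> I} \<or>
         {0..<a} \<union> {b<..<2 * pi} \<subseteq> {t \<in> {0..<2 * pi}. cis t \<in> I}"
proof (rule ccontr)
  assume "\<not> ?thesis"
  then obtain p q where "p \<in> {a<..<b}" "p \<notin> {t \<in> {0..<2 * pi}. cis t \<in> I}"
      "q \<in> {0..<a} \<union> {b<..<2 * pi}" "q \<notin> {t \<in> {0..<2 * pi}. cis t \<in> I}"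
    by blast
  then have p: "a < p" "p < b" "cis p \<notin> I"
    and q: "0 \<le> q" "q < 2 * pi" "q < a \<or> b < q" "cis q \<notin> I"
    using ab by auto
  \<comment> \<open>real-affine in \<zeta>, and zero at cis p and cis q\<close>
  define H where "H \<zeta> = cos ((p - q) / 2) - Re (\<zeta> * cis (- (p + q) / 2))" for \<zeta>
  have H: "H (cis t) = 2 * sin ((t - p) / 2) * sin ((t - q) / 2)" for t
  proof -
    have "H (cis t) = cos ((t - q) / 2 - (t - p) / 2) - cos ((t - q) / 2 + (t - p) / 2)"
      by (simp add: H_def cis_mult add_divide_distrib diff_divide_distrib)
        (simp add: algebra_simps)
    also have "\<dots> = 2 * sin ((t - p) / 2) * sin ((t - q) / 2)"
      by (simp only: cos_diff cos_add) simp
    finally show ?thesis .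
  qed
  have pos: "sin (x / 2) > 0" if "0 < x" "x < 2 * pi" for x
    using that by (intro sin_gt_zero) auto
  have neg: "sin (x / 2) < 0" if "-2 * pi < x" "x < 0" for x
    using pos[of "- x"] that by simp
  have nz: "sin (x / 2) \<noteq> 0" if "-2 * pi < x" "x < 2 * pi" "x \<noteq> 0" for x
    using pos[of x] neg[of x] that by (cases "x > 0") auto
  have *: "H (cis a) < 0 \<and> 0 < H (cis b) \<or> H (cis b) < 0 \<and> 0 < H (cis a)"
  proof (cases "q < a")
    case True
    have "sin ((a - p) / 2) < 0" "sin ((a - q) / 2) > 0" "sin ((b - p) / 2) > 0" "sin ((b - q) / 2) > 0"
      using p q ab True by (auto intro!: pos neg)
    then show ?thesis unfolding H by (simp add: mult_neg_pos)
  next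
    case False
    then have "sin ((a - p) / 2) < 0" "sin ((a - q) / 2) < 0" "sin ((b - p) / 2) > 0" "sin ((b - q) / 2) < 0"
      using p q ab by (auto intro!: pos neg)
    then show ?thesis unfolding H by (simp add: mult_neg_neg mult_pos_neg)
  qed
  have "connected (H ` I)"
    by (intro connected_continuous_image assms(1)) (auto simp: H_def intro!: continuous_intros)
  then have "0 \<in> H ` I"
    using * assms(3,4) connectedD_interval[of "H ` I" "H (cis a)" "H (cis b)" 0]
      connectedD_interval[of "H ` I" "H (cis b)" "H (cis a)" 0] by auto
  then obtain \<zeta> where \<zeta>: "\<zeta> \<in> I" "H \<zeta> = 0" by auto
  obtain t where t: "0 \<le> t" "t < 2 * pi" "\<zeta> = cis t"
    using \<zeta>(1) assms(2) unit_circle_cis[of \<zeta>] by (metis mem_sphere_0 subsetD)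
  have "sin ((t - p) / 2) = 0 \<or> sin ((t - q) / 2) = 0" using \<zeta>(2) H[of t] t by simp
  then have "t = p \<or> t = q"
    using nz[of "t - p"] nz[of "t - q"] t p q ab by auto
  then show False using \<zeta>(1) t p q by auto
qed

lemma arc_len_eq_measure:
  "2 * pi * arc_len I = measure lborel {t \<in> {0..<2 * pi}. cis t \<in> I}"
  by (simp add: arc_len_def)

text \<open>The measure of a set that is not measurable is 0 by convention, so positive length implies
measurability.\<close>

lemma subarc_parameters_measurable:
  assumes "subarc I"
  shows "{t \<in> {0..<2 * pi}. cis t \<in> I} \<in> sets lborel"
proof (rule ccontr)
  assume "\<not> ?thesis"
  then have "arc_len I = 0" unfolding arc_len_def by (simp add: measure_notin_sets)
  then show False using assms by (simp add: subarc_def)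
qed

lemma measure_lborel_mono_bounded:
  assumes "A \<subseteq> B" "A \<in> sets lborel" "B \<in> sets lborel" "bounded (B :: real set)"
  shows "measure lborel A \<le> measure lborel B"
  using assms emeasure_bounded_finite[of B]
  by (intro measure_mono_fmeasurable) (auto simp: fmeasurable_def)

text \<open>An arc contains one of the two circular arcs between any two of its points, and either of
these is at least as long as the chord. Measurability is a hypothesis so that the lemma also yields lower bounds
for the length of explicit arcs.\<close>

lemma chord_le_arc_len:
  assumes conn: "connected I" "I \<subseteq> sphere 0 1"
    and meas: "{t \<in> {0..<2 * pi}. cis t \<in> I} \<in> sets lborel"
    and "\<xi> \<in> I" "\<xi>' \<in> I"
  shows "cmod (\<xi> - \<xi>') \<le> 2 * pi * arc_len I"
proof -
  let ?T = "{t \<in> {0..<2 * pi}. cis t \<in> I}"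
  have bnd: "bounded ?T" by (rule bounded_subset[OF bounded_closed_interval[of 0 "2 * pi"]]) auto
  have main: "cmod (cis a - cis b) \<le> measure lborel ?T"
    if ab: "0 \<le> a" "a < b" "b < 2 * pi" "cis a \<in> I" "cis b \<in> I" for a b
  proof -
    consider "{a<..<b} \<subseteq> ?T" | "{0..<a} \<union> {b<..<2 * pi} \<subseteq> ?T"
      using connected_circle_contains_arc[OF conn ab(4,5,1,2,3)] by blast
    then show ?thesis
    proof cases
      case 1
      have "cmod (cis a - cis b) \<le> b - a" using cmod_cis_diff_le[of a b] ab by simp
      also have "\<dots> = measure lborel {a<..<b}" using ab by simp
      also have "\<dots> \<le> measure lborel ?T"
        using 1 meas bnd by (intro measure_lborel_mono_bounded) auto
      finally show ?thesis .
    next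
      case 2
      have "cmod (cis a - cis b) = cmod (cis (a + 2 * pi) - cis b)"
        by (simp add: cis_mult[symmetric])
      also have "\<dots> \<le> a + 2 * pi - b" using cmod_cis_diff_le[of "a + 2 * pi" b] ab by simp
      also have "\<dots> = measure lborel {0..<a} + measure lborel {b<..<2 * pi}" using ab by simp
      also have "\<dots> = measure lborel ({0..<a} \<union> {b<..<2 * pi})"
        using ab emeasure_bounded_finite[of "{0..<a}"] emeasure_bounded_finite[of "{b<..<2 * pi}"]
        by (intro measure_Union[symmetric]) auto
      also have "\<dots> \<le> measure lborel ?T"
        using 2 meas bnd by (intro measure_lborel_mono_bounded) auto
      finally show ?thesis .
    qed
  qed
  have "\<xi> \<in> sphere 0 1" "\<xi>' \<in> sphere 0 1" using assms by auto
  then obtain a b where a: "0 \<le> a" "a < 2 * pi" "\<xi> = cis a" and b: "0 \<le> b" "b < 2 * pi" "\<xi>' = cis b"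
    by (auto elim!: unit_circle_cis)
  consider "a < b" | "b < a" | "a = b" by linarith
  then show ?thesis
    unfolding arc_len_eq_measure
  proof cases
    case 1 then show "cmod (\<xi> - \<xi>') \<le> measure lborel ?T" using main[of a b] a b assms by simp
  next
    case 2 then show "cmod (\<xi> - \<xi>') \<le> measure lborel ?T"
      using main[of b a] a b assms by (simp add: norm_minus_commute)
  next
    case 3 then show "cmod (\<xi> - \<xi>') \<le> measure lborel ?T" using a b by simp
  qed
qed

lemma arc_len_le_1: "arc_len I \<le> 1"
proof (cases "{t \<in> {0..<2 * pi}. cis t \<in> I} \<in> sets lborel")
  case True
  then have "measure lborel {t \<in> {0..<2 * pi}. cis t \<in> I} \<le> measure lborel {0..<2 * pi}"
    by (intro measure_lborel_mono_bounded) auto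
  then show ?thesis by (simp add: arc_len_def)
next
  case False
  then show ?thesis by (simp add: arc_len_def measure_notin_sets)
qed

lemma arc_len_circle: "arc_len (sphere 0 1) = 1"
proof -
  have "{t \<in> {0..<2 * pi}. cis t \<in> sphere 0 1} = {0..<2 * pi}" by auto
  then show ?thesis by (simp add: arc_len_def)
qed

lemma subarc_circle: "subarc (sphere 0 1)"
  by (auto simp: subarc_def arc_len_circle intro!: connected_sphere)

lemma carleson_square_circle: "carleson_square (sphere 0 1) = unit_disk"
proof (intro equalityI subsetI)
  fix z :: complex assume z: "z \<in> unit_disk"
  show "z \<in> carleson_square (sphere 0 1)"
  proof (cases "z = 0")
    case True
    then show ?thesis
      unfolding carleson_square_def arc_len_circle mem_Collect_eq
      by (intro exI[of _ 0] exI[of _ 1]) simp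
  next
    case False
    then have "z = of_real (cmod z) * sgn z" "cmod (sgn z) = 1"
      by (simp_all add: norm_sgn) (simp add: sgn_eq)
    then show ?thesis
      using z unfolding carleson_square_def arc_len_circle
      by (auto intro!: exI[of _ "cmod z"] exI[of _ "sgn z"])
  qed
qed (auto simp: carleson_square_def norm_mult arc_len_circle)

lemma carleson_square_subset_disk:
  assumes "I \<subseteq> sphere 0 1"
  shows "carleson_square I \<subseteq> unit_disk"
proof
  fix z assume "z \<in> carleson_square I"
  then obtain r \<zeta> where z: "z = of_real r * \<zeta>" "1 - arc_len I \<le> r" "r < 1" "\<zeta> \<in> I"
    by (auto simp: carleson_square_def)
  moreover have "cmod \<zeta> = 1" using assms z by auto
  ultimately show "z \<in> unit_disk" using arc_len_le_1[of I] by (simp add: norm_mult)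
qed

text \<open>A Carleson square is contained in a ball of comparable radius around any point of
its arc. This replaces arbitrary arcs by balls.\<close>

lemma carleson_square_near_point:
  assumes "subarc I" "\<xi> \<in> I" "z \<in> carleson_square I"
  shows "cmod z < 1" "1 - cmod z \<le> arc_len I" "cmod (z - \<xi>) \<le> 8 * arc_len I"
proof -
  obtain r \<zeta> where z: "z = of_real r * \<zeta>" "1 - arc_len I \<le> r" "r < 1" "\<zeta> \<in> I"
    using assms(3) by (auto simp: carleson_square_def)
  have r: "0 \<le> r" using arc_len_le_1[of I] z by linarith
  have \<zeta>: "cmod \<zeta> = 1" using z assms(1) by (auto simp: subarc_def)
  have norm: "cmod z = r" using z r \<zeta> by (simp add: norm_mult)
  show "cmod z < 1" "1 - cmod z \<le> arc_len I" using norm z by auto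
  have "z - \<zeta> = of_real (r - 1) * \<zeta>" using z by (simp add: algebra_simps)
  then have "cmod (z - \<zeta>) = 1 - r" using \<zeta> z by (simp add: norm_mult del: of_real_diff)
  moreover have "cmod (\<zeta> - \<xi>) \<le> 2 * pi * arc_len I"
    using assms z subarc_parameters_measurable[OF assms(1)]
    by (intro chord_le_arc_len) (auto simp: subarc_def)
  moreover have "2 * pi * arc_len I \<le> 7 * arc_len I"
    using assms(1) pi_approx by (intro mult_right_mono) (auto simp: subarc_def)
  moreover have "cmod (z - \<xi>) \<le> cmod (z - \<zeta>) + cmod (\<zeta> - \<xi>)" by norm
  ultimately show "cmod (z - \<xi>) \<le> 8 * arc_len I" using z(2) by linarith
qed

lemma carleson_square_measurable:
  assumes "closed I" "arc_len I < 1" "I \<subseteq> sphere 0 1"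
  shows "carleson_square I \<in> sets borel"
proof -
  have "carleson_square I = {z. cmod z \<in> {1 - arc_len I..<1}} \<inter> sgn -` I"
  proof (intro equalityI subsetI)
    fix z assume "z \<in> carleson_square I"
    then obtain r \<zeta> where z: "z = of_real r * \<zeta>" "1 - arc_len I \<le> r" "r < 1" "\<zeta> \<in> I"
      by (auto simp: carleson_square_def)
    have "0 < r" using assms z by linarith
    moreover have "cmod \<zeta> = 1" using assms z by auto
    ultimately show "z \<in> {z. cmod z \<in> {1 - arc_len I..<1}} \<inter> sgn -` I"
      using z by (auto simp: norm_mult sgn_mult sgn_of_real sgn_eq)
  next
    fix z assume "z \<in> {z. cmod z \<in> {1 - arc_len I..<1}} \<inter> sgn -` I"
    moreover have "z = of_real (cmod z) * sgn z" by (cases "z = 0") (auto simp: sgn_eq)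
    ultimately show "z \<in> carleson_square I" unfolding carleson_square_def by blast
  qed
  moreover have "(sgn :: complex \<Rightarrow> complex) \<in> borel_measurable borel"
    unfolding sgn_div_norm[abs_def] by measurable
  ultimately show ?thesis
    using assms(1) measurable_sets[of sgn borel borel I] by (auto intro!: sets.Int)
qed

text \<open>The converse of the previous comparison: a ball centred on the circle is covered, inside
the disk, by a measurable Carleson square. For a large radius the full circle serves. For a small radius $h$ the
arc of half-angle $8h$ is long enough for its square to reach down to height $h$ and to cover the ball sideways;
the lower bound for its length comes from its chord, the upper bound from covering its parameters by three
translates of an interval.\<close>

lemma exists_arc_around_point:
  assumes \<xi>: "cmod \<xi> = 1" and h: "0 < h"
  obtains J where "subarc J" "arc_len J \<le> min 1 (8 * h)"
    "unit_disk \<inter> cball \<xi> h \<subseteq> carleson_square J" "carleson_square J \<in> sets borel"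
proof (cases "h \<le> 1 / 8")
  case False
  then show ?thesis
    using that[OF subarc_circle] by (auto simp: arc_len_circle carleson_square_circle)
next
  case True
  obtain \<theta> where \<theta>: "0 \<le> \<theta>" "\<theta> < 2 * pi" "\<xi> = cis \<theta>" using \<xi> by (rule unit_circle_cis)
  define J where "J = cis ` {\<theta> - 8 * h..\<theta> + 8 * h}"
  have comp: "compact J" unfolding J_def
    by (intro compact_continuous_image continuous_intros compact_Icc)
  then have closed: "closed J" by (rule compact_imp_closed)
  have sub: "J \<subseteq> sphere 0 1" by (auto simp: J_def)
  have conn: "connected J" unfolding J_def
    by (intro connected_continuous_image continuous_intros connected_Icc)
  let ?T = "{t \<in> {0..<2 * pi}. cis t \<in> J}"
  have "cis -` J \<inter> space borel \<in> sets borel"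
    by (rule measurable_sets[of _ borel borel])
      (use closed in \<open>auto intro!: borel_measurable_continuous_onI continuous_intros\<close>)
  then have "{0..<2 * pi} \<inter> cis -` J \<in> sets borel" by auto
  moreover have "?T = {0..<2 * pi} \<inter> cis -` J" by auto
  ultimately have T: "?T \<in> sets lborel" by simp
  have lower: "h \<le> arc_len J"
  proof -
    have "cis (\<theta> + 8 * h) \<in> J" "cis (\<theta> - 8 * h) \<in> J" using h by (auto simp: J_def)
    then have "cmod (cis (\<theta> + 8 * h) - cis (\<theta> - 8 * h)) \<le> 2 * pi * arc_len J"
      by (rule chord_le_arc_len[OF conn sub T])
    moreover have "2 * (2 / pi * (8 * h)) \<le> cmod (cis (\<theta> + 8 * h) - cis (\<theta> - 8 * h))"
    proof -
      have "2 / pi * (8 * h) \<le> sin (8 * h)"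
        using h True pi_gt3 by (intro sin_ge_chord) auto
      then show ?thesis by (simp add: cmod_cis_diff)
    qed
    moreover have "2 * pi * h \<le> 2 * (2 / pi * (8 * h))"
    proof -
      have "pi * pi \<le> 4 * 4" using pi_less_4 by (intro mult_mono) auto
      then show ?thesis using h by (simp add: field_simps)
    qed
    ultimately have "2 * pi * h \<le> 2 * pi * arc_len J" by linarith
    then show ?thesis by simp
  qed
  have upper: "arc_len J \<le> 48 * h / (2 * pi)"
  proof -
    let ?S = "\<lambda>k::real. {\<theta> - 8 * h + k * (2 * pi)..\<theta> + 8 * h + k * (2 * pi)}"
    have "?T \<subseteq> ?S (-1) \<union> ?S 0 \<union> ?S 1"
    proof
      fix t assume "t \<in> ?T"
      then have t: "0 \<le> t" "t < 2 * pi" and "cis t \<in> cis ` {\<theta> - 8 * h..\<theta> + 8 * h}"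
        by (auto simp: J_def)
      then obtain s where "s \<in> {\<theta> - 8 * h..\<theta> + 8 * h}" and s2: "cis t = cis s" by blast
      then have s: "\<bar>s - \<theta>\<bar> \<le> 8 * h" "cis t = cis s" by (auto simp: abs_le_iff)
      have "sin t = sin s \<and> cos t = cos s" using s(2) by (simp add: complex_eq_iff)
      then obtain n :: int where n: "t = s + 2 * pi * of_int n"
        using sin_cos_eq_iff[of t s] by auto
      define N where "N = of_int n * pi"
      have "t = s + 2 * N" using n by (simp add: N_def)
      then have "N < 2 * pi" "- 2 * pi < N"
        using t s(1) \<theta>(1,2) True pi_gt3 unfolding abs_le_iff by linarith+
      then have "of_int n * pi < 2 * pi" "(- 2) * pi < of_int n * pi" unfolding N_def by auto
      then have "real_of_int n < 2" "- 2 < real_of_int n"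
        by (simp_all only: mult_less_cancel_right_pos[OF pi_gt_zero])
      then have "n = -1 \<or> n = 0 \<or> n = 1" by auto
      then show "t \<in> ?S (-1) \<union> ?S 0 \<union> ?S 1"
        using n s(1) unfolding abs_le_iff by (elim disjE) simp_all
    qed
    then have "measure lborel ?T \<le> measure lborel (?S (-1) \<union> ?S 0 \<union> ?S 1)"
      using T by (intro measure_lborel_mono_bounded) auto
    also have "\<dots> \<le> measure lborel (?S (-1) \<union> ?S 0) + measure lborel (?S 1)"
      by (rule measure_Un_le) auto
    also have "measure lborel (?S (-1) \<union> ?S 0) \<le> measure lborel (?S (-1)) + measure lborel (?S 0)"
      by (rule measure_Un_le) auto
    finally have "measure lborel ?T \<le> 48 * h" using h by simp
    then show ?thesis unfolding arc_len_def by (rule divide_right_mono) simp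
  qed
  have "6 * h * 8 / (2 * pi) \<le> 8 * h" using pi_gt3 h by (simp add: field_simps)
  then have u1: "arc_len J \<le> 8 * h" using upper by simp
  have "48 * h / (2 * pi) \<le> 6 / (2 * pi)" using True by (simp add: divide_right_mono)
  also have "\<dots> < 1" using pi_gt3 by (simp add: field_simps)
  finally have "48 * h / (2 * pi) < 1" .
  then have u2: "arc_len J < 1" by (rule le_less_trans[OF upper])
  have incl: "unit_disk \<inter> cball \<xi> h \<subseteq> carleson_square J"
  proof
    fix z assume z: "z \<in> unit_disk \<inter> cball \<xi> h"
    have 1: "1 - cmod z \<le> h" using z \<xi> norm_triangle_ineq2[of \<xi> z] by (auto simp: dist_norm)
    then have z0: "z \<noteq> 0" using True by auto
    then obtain t' where t': "sgn z = cis t'" using unit_circle_cis[of "sgn z"] by (metis norm_sgn)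
    have zs: "z = of_real (cmod z) * sgn z" using z0 by (simp add: sgn_eq)
    have "sgn z - z = of_real (1 - cmod z) * sgn z" using zs by (simp add: algebra_simps)
    then have "cmod (sgn z - z) = 1 - cmod z"
      using z z0 by (simp add: norm_mult norm_sgn del: of_real_diff)
    then have 2: "cmod (sgn z - \<xi>) \<le> 2 * h"
      using norm_triangle_ineq[of "sgn z - z" "z - \<xi>"] z 1 by (auto simp: dist_norm norm_minus_commute)
    have "\<exists>s. -pi < s \<and> s \<le> pi \<and> sin s = sin (t' - \<theta>) \<and> cos s = cos (t' - \<theta>)"
      using sincos_principal_value[of "t' - \<theta>"] by blast
    then obtain s where s: "-pi < s" "s \<le> pi" "cis s = cis (t' - \<theta>)" by (auto simp: complex_eq_iff)
    have eq: "sgn z = cis (\<theta> + s)" unfolding t' cis_mult[symmetric] s(3) by (simp add: cis_mult)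
    have "cmod (sgn z - \<xi>) = 2 * sin (\<bar>s\<bar> / 2)"
      unfolding eq \<theta>(3) cmod_cis_diff using s sin_ge_zero[of "\<bar>s\<bar> / 2"] by (cases "s \<ge> 0") auto
    moreover have "2 / pi * (\<bar>s\<bar> / 2) \<le> sin (\<bar>s\<bar> / 2)" using s by (intro sin_ge_chord) auto
    ultimately have "\<bar>s\<bar> \<le> pi * sin (\<bar>s\<bar> / 2)" "sin (\<bar>s\<bar> / 2) \<le> h"
      using 2 by (simp_all add: field_simps)
    moreover from this(2) have "pi * sin (\<bar>s\<bar> / 2) \<le> pi * h" by (intro mult_left_mono) auto
    ultimately have "\<bar>s\<bar> \<le> pi * h" by linarith
    also have "\<dots> \<le> 8 * h" using pi_less_4 h by (intro mult_right_mono) auto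
    finally have "sgn z \<in> J" unfolding eq J_def by (auto simp: abs_le_iff)
    then show "z \<in> carleson_square J"
      unfolding carleson_square_def mem_Collect_eq using zs 1 lower z
      by (intro exI[of _ "cmod z"] exI[of _ "sgn z"]) auto
  qed
  show ?thesis
    by (rule that[of J])
      (use u1 u2 lower h sub conn incl carleson_square_measurable[OF closed u2 sub] in \<open>auto simp: subarc_def\<close>)
qed

section \<open>Rotation invariance of area and the area sub-mean value inequality\<close>

lemma lborel_complex_eq_distr:
  "(lborel :: complex measure) = distr (lborel :: (real \<times> real) measure) borel (\<lambda>(x, y). Complex x y)"
proof (rule lborel_eqI)
  have meas: "(\<lambda>(x, y). Complex x y) \<in> borel_measurable borel"
    by (intro borel_measurable_continuous_onI) (auto simp: split_def Complex_eq intro!: continuous_intros)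
  fix l u :: complex
  assume le: "\<And>b. b \<in> Basis \<Longrightarrow> l \<bullet> b \<le> u \<bullet> b"
  have le': "Re l \<le> Re u" "Im l \<le> Im u"
    using le[of 1] le[of \<i>] by (auto simp: Basis_complex_def)
  have pre: "(\<lambda>(x, y). Complex x y) -` box l u = box (Re l, Im l) (Re u, Im u)"
    by (auto simp: box_def Basis_complex_def Basis_prod_def)
  have "emeasure (distr (lborel :: (real \<times> real) measure) borel (\<lambda>(x, y). Complex x y)) (box l u)
      = emeasure lborel (box (Re l, Im l) (Re u, Im u))"
    using meas by (subst emeasure_distr) (auto simp: pre)
  also have "\<dots> = (\<Prod>b\<in>Basis. ((Re u, Im u) - (Re l, Im l)) \<bullet> b)"
    using le' by (intro emeasure_lborel_box) (auto simp: Basis_prod_def)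
  also have "(\<Prod>b\<in>Basis. ((Re u, Im u) - (Re l, Im l)) \<bullet> b) = (\<Prod>b\<in>Basis. (u - l) \<bullet> b)"
    by (simp add: Basis_complex_def Basis_prod_def)
  finally show "emeasure (distr (lborel :: (real \<times> real) measure) borel (\<lambda>(x, y). Complex x y)) (box l u)
      = (\<Prod>b\<in>Basis. (u - l) \<bullet> b)" .
qed simp

lemma nn_integral_lborel_complex:
  fixes f :: "complex \<Rightarrow> ennreal"
  assumes f[measurable]: "f \<in> borel_measurable borel"
  shows "(\<integral>\<^sup>+z. f z \<partial>lborel) = (\<integral>\<^sup>+y. \<integral>\<^sup>+x. f (Complex x y) \<partial>lborel \<partial>lborel)"
    and "(\<integral>\<^sup>+z. f z \<partial>lborel) = (\<integral>\<^sup>+x. \<integral>\<^sup>+y. f (Complex x y) \<partial>lborel \<partial>lborel)"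
proof -
  have meas: "(\<lambda>(x, y). Complex x y) \<in> borel_measurable borel"
    by (intro borel_measurable_continuous_onI) (auto simp: split_def Complex_eq intro!: continuous_intros)
  have g: "(\<lambda>q. f (case q of (x, y) \<Rightarrow> Complex x y)) \<in> borel_measurable (borel :: (real \<times> real) measure)"
    using measurable_compose[OF meas f] .
  have g': "(\<lambda>q. f (case q of (x, y) \<Rightarrow> Complex x y)) \<in>
      borel_measurable (lborel \<Otimes>\<^sub>M (lborel :: real measure))"
    using g by (subst lborel_prod) simp
  have eq: "(\<integral>\<^sup>+z. f z \<partial>lborel) =
      (\<integral>\<^sup>+q. f (case q of (x, y) \<Rightarrow> Complex x y) \<partial>(lborel \<Otimes>\<^sub>M (lborel :: real measure)))"
    using meas by (subst lborel_complex_eq_distr, subst nn_integral_distr) (auto simp: lborel_prod)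
  show "(\<integral>\<^sup>+z. f z \<partial>lborel) = (\<integral>\<^sup>+y. \<integral>\<^sup>+x. f (Complex x y) \<partial>lborel \<partial>lborel)"
    unfolding eq by (subst lborel_pair.nn_integral_snd[symmetric]) (use g' in \<open>auto simp: split_def\<close>)
  show "(\<integral>\<^sup>+z. f z \<partial>lborel) = (\<integral>\<^sup>+x. \<integral>\<^sup>+y. f (Complex x y) \<partial>lborel \<partial>lborel)"
    unfolding eq by (subst lborel.nn_integral_fst[symmetric]) (use g' in \<open>auto simp: split_def\<close>)
qed

lemma nn_integral_lborel_translate:
  fixes f :: "'a::euclidean_space \<Rightarrow> ennreal"
  assumes [measurable]: "f \<in> borel_measurable borel"
  shows "(\<integral>\<^sup>+x. f (c + x) \<partial>lborel) = (\<integral>\<^sup>+x. f x \<partial>lborel)"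
proof -
  have "(\<integral>\<^sup>+x. f x \<partial>lborel) = (\<integral>\<^sup>+x. f x \<partial>distr lborel borel ((+) c))"
    by (simp add: lborel_distr_plus)
  also have "\<dots> = (\<integral>\<^sup>+x. f (c + x) \<partial>lborel)"
    by (subst nn_integral_distr) auto
  finally show ?thesis by simp
qed

lemma nn_integral_shear_Re:
  fixes f :: "complex \<Rightarrow> ennreal"
  assumes [measurable]: "f \<in> borel_measurable borel"
  shows "(\<integral>\<^sup>+z. f (Complex (Re z + a * Im z) (Im z)) \<partial>lborel) = (\<integral>\<^sup>+z. f z \<partial>lborel)"
proof -
  have [measurable]: "(\<lambda>z. Complex (Re z + a * Im z) (Im z)) \<in> borel_measurable borel"
    "\<And>y. (\<lambda>x. Complex x y) \<in> borel_measurable borel"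
    by (intro borel_measurable_continuous_onI; simp add: Complex_eq; intro continuous_intros)+
  show ?thesis
    apply (subst (1 2) nn_integral_lborel_complex(1))
      apply simp_all
    apply (subst add.commute)
    apply (subst nn_integral_lborel_translate[where f = "\<lambda>x. f (Complex x _)"])
     apply simp_all
    done
qed

lemma nn_integral_shear_Im:
  fixes f :: "complex \<Rightarrow> ennreal"
  assumes [measurable]: "f \<in> borel_measurable borel"
  shows "(\<integral>\<^sup>+z. f (Complex (Re z) (Im z + a * Re z)) \<partial>lborel) = (\<integral>\<^sup>+z. f z \<partial>lborel)"
proof -
  have [measurable]: "(\<lambda>z. Complex (Re z) (Im z + a * Re z)) \<in> borel_measurable borel"
    "\<And>x. (\<lambda>y. Complex x y) \<in> borel_measurable borel"
    by (intro borel_measurable_continuous_onI; simp add: Complex_eq; intro continuous_intros)+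
  show ?thesis
    apply (subst (1 2) nn_integral_lborel_complex(2))
      apply simp_all
    apply (subst add.commute)
    apply (subst nn_integral_lborel_translate[where f = "\<lambda>y. f (Complex _ y)"])
     apply simp_all
    done
qed

text \<open>A rotation is a product of three shears, and a shear preserves area by Fubini's theorem
and translation invariance on lines.\<close>

lemma nn_integral_rotate_by_shears:
  fixes f :: "complex \<Rightarrow> ennreal"
  assumes [measurable]: "f \<in> borel_measurable borel" and "cos (\<theta> / 2) \<noteq> 0"
  shows "(\<integral>\<^sup>+z. f (cis \<theta> * z) \<partial>lborel) = (\<integral>\<^sup>+z. f z \<partial>lborel)"
proof -
  define a where "a = - tan (\<theta> / 2)"
  have s: "sin \<theta> = 2 * sin (\<theta>/2) * cos (\<theta>/2)" using sin_double[of "\<theta>/2"] by simp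
  have c: "cos \<theta> = 1 - 2 * (sin (\<theta>/2))^2" using cos_double_sin[of "\<theta>/2"] by simp
  \<comment> \<open>these relations make the product of the shears with parameters a, sin \<theta>, a the rotation by \<theta>\<close>
  have as: "a * sin \<theta> = cos \<theta> - 1"
    using assms(2) by (simp add: a_def tan_def s c power2_eq_square)
  have a2: "a * (cos \<theta> + 1) = - sin \<theta>"
    using assms(2) cos_double_cos[of "\<theta>/2"] by (simp add: a_def tan_def s power2_eq_square)
  have rot: "cis \<theta> * z = Complex (Re z + a * Im z + a * (Im z + sin \<theta> * (Re z + a * Im z)))
      (Im z + sin \<theta> * (Re z + a * Im z))" for z
  proof -
    have e1: "Re z * cos \<theta> - Im z * sin \<theta> = Re z + a * Im z + a * (Im z + sin \<theta> * (Re z + a * Im z))"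
    proof -
      have "Re z + a * Im z + a * (Im z + sin \<theta> * (Re z + a * Im z)) =
        Re z * (1 + a * sin \<theta>) + Im z * (a * (2 + a * sin \<theta>))" by (simp add: algebra_simps)
      also have "\<dots> = Re z * cos \<theta> + Im z * (a * (cos \<theta> + 1))" by (simp add: as algebra_simps)
      finally show ?thesis by (simp add: a2)
    qed
    have e2: "Re z * sin \<theta> + Im z * cos \<theta> = Im z + sin \<theta> * (Re z + a * Im z)"
    proof -
      have "Im z + sin \<theta> * (Re z + a * Im z) = Re z * sin \<theta> + Im z * (1 + a * sin \<theta>)"
        by (simp add: algebra_simps)
      then show ?thesis by (simp add: as)
    qed
    show ?thesis using e1 e2 by (simp add: complex_eq_iff algebra_simps)
  qed
  have [measurable]: "(\<lambda>z. Complex (Re z + a * Im z) (Im z)) \<in> borel_measurable borel" for a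
    by (intro borel_measurable_continuous_onI; simp add: Complex_eq; intro continuous_intros)
  have [measurable]: "(\<lambda>z. Complex (Re z) (Im z + a * Re z)) \<in> borel_measurable borel" for a
    by (intro borel_measurable_continuous_onI; simp add: Complex_eq; intro continuous_intros)
  define f1 where "f1 z = f (Complex (Re z + a * Im z) (Im z))" for z
  have [measurable]: "f1 \<in> borel_measurable borel" unfolding f1_def by measurable
  define f2 where "f2 z = f1 (Complex (Re z) (Im z + sin \<theta> * Re z))" for z
  have [measurable]: "f2 \<in> borel_measurable borel" unfolding f2_def by measurable
  have "(\<integral>\<^sup>+z. f z \<partial>lborel) = (\<integral>\<^sup>+z. f1 z \<partial>lborel)" unfolding f1_def
    by (rule nn_integral_shear_Re[symmetric]) simp
  also have "\<dots> = (\<integral>\<^sup>+z. f2 z \<partial>lborel)" unfolding f2_def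
    by (rule nn_integral_shear_Im[symmetric]) simp
  also have "\<dots> = (\<integral>\<^sup>+z. f2 (Complex (Re z + a * Im z) (Im z)) \<partial>lborel)"
    by (rule nn_integral_shear_Re[symmetric]) simp
  finally show ?thesis by (simp add: rot f1_def f2_def)
qed

lemma nn_integral_rotate:
  fixes f :: "complex \<Rightarrow> ennreal"
  assumes [measurable]: "f \<in> borel_measurable borel"
  shows "(\<integral>\<^sup>+z. f (cis \<theta> * z) \<partial>lborel) = (\<integral>\<^sup>+z. f z \<partial>lborel)"
proof (cases "cos (\<theta> / 2) = 0")
  case False
  then show ?thesis by (intro nn_integral_rotate_by_shears) auto
next
  case True
  have nz: "cos (\<theta> / 2 / 2) \<noteq> 0"
    using True cos_double_cos[of "\<theta>/2/2"] by auto
  have "(\<integral>\<^sup>+z. f (cis \<theta> * z) \<partial>lborel) = (\<integral>\<^sup>+z. (\<lambda>z. f (cis (\<theta>/2) * z)) (cis (\<theta>/2) * z) \<partial>lborel)"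
    by (simp add: mult.assoc[symmetric] cis_mult)
  also have "\<dots> = (\<integral>\<^sup>+z. f (cis (\<theta>/2) * z) \<partial>lborel)"
    using nz by (intro nn_integral_rotate_by_shears) auto
  also have "\<dots> = (\<integral>\<^sup>+z. f z \<partial>lborel)"
    using nz by (intro nn_integral_rotate_by_shears) auto
  finally show ?thesis .
qed

text \<open>Cauchy's integral formula on the circle through $u + z$ around $u$. The circle is
parametrised from the point $u + z$, so that it appears as the orbit of $z$ under rotations.\<close>

lemma norm_center_le_circle_mean:
  assumes "g holomorphic_on ball u s" and "z \<in> ball 0 s"
  shows "ennreal (cmod (g u)) \<le> (\<integral>\<^sup>+t\<in>{0..1}. ennreal (cmod (g (u + cis (2 * pi * t) * z))) \<partial>lborel)"
proof -
  define h where "h t = g (u + cis (2 * pi * t) * z)" for t :: real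
  have "continuous_on {0..1} h"
    unfolding h_def
    by (rule continuous_on_compose2[OF holomorphic_on_imp_continuous_on[OF assms(1)]])
      (use assms(2) in \<open>auto intro!: continuous_intros simp: dist_norm norm_mult\<close>)
  moreover have "(h has_integral g u) {0..1}"
  proof (cases "z = 0")
    case True
    then have "h = (\<lambda>_. g u)" by (simp add: h_def fun_eq_iff)
    then show ?thesis using has_integral_const_real[of "g u" 0 1] by simp
  next
    case False
    define r where "r = cmod z"
    have r: "0 < r" "r < s" using False assms(2) by (auto simp: r_def)
    obtain \<phi> where \<phi>: "z = of_real r * cis \<phi>" using rcis_cmod_Arg[of z] unfolding r_def rcis_def by metis
    define g' where "g' w = g (u + cis \<phi> * (w - u))" for w
    have "g' holomorphic_on ball u s"
      unfolding g'_def
      by (rule holomorphic_on_compose_gen[OF _ assms(1), unfolded o_def])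
        (auto intro!: holomorphic_intros simp: dist_norm norm_mult norm_minus_commute)
    then have hol: "g' holomorphic_on cball u r" using r by (elim holomorphic_on_subset) auto
    have "((\<lambda>w. g' w / (w - u)) has_contour_integral (2 * of_real pi * \<i> * g' u)) (circlepath u r)"
      by (rule Cauchy_integral_circlepath_simple) (use hol r in auto)
    then have "((\<lambda>t. g' (circlepath u r t) / (circlepath u r t - u) * vector_derivative (circlepath u r) (at t within {0..1}))
        has_integral (2 * of_real pi * \<i> * g' u)) {0..1}"
      by (simp add: has_contour_integral_def)
    then have "((\<lambda>t. (2 * of_real pi * \<i>) * h t) has_integral (2 * of_real pi * \<i> * g' u)) {0..1}"
    proof (rule has_integral_eq[rotated])
      fix t :: real assume t: "t \<in> {0..1}"
      have e: "circlepath u r t = u + of_real r * exp (2 * of_real pi * \<i> * of_real t)"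
        by (simp add: circlepath)
      have e2: "exp (2 * of_real pi * \<i> * of_real t) = cis (2 * pi * t)"
        by (simp add: cis_conv_exp mult_ac)
      have "g' (circlepath u r t) = h t"
        unfolding g'_def h_def e e2 by (simp add: \<phi> mult_ac)
      moreover have "vector_derivative (circlepath u r) (at t within {0..1}) = 2 * of_real pi * \<i> * (circlepath u r t - u)"
        using t by (subst vector_derivative_circlepath01) (auto simp: circlepath mult_ac)
      moreover have "circlepath u r t - u \<noteq> 0" using r by (simp add: e)
      ultimately show "g' (circlepath u r t) / (circlepath u r t - u) * vector_derivative (circlepath u r) (at t within {0..1})
         = (2 * of_real pi * \<i>) * h t" by (simp)
    qed
    then have "((\<lambda>t. inverse (2 * of_real pi * \<i>) * (2 * of_real pi * \<i> * h t)) has_integral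
        inverse (2 * of_real pi * \<i>) * (2 * of_real pi * \<i> * g' u)) {0..1}"
      by (rule has_integral_mult_right)
    moreover have "inverse (2 * of_real pi * \<i>) * (2 * of_real pi * \<i> * w) = w" for w
      by (simp add: field_simps)
    ultimately show ?thesis by (simp only: g'_def) simp
  qed
  ultimately have i: "set_integrable lborel {0..1} h" "(LBINT t:{0..1}. h t) = g u"
    using borel_integrable_atLeastAtMost'[of 0 1 h] set_borel_integral_eq_integral(2)[of "{0..1}" h]
    by (auto simp: integral_unique)
  then have "ennreal (cmod (g u)) \<le> (\<integral>\<^sup>+t. ennreal (cmod (indicator {0..1} t *\<^sub>R h t)) \<partial>lborel)"
    using integral_norm_bound_ennreal[of lborel "\<lambda>t. indicator {0..1} t *\<^sub>R h t"]
    by (simp add: set_integrable_def set_lebesgue_integral_def)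
  also have "\<dots> = (\<integral>\<^sup>+t\<in>{0..1}. ennreal (cmod (h t)) \<partial>lborel)"
    by (intro nn_integral_cong) (auto simp: indicator_def)
  finally show ?thesis by (simp add: h_def)
qed

text \<open>The inequality for circles is averaged over all $z$ in the disk. After the exchange of the
integrals, the inner integral does not depend on the angle by rotation invariance.\<close>

lemma area_sub_mean:
  assumes hol: "g holomorphic_on ball u s" and "0 \<le> s"
  shows "ennreal (pi * s\<^sup>2 * cmod (g u)) \<le> (\<integral>\<^sup>+z\<in>ball u s. ennreal (cmod (g z)) \<partial>lborel)"
proof -
  define F where "F z = ennreal (cmod (indicator (ball u s) z *\<^sub>R g z))" for z
  have "(\<lambda>z. indicator (ball u s) z *\<^sub>R g z) \<in> borel_measurable borel"
    by (intro borel_measurable_continuous_on_indicator holomorphic_on_imp_continuous_on[OF hol]) auto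
  then have F[measurable]: "F \<in> borel_measurable borel" unfolding F_def by measurable
  have Fu[measurable]: "(\<lambda>z. F (u + z)) \<in> borel_measurable borel" by measurable
  have eq: "ennreal (cmod (g z)) * indicator (ball u s) z = F z" for z
    by (auto simp: F_def indicator_def)
  have cis[measurable]: "(\<lambda>t::real. cis (2 * pi * t)) \<in> borel_measurable borel"
    by (intro borel_measurable_continuous_onI continuous_intros)
  have A: "ennreal (cmod (g u)) * indicator (ball 0 s) z \<le> (\<integral>\<^sup>+t. F (u + cis (2 * pi * t) * z) * indicator {0..1} t \<partial>lborel)" for z
  proof (cases "z \<in> ball 0 s")
    case True
    then have "(\<integral>\<^sup>+t. F (u + cis (2 * pi * t) * z) * indicator {0..1} t \<partial>lborel) =
       (\<integral>\<^sup>+t\<in>{0..1}. ennreal (cmod (g (u + cis (2 * pi * t) * z))) \<partial>lborel)"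
      by (intro nn_integral_cong) (auto simp: F_def indicator_def dist_norm norm_mult)
    with norm_center_le_circle_mean[OF hol True] True show ?thesis by simp
  qed simp
  have "ennreal (pi * s\<^sup>2 * cmod (g u)) = (\<integral>\<^sup>+(z::complex). ennreal (cmod (g u)) * indicator (ball 0 s) z \<partial>lborel)"
    using \<open>0 \<le> s\<close> by (subst nn_integral_cmult_indicator)
      (auto simp: emeasure_ball unit_ball_vol_2 ennreal_mult'[symmetric] mult_ac)
  also have "\<dots> \<le> (\<integral>\<^sup>+z. \<integral>\<^sup>+t. F (u + cis (2 * pi * t) * z) * indicator {0..1} t \<partial>lborel \<partial>lborel)"
    by (intro nn_integral_mono A)
  also have "\<dots> = (\<integral>\<^sup>+t. \<integral>\<^sup>+z. F (u + cis (2 * pi * t) * z) * indicator {0..1} t \<partial>lborel \<partial>lborel)"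
    by (rule lborel_pair.Fubini') measurable
  also have "\<dots> = (\<integral>\<^sup>+t. (\<integral>\<^sup>+z. F z \<partial>lborel) * indicator {0..1::real} t \<partial>lborel)"
  proof (intro nn_integral_cong)
    fix t :: real
    have "(\<integral>\<^sup>+z. F (u + cis (2 * pi * t) * z) \<partial>lborel) = (\<integral>\<^sup>+z. F (u + z) \<partial>lborel)"
      by (rule nn_integral_rotate[OF Fu])
    also have "\<dots> = (\<integral>\<^sup>+z. F z \<partial>lborel)" by (rule nn_integral_lborel_translate) simp
    finally show "(\<integral>\<^sup>+z. F (u + cis (2 * pi * t) * z) * indicator {0..1} t \<partial>lborel) = (\<integral>\<^sup>+z. F z \<partial>lborel) * indicator {0..1} t"
      by (subst nn_integral_multc) auto
  qed
  also have "\<dots> = (\<integral>\<^sup>+z. F z \<partial>lborel)"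
    by (simp add: nn_integral_cmult)
  finally show ?thesis by (simp add: eq)
qed

section \<open>Energies of functions in $Q_p$\<close>

text \<open>The identity that links the weight of the $Q_p$-norm to the geometry of the disk.\<close>

lemma mobius_defect:
  assumes "cmod w < 1" "cmod z < 1"
  shows "1 - (cmod (disk_involution w z))\<^sup>2 =
    (1 - (cmod w)\<^sup>2) * (1 - (cmod z)\<^sup>2) / (cmod (1 - cnj w * z))\<^sup>2"
    and "cmod (1 - cnj w * z) > 0"
proof -
  have "cmod (cnj w * z) < 1"
    using assms mult_strict_mono[of "cmod w" 1 "cmod z" 1] by (cases "w = 0") (auto simp: norm_mult)
  then have nz: "1 - cnj w * z \<noteq> 0" by auto
  then show pos: "cmod (1 - cnj w * z) > 0" by simp
  have "(cmod (1 - cnj w * z))\<^sup>2 - (cmod (w - z))\<^sup>2 = (1 - (cmod w)\<^sup>2) * (1 - (cmod z)\<^sup>2)"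
    unfolding cmod_power2 by (simp add: power2_eq_square algebra_simps)
  then show "1 - (cmod (disk_involution w z))\<^sup>2 =
    (1 - (cmod w)\<^sup>2) * (1 - (cmod z)\<^sup>2) / (cmod (1 - cnj w * z))\<^sup>2"
    using pos by (simp add: disk_involution_def norm_divide power_divide field_simps)
qed

lemma mobius_defect_pos:
  assumes "cmod w < 1" "cmod z < 1"
  shows "0 < 1 - (cmod (disk_involution w z))\<^sup>2"
  unfolding mobius_defect(1)[OF assms]
  using assms mobius_defect(2)[OF assms]
  by (intro divide_pos_pos mult_pos_pos) (auto simp: power_less_one_iff abs_square_less_1)

lemma mobius_defect_ge:
  assumes w: "cmod w < 1" and z: "cmod z < 1" and "cmod (1 - cnj w * z) \<le> R"
  shows "(1 - cmod w) * (1 - cmod z) / R\<^sup>2 \<le> 1 - (cmod (disk_involution w z))\<^sup>2"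
proof -
  have sq: "1 - x \<le> 1 - x\<^sup>2" if "0 \<le> x" "x < 1" for x :: real
    using that mult_left_mono[of x 1 x] by (simp add: power2_eq_square)
  note pos = mobius_defect(2)[OF w z]
  have "(1 - cmod w) * (1 - cmod z) \<le> (1 - (cmod w)\<^sup>2) * (1 - (cmod z)\<^sup>2)"
    using w z sq by (intro mult_mono) (auto simp: abs_square_le_1)
  moreover have "(cmod (1 - cnj w * z))\<^sup>2 \<le> R\<^sup>2" using assms by (intro power_mono) auto
  ultimately show ?thesis
    unfolding mobius_defect(1)[OF w z] using pos w z by (intro frac_le) (auto simp: abs_square_le_1)
qed

lemma cmod_one_minus_cnj_mult_ge:
  assumes "cmod w < 1" "cmod z < 1"
  shows "1 - cmod z \<le> cmod (1 - cnj w * z)" "1 - cmod w \<le> cmod (1 - cnj w * z)"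
proof -
  have "cmod 1 \<le> cmod (1 - cnj w * z) + cmod (cnj w * z)" by norm
  moreover have "cmod (cnj w * z) \<le> cmod z" "cmod (cnj w * z) \<le> cmod w"
    using assms mult_right_mono[of "cmod w" 1 "cmod z"] mult_left_mono[of "cmod z" 1 "cmod w"]
    by (auto simp: norm_mult)
  ultimately show "1 - cmod z \<le> cmod (1 - cnj w * z)" "1 - cmod w \<le> cmod (1 - cnj w * z)"
    by auto
qed

lemma nearest_circle_point:
  assumes "cmod z < 1"
  obtains \<zeta> where "cmod \<zeta> = 1" "cmod (\<zeta> - z) = 1 - cmod z"
proof -
  define \<zeta> where "\<zeta> = (if z = 0 then 1 else sgn z)"
  have \<zeta>: "cmod \<zeta> = 1" by (simp add: \<zeta>_def norm_sgn)
  have "\<zeta> - z = of_real (1 - cmod z) * \<zeta>" by (auto simp: \<zeta>_def sgn_eq algebra_simps)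
  then have "cmod (\<zeta> - z) = \<bar>1 - cmod z\<bar> * cmod \<zeta>" by (simp only: norm_mult norm_of_real)
  then show ?thesis using that[OF \<zeta>] assms \<zeta> by simp
qed

lemma cmod_one_minus_cnj_mult_le:
  assumes "cmod \<xi> = 1" "cmod z \<le> 1"
  shows "cmod (1 - cnj w * z) \<le> cmod (\<xi> - w) + cmod (\<xi> - z)"
proof -
  have "1 - cnj w * z = cnj (\<xi> - w) * z + cnj \<xi> * (\<xi> - z)"
    using assms(1) complex_norm_square[of \<xi>] by (simp add: algebra_simps)
  then have "cmod (1 - cnj w * z) \<le> cmod (cnj (\<xi> - w) * z) + cmod (cnj \<xi> * (\<xi> - z))"
    by (metis norm_triangle_ineq)
  also have "\<dots> \<le> cmod (\<xi> - w) + cmod (\<xi> - z)"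
    using assms mult_left_le[of "cmod z" "cmod (\<xi> - w)"] unfolding norm_mult complex_mod_cnj by auto
  finally show ?thesis .
qed

text \<open>Turns the bounds on norms, which contain square roots, into bounds on integrals.\<close>

lemma esqrt_le_iff:
  assumes "0 \<le> b"
  shows "esqrt x \<le> ennreal b \<longleftrightarrow> x \<le> ennreal (b\<^sup>2)"
proof (cases x)
  case (real r)
  then show ?thesis using assms real_sqrt_le_iff[of r "b\<^sup>2"] by (simp add: esqrt_def)
next
  case top
  then show ?thesis by (simp add: esqrt_def top_unique)
qed

definition Qp_energy :: "real \<Rightarrow> (complex \<Rightarrow> complex) \<Rightarrow> complex \<Rightarrow> ennreal" where
  "Qp_energy p f w = (\<integral>\<^sup>+z\<in>unit_disk.
     ennreal ((cmod (deriv f z))\<^sup>2 * (1 - (cmod (disk_involution w z))\<^sup>2) powr p) \<partial>lborel)"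

text \<open>A bound on both terms of the norm at once. It determines the norm up to a factor 2 and avoids
suprema and square roots in extended reals.\<close>

definition Qp_bounded_by :: "real \<Rightarrow> (complex \<Rightarrow> complex) \<Rightarrow> real \<Rightarrow> bool" where
  "Qp_bounded_by p f B \<longleftrightarrow> 0 \<le> B \<and> f holomorphic_on unit_disk \<and> cmod (f 0) \<le> B \<and>
     (\<forall>w\<in>unit_disk. Qp_energy p f w \<le> ennreal (B\<^sup>2))"

lemma Qp_norm_le_imp_bounded_by:
  assumes "f \<in> Qp p" "Qp_norm p f \<le> ennreal B" "0 \<le> B"
  shows "Qp_bounded_by p f B"
proof -
  have "ennreal (cmod (f 0)) \<le> ennreal B"
    using assms(2) unfolding Qp_norm_def by (rule order_trans[rotated]) simp
  then have "cmod (f 0) \<le> B" using assms(3) by (simp add: ennreal_le_iff)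
  moreover have "Qp_energy p f w \<le> ennreal (B\<^sup>2)" if "w \<in> unit_disk" for w
  proof -
    have "esqrt (Qp_energy p f w) \<le> (SUP w\<in>unit_disk. esqrt (Qp_energy p f w))"
      using that by (rule SUP_upper)
    also have "\<dots> \<le> Qp_norm p f" unfolding Qp_norm_def Qp_energy_def by simp
    finally show ?thesis using assms(2,3) esqrt_le_iff by (meson order_trans)
  qed
  ultimately show ?thesis using assms by (auto simp: Qp_bounded_by_def Qp_def)
qed

lemma bounded_by_imp_Qp:
  assumes "Qp_bounded_by p f B"
  shows "f \<in> Qp p" "Qp_norm p f \<le> ennreal (2 * B)"
proof -
  have B: "0 \<le> B" using assms by (simp add: Qp_bounded_by_def)
  have "(SUP w\<in>unit_disk. esqrt (Qp_energy p f w)) \<le> ennreal B"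
    using assms B by (intro SUP_least) (auto simp: Qp_bounded_by_def esqrt_le_iff)
  moreover have "ennreal (cmod (f 0)) \<le> ennreal B"
    using assms by (auto simp: Qp_bounded_by_def intro: ennreal_leI)
  ultimately have "Qp_norm p f \<le> ennreal B + ennreal B"
    unfolding Qp_norm_def Qp_energy_def by (rule add_mono[rotated])
  also have "\<dots> = ennreal (2 * B)" using B by (simp flip: ennreal_plus)
  finally show le: "Qp_norm p f \<le> ennreal (2 * B)" .
  then show "f \<in> Qp p" using assms by (auto simp: Qp_def Qp_bounded_by_def le_less_trans)
qed

lemma borel_measurable_indicator_disk:
  fixes g :: "complex \<Rightarrow> real"
  assumes "continuous_on unit_disk g"
  shows "(\<lambda>z. ennreal (g z) * indicator unit_disk z) \<in> borel_measurable borel"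
proof -
  have "(\<lambda>z. indicator unit_disk z *\<^sub>R g z) \<in> borel_measurable borel"
    by (intro borel_measurable_continuous_on_indicator assms) auto
  then have "(\<lambda>z. ennreal (indicator unit_disk z *\<^sub>R g z)) \<in> borel_measurable borel"
    by measurable
  moreover have "ennreal (indicator unit_disk z *\<^sub>R g z) = ennreal (g z) * indicator unit_disk z" for z
    by (auto simp: indicator_def)
  ultimately show ?thesis by simp
qed

lemma continuous_on_deriv_disk:
  assumes "f holomorphic_on unit_disk"
  shows "continuous_on unit_disk (deriv f)"
  using assms by (intro holomorphic_on_imp_continuous_on holomorphic_deriv) auto

lemma Qp_integrand_measurable:
  assumes "f holomorphic_on unit_disk" "cmod w < 1"
  shows "(\<lambda>z. ennreal ((cmod (deriv f z))\<^sup>2 * (1 - (cmod (disk_involution w z))\<^sup>2) powr p) *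
    indicator unit_disk z) \<in> borel_measurable borel"
proof (rule borel_measurable_indicator_disk)
  have "1 - cnj w * z \<noteq> 0" if "z \<in> unit_disk" for z
    using mobius_defect(2)[of w z] assms that by auto
  moreover have "1 - (cmod (disk_involution w z))\<^sup>2 \<noteq> 0" if "z \<in> unit_disk" for z
    using mobius_defect_pos[of w z] assms that by auto
  ultimately show "continuous_on unit_disk
      (\<lambda>z. (cmod (deriv f z))\<^sup>2 * (1 - (cmod (disk_involution w z))\<^sup>2) powr p)"
    unfolding disk_involution_def
    by (intro continuous_intros continuous_on_deriv_disk assms) auto
qed

text \<open>The supremum in the $Q_p$-norm is used by choosing $w$: wherever a weight $u$ is dominated by
the weight belonging to $w$, the energy with weight $u$ is controlled.\<close>

lemma weighted_energy_le:
  assumes f: "Qp_bounded_by p f B" and w: "cmod w < 1" and "0 < c" "0 \<le> p"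
    and le: "\<And>z. z \<in> A \<Longrightarrow> cmod z < 1 \<and> 0 \<le> u z \<and> u z \<le> c * (1 - (cmod (disk_involution w z))\<^sup>2)"
  shows "(\<integral>\<^sup>+z\<in>A. ennreal ((cmod (deriv f z))\<^sup>2 * u z powr p) \<partial>lborel) \<le> ennreal (c powr p * B\<^sup>2)"
proof -
  let ?g = "\<lambda>z. ennreal ((cmod (deriv f z))\<^sup>2 * (1 - (cmod (disk_involution w z))\<^sup>2) powr p) *
    indicator unit_disk z"
  have meas: "?g \<in> borel_measurable borel"
    using f w by (intro Qp_integrand_measurable) (auto simp: Qp_bounded_by_def)
  have "(\<integral>\<^sup>+z\<in>A. ennreal ((cmod (deriv f z))\<^sup>2 * u z powr p) \<partial>lborel)
      \<le> (\<integral>\<^sup>+z. ennreal (c powr p) * ?g z \<partial>lborel)"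
  proof (rule nn_integral_mono)
    fix z
    show "ennreal ((cmod (deriv f z))\<^sup>2 * u z powr p) * indicator A z \<le> ennreal (c powr p) * ?g z"
    proof (cases "z \<in> A")
      case True
      let ?W = "1 - (cmod (disk_involution w z))\<^sup>2"
      have z: "cmod z < 1" "0 \<le> u z" "u z \<le> c * ?W" using le[OF True] by auto
      have W: "0 < ?W" using w z by (intro mobius_defect_pos)
      have "u z powr p \<le> (c * ?W) powr p" using z assms by (intro powr_mono2) auto
      also have "\<dots> = c powr p * ?W powr p" using W assms by (simp add: powr_mult)
      finally have "(cmod (deriv f z))\<^sup>2 * u z powr p \<le> c powr p * ((cmod (deriv f z))\<^sup>2 * ?W powr p)"
        using mult_left_mono[of "u z powr p" "c powr p * ?W powr p" "(cmod (deriv f z))\<^sup>2"]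
        by (simp add: mult_ac)
      then show ?thesis using True z by (simp add: ennreal_mult'[symmetric] ennreal_leI)
    qed simp
  qed
  also have "\<dots> = ennreal (c powr p) * Qp_energy p f w"
    unfolding Qp_energy_def using meas by (intro nn_integral_cmult) simp
  also have "\<dots> \<le> ennreal (c powr p) * ennreal (B\<^sup>2)"
    using f w by (intro mult_left_mono) (auto simp: Qp_bounded_by_def)
  finally show ?thesis by (simp add: ennreal_mult'[symmetric])
qed

text \<open>The sub-mean value inequality for $(f')^2$ bounds $f'$ on the half-size disk, and the mean
value inequality then bounds the increment. The scale disappears, since area scales like the square of
length.\<close>

lemma oscillation_le_local_energy:
  assumes f: "f holomorphic_on unit_disk" and v: "cmod v < 1" and u: "cmod (u - v) \<le> (1 - cmod v) / 2"
  shows "ennreal ((cmod (f u - f v))\<^sup>2) \<le> ennreal (4 / pi) *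
    (\<integral>\<^sup>+z\<in>ball v (3 / 4 * (1 - cmod v)). ennreal ((cmod (deriv f z))\<^sup>2) \<partial>lborel)"
proof -
  define r where "r = 1 - cmod v"
  have r: "0 < r" using v by (simp add: r_def)
  define A where "A = (\<integral>\<^sup>+z\<in>ball v (3 / 4 * r). ennreal ((cmod (deriv f z))\<^sup>2) \<partial>lborel)"
  have disk: "x \<in> unit_disk" if "cmod (x - v) < r" for x
    using that norm_triangle_ineq[of "x - v" v] by (simp add: r_def)
  have hol': "deriv f holomorphic_on unit_disk" using f by (intro holomorphic_deriv) auto
  have mean: "ennreal (pi * (r / 4)\<^sup>2 * (cmod (deriv f x))\<^sup>2) \<le> A" if x: "x \<in> cball v (r / 2)" for x
  proof -
    have sub: "ball x (r / 4) \<subseteq> ball v (3 / 4 * r)"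
    proof
      fix y assume "y \<in> ball x (r / 4)"
      then show "y \<in> ball v (3 / 4 * r)" using x dist_triangle[of v y x] by simp
    qed
    moreover have "ball v (3 / 4 * r) \<subseteq> unit_disk"
      using r by (intro subsetI disk) (auto simp: dist_norm norm_minus_commute)
    ultimately have "deriv f holomorphic_on ball x (r / 4)"
      by (intro holomorphic_on_subset[OF hol']) blast
    then have "(\<lambda>z. (deriv f z)\<^sup>2) holomorphic_on ball x (r / 4)"
      by (intro holomorphic_on_power)
    then have "ennreal (pi * (r / 4)\<^sup>2 * cmod ((deriv f x)\<^sup>2)) \<le>
        (\<integral>\<^sup>+z\<in>ball x (r / 4). ennreal (cmod ((deriv f z)\<^sup>2)) \<partial>lborel)"
      using r by (intro area_sub_mean) auto
    also have "\<dots> \<le> A" unfolding A_def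
      using sub by (intro nn_integral_mono) (auto simp: norm_power indicator_def)
    finally show ?thesis by (simp add: norm_power)
  qed
  show ?thesis
  proof (cases "A")
    case top
    then show ?thesis unfolding A_def[symmetric] r_def[symmetric] by (simp add: ennreal_mult_top)
  next
    case (real a)
    define M where "M = 4 / r * sqrt (a / pi)"
    have bound: "cmod (deriv f x) \<le> M" if x: "x \<in> cball v (r / 2)" for x
    proof -
      have "pi * (r / 4)\<^sup>2 * (cmod (deriv f x))\<^sup>2 \<le> a"
        using mean[OF x] real by simp
      then have "(cmod (deriv f x))\<^sup>2 \<le> (4 / r)\<^sup>2 * (a / pi)"
        using r by (simp add: field_simps power2_eq_square)
      then have "sqrt ((cmod (deriv f x))\<^sup>2) \<le> sqrt ((4 / r)\<^sup>2 * (a / pi))" by (rule real_sqrt_le_mono)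
      then show ?thesis using r by (simp add: M_def real_sqrt_mult real_sqrt_divide)
    qed
    have "cmod (f u - f v) \<le> M * cmod (u - v)"
    proof (rule field_differentiable_bound[where S = "cball v (r / 2)" and f' = "deriv f"])
      fix x assume x: "x \<in> cball v (r / 2)"
      then have "x \<in> unit_disk" using r by (intro disk) (auto simp: dist_norm norm_minus_commute)
      then show "(f has_field_derivative deriv f x) (at x within cball v (r / 2))"
        using holomorphic_derivI[OF f, of x] by simp
    qed (use bound u r in \<open>auto simp: r_def dist_norm norm_minus_commute\<close>)
    also have "\<dots> \<le> M * (r / 2)" using u r real by (intro mult_left_mono) (auto simp: r_def M_def)
    also have "\<dots> = 2 * sqrt (a / pi)" using r by (simp add: M_def)
    finally have "(cmod (f u - f v))\<^sup>2 \<le> (2 * sqrt (a / pi))\<^sup>2" by (intro power_mono) auto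
    also have "\<dots> = 4 / pi * a" using real by (simp add: power_mult_distrib)
    finally show ?thesis
      unfolding A_def[symmetric] r_def[symmetric] using real
      by (simp add: ennreal_mult'[symmetric] ennreal_leI)
  qed
qed

text \<open>The choice $w = v$: on a disk around $v$ that stays away from the circle, the weight is bounded
below by a constant.\<close>

lemma local_energy_le:
  assumes f: "Qp_bounded_by p f B" and "0 \<le> p" and v: "cmod v < 1"
  shows "(\<integral>\<^sup>+z\<in>ball v (3 / 4 * (1 - cmod v)). ennreal ((cmod (deriv f z))\<^sup>2) \<partial>lborel)
    \<le> ennreal (36 powr p * B\<^sup>2)"
proof -
  have "(\<integral>\<^sup>+z\<in>ball v (3 / 4 * (1 - cmod v)). ennreal ((cmod (deriv f z))\<^sup>2 * 1 powr p) \<partial>lborel)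
    \<le> ennreal (36 powr p * B\<^sup>2)"
  proof (rule weighted_energy_le[OF f v _ \<open>0 \<le> p\<close>])
    fix z assume z: "z \<in> ball v (3 / 4 * (1 - cmod v))"
    define r where "r = 1 - cmod v"
    have r: "0 < r" using v by (simp add: r_def)
    have d: "cmod (z - v) < 3 / 4 * r" using z by (simp add: r_def dist_norm norm_minus_commute)
    have "cmod z \<le> cmod (z - v) + cmod v" using norm_triangle_ineq[of "z - v" v] by simp
    then have z1: "r / 4 \<le> 1 - cmod z" using d by (simp add: r_def)
    have "1 - cnj v * z = (1 - of_real ((cmod v)\<^sup>2)) - cnj v * (z - v)"
      using complex_norm_square[of v] by (simp add: algebra_simps)
    then have "cmod (1 - cnj v * z) \<le> cmod (1 - of_real ((cmod v)\<^sup>2)) + cmod (cnj v * (z - v))"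
      by (metis norm_triangle_ineq4)
    also have "cmod (1 - of_real ((cmod v)\<^sup>2)) = 1 - (cmod v)\<^sup>2"
    proof -
      have "1 - complex_of_real ((cmod v)\<^sup>2) = of_real (1 - (cmod v)\<^sup>2)" by simp
      then show ?thesis using v by (simp only: norm_of_real) (simp add: abs_square_le_1)
    qed
    also have "1 - (cmod v)\<^sup>2 \<le> 2 * r"
    proof -
      have "1 - (cmod v)\<^sup>2 = (1 + cmod v) * r" by (simp add: r_def power2_eq_square algebra_simps)
      also have "\<dots> \<le> 2 * r" using v r by (intro mult_right_mono) auto
      finally show ?thesis .
    qed
    also have "cmod (cnj v * (z - v)) \<le> 1 * r"
      using v d r unfolding norm_mult complex_mod_cnj by (intro mult_mono) auto
    finally have R: "cmod (1 - cnj v * z) \<le> 3 * r" by simp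
    have "1 / 36 = r * (r / 4) / (3 * r)\<^sup>2" using r by (simp add: power2_eq_square)
    also have "\<dots> \<le> (1 - cmod v) * (1 - cmod z) / (3 * r)\<^sup>2"
      using z1 r by (intro divide_right_mono mult_mono) (auto simp: r_def)
    also have "\<dots> \<le> 1 - (cmod (disk_involution v z))\<^sup>2"
      using z1 r R v by (intro mobius_defect_ge) auto
    finally show "cmod z < 1 \<and> 0 \<le> (1::real) \<and> 1 \<le> 36 * (1 - (cmod (disk_involution v z))\<^sup>2)"
      using z1 r by auto
  qed simp
  then show ?thesis by simp
qed

text \<open>The choice $w = (1-h)\<xi>$: the measure $|f'|^2 (1-|z|)^p dm$ is a $p$-Carleson measure, here on
balls of radius $10h$ around $\<xi>$. The factor 10 is what the exchange of integrals below requires.\<close>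

lemma carleson_energy_le:
  assumes f: "Qp_bounded_by p f B" and "0 \<le> p" and \<xi>: "cmod \<xi> = 1" and h: "0 < h" "h \<le> 1"
  shows "(\<integral>\<^sup>+z\<in>unit_disk \<inter> cball \<xi> (10 * h). ennreal ((cmod (deriv f z))\<^sup>2 * (1 - cmod z) powr p) \<partial>lborel)
    \<le> ennreal ((121 * h) powr p * B\<^sup>2)"
proof -
  define w where "w = of_real (1 - h) * \<xi>"
  have nw: "cmod w = 1 - h" using h \<xi> by (simp add: w_def norm_mult del: of_real_diff)
  show ?thesis
  proof (rule weighted_energy_le[OF f, where w = w])
    fix z assume z: "z \<in> unit_disk \<inter> cball \<xi> (10 * h)"
    have "\<xi> - w = of_real h * \<xi>" by (simp add: w_def algebra_simps)
    then have "cmod (\<xi> - w) = h" using h \<xi> by (simp add: norm_mult)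
    then have "cmod (1 - cnj w * z) \<le> 11 * h"
      using cmod_one_minus_cnj_mult_le[of \<xi> z w] z \<xi> by (auto simp: dist_norm)
    then have "(1 - cmod w) * (1 - cmod z) / (11 * h)\<^sup>2 \<le> 1 - (cmod (disk_involution w z))\<^sup>2"
      using z nw h by (intro mobius_defect_ge) auto
    moreover have "(1 - cmod w) * (1 - cmod z) / (11 * h)\<^sup>2 = (1 - cmod z) / (121 * h)"
      using h by (simp add: nw power2_eq_square)
    ultimately have "1 - cmod z \<le> (1 - (cmod (disk_involution w z))\<^sup>2) * (121 * h)"
      using h by (simp only: pos_divide_le_eq)
    then show "cmod z < 1 \<and> 0 \<le> 1 - cmod z \<and> 1 - cmod z \<le> 121 * h * (1 - (cmod (disk_involution w z))\<^sup>2)"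
      using z by (simp add: mult_ac)
  qed (use nw h assms in auto)
qed

section \<open>Telescoping along a radius\<close>

text \<open>The point at height $2^{-j}$ on the radius through $z$; for $j = 0$ it is the origin, also when
$z = 0$ and the radius is not determined.\<close>

definition radial_point :: "nat \<Rightarrow> complex \<Rightarrow> complex" where
  "radial_point j z = of_real (1 - (1 / 2) ^ j) * sgn z"

lemma cmod_radial_point:
  assumes "1 - cmod z \<le> (1 / 2) ^ j"
  shows "cmod (radial_point j z) = 1 - (1 / 2) ^ j"
proof (cases "z = 0")
  case True
  then have "1 \<le> (1 / 2 :: real) ^ j" using assms by simp
  moreover have "(1 / 2 :: real) ^ j \<le> 1" by (simp add: power_le_one)
  ultimately show ?thesis by (simp add: radial_point_def)
next
  case False
  have "(1 / 2 :: real) ^ j \<le> 1" by (simp add: power_le_one)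
  then show ?thesis using False by (simp add: radial_point_def norm_mult norm_sgn del: of_real_diff)
qed

lemma cmod_sub_radial_point:
  assumes "1 - cmod z \<le> (1 / 2) ^ j" "cmod z < 1"
  shows "cmod (z - radial_point j z) = (1 / 2) ^ j - (1 - cmod z)"
proof -
  have "z - radial_point j z = of_real (cmod z - (1 - (1 / 2) ^ j)) * sgn z"
    by (cases "z = 0") (auto simp: radial_point_def sgn_eq algebra_simps)
  then have "cmod (z - radial_point j z) = \<bar>cmod z - (1 - (1 / 2) ^ j)\<bar> * cmod (sgn z)"
    by (simp only: norm_mult norm_of_real)
  moreover have "1 \<le> (1 / 2 :: real) ^ j \<Longrightarrow> (1 / 2 :: real) ^ j = 1"
    using power_le_one[of "1 / 2 :: real" j] by linarith
  ultimately show ?thesis using assms by (cases "z = 0") (auto simp: norm_sgn)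
qed

lemma exists_dyadic_scale:
  fixes y :: real
  assumes "0 < y" "y \<le> 1"
  obtains n where "(1 / 2) ^ Suc n < y" "y \<le> (1 / 2) ^ n"
proof -
  obtain k where k: "(1 / 2 :: real) ^ k < y"
    using real_arch_pow_inv[of y "1 / 2"] assms by auto
  define n where "n = (LEAST n. (1 / 2 :: real) ^ Suc n < y)"
  have "(1 / 2 :: real) ^ Suc k \<le> (1 / 2) ^ k" by simp
  then have "(1 / 2 :: real) ^ Suc k < y" using k by linarith
  then have 1: "(1 / 2 :: real) ^ Suc n < y"
    unfolding n_def by (rule LeastI)
  have 2: "y \<le> (1 / 2) ^ n"
  proof (cases n)
    case (Suc m)
    then have "\<not> (1 / 2 :: real) ^ Suc m < y"
      using not_less_Least[of m "\<lambda>n. (1 / 2 :: real) ^ Suc n < y"] by (simp add: n_def)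
    then show ?thesis using Suc by simp
  qed (use assms in simp)
  show ?thesis using that 1 2 .
qed

definition dyadic_energy :: "(complex \<Rightarrow> complex) \<Rightarrow> nat \<Rightarrow> complex \<Rightarrow> ennreal" where
  "dyadic_energy f j z =
     (\<integral>\<^sup>+\<eta>\<in>ball (radial_point j z) (3 / 4 * (1 / 2) ^ j). ennreal ((cmod (deriv f \<eta>))\<^sup>2) \<partial>lborel)"

text \<open>The weights $(j+1)^2$ in the Cauchy-Schwarz inequality have summable inverses.\<close>

lemma sum_inverse_squares_le: "(\<Sum>j\<in>{m..n}. (1 / (real j + 1))\<^sup>2) \<le> 2"
proof -
  have "(\<Sum>j\<in>{m..n}. (1 / (real j + 1))\<^sup>2) \<le> (\<Sum>j. 1 / (real (Suc j))\<^sup>2)"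
    using sums_summable[OF inverse_squares_sums]
    by (subst power_one_over) (auto intro!: sum_le_suminf simp: add_ac power_divide)
  also have "\<dots> = pi\<^sup>2 / 6" using inverse_squares_sums by (simp add: sums_iff add_ac)
  also have "\<dots> \<le> 2"
  proof -
    have "pi\<^sup>2 \<le> 3.2\<^sup>2" using pi_approx by (intro power_mono) auto
    then show ?thesis by (simp add: power2_eq_square)
  qed
  finally show ?thesis .
qed

text \<open>The numbers $d_j$ are the moduli of the increments of $f$ along the radius: from height $2^{-j}$ to
height $2^{-j-1}$ for $j < n$, and from height $2^{-n}$ to $z$ for $j = n$. They have an individual bound,
which gives logarithmic growth, and a bound by local energies, which is finer when integrated.\<close>

lemma radial_chain:
  assumes f: "Qp_bounded_by p f B" and "0 \<le> p"
    and z: "cmod z < 1" and n: "(1 / 2) ^ Suc n < 1 - cmod z" "1 - cmod z \<le> (1 / 2) ^ n"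
  obtains d :: "nat \<Rightarrow> real" where
    "\<And>j. 0 \<le> d j"
    "\<And>j. j \<le> n \<Longrightarrow> ennreal ((d j)\<^sup>2) \<le> ennreal (4 / pi) * dyadic_energy f j z"
    "\<And>j. j \<le> n \<Longrightarrow> d j \<le> 2 * 6 powr p * B"
    "\<And>m. m \<le> n \<Longrightarrow> cmod (f z) \<le> B + (\<Sum>j<m. d j) + (\<Sum>j\<in>{m..n}. d j)"
proof -
  have B: "0 \<le> B" and hol: "f holomorphic_on unit_disk" and f0: "cmod (f 0) \<le> B"
    using f by (auto simp: Qp_bounded_by_def)
  define d where "d j = (if j < n then cmod (f (radial_point (Suc j) z) - f (radial_point j z))
    else cmod (f z - f (radial_point n z)))" for j
  have le: "1 - cmod z \<le> (1 / 2) ^ j" if "j \<le> n" for j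
  proof -
    have "(1 / 2 :: real) ^ n \<le> (1 / 2) ^ j" using that by (intro power_decreasing) auto
    then show ?thesis using n(2) by linarith
  qed
  have E: "ennreal ((d j)\<^sup>2) \<le> ennreal (4 / pi) * dyadic_energy f j z" if j: "j \<le> n" for j
  proof -
    let ?v = "radial_point j z"
    have v: "cmod ?v = 1 - (1 / 2) ^ j" using cmod_radial_point le[OF j] by auto
    define u where "u = (if j < n then radial_point (Suc j) z else z)"
    have "cmod (u - ?v) \<le> (1 - cmod ?v) / 2"
    proof (cases "j < n")
      case True
      have "u - ?v = of_real ((1 / 2) ^ Suc j) * sgn z"
        using True by (simp add: u_def radial_point_def algebra_simps)
      then have "cmod (u - ?v) = (1 / 2) ^ Suc j * cmod (sgn z)"
        by (simp only: norm_mult norm_of_real) simp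
      also have "\<dots> \<le> (1 / 2) ^ Suc j" by (simp add: norm_sgn)
      finally show ?thesis by (simp add: v)
    next
      case False
      then have "j = n" using j by simp
      then show ?thesis using cmod_sub_radial_point[OF n(2) z] n(1) False v by (simp add: u_def)
    qed
    moreover have "(1 / 2 :: real) ^ j > 0" by simp
    then have "cmod ?v < 1" unfolding v by linarith
    ultimately have "ennreal ((cmod (f u - f ?v))\<^sup>2) \<le> ennreal (4 / pi) * dyadic_energy f j z"
      unfolding dyadic_energy_def using oscillation_le_local_energy[OF hol, of ?v u] v by simp
    then show ?thesis using j by (cases "j < n") (auto simp: d_def u_def)
  qed
  have bound: "d j \<le> 2 * 6 powr p * B" if j: "j \<le> n" for j
  proof -
    have v: "cmod (radial_point j z) = 1 - (1 / 2) ^ j" using cmod_radial_point le[OF j] by auto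
    moreover have "(1 / 2 :: real) ^ j > 0" by simp
    ultimately have v1: "cmod (radial_point j z) < 1" by linarith
    have "dyadic_energy f j z \<le> ennreal (36 powr p * B\<^sup>2)"
      unfolding dyadic_energy_def using local_energy_le[OF f \<open>0 \<le> p\<close> v1] v by simp
    then have "ennreal ((d j)\<^sup>2) \<le> ennreal (4 / pi) * ennreal (36 powr p * B\<^sup>2)"
      by (intro order_trans[OF E[OF j]] mult_left_mono) auto
    then have "(d j)\<^sup>2 \<le> 4 / pi * (36 powr p * B\<^sup>2)"
      by (simp add: ennreal_mult'[symmetric] ennreal_le_iff)
    also have "\<dots> \<le> 4 * (36 powr p * B\<^sup>2)"
      using pi_gt3 by (intro mult_right_mono) (auto simp: field_simps)
    also have "36 powr p = (6 powr p)\<^sup>2"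
      using powr_mult[of 6 6 p] by (simp add: power2_eq_square)
    also have "4 * ((6 powr p)\<^sup>2 * B\<^sup>2) = (2 * 6 powr p * B)\<^sup>2" by (simp add: power_mult_distrib)
    finally show ?thesis by (rule power2_le_imp_le) (use B in simp)
  qed
  have total: "cmod (f z) \<le> B + (\<Sum>j<m. d j) + (\<Sum>j\<in>{m..n}. d j)" if m: "m \<le> n" for m
  proof -
    have "f z - f 0 = (f z - f (radial_point n z)) + (\<Sum>j<n. f (radial_point (Suc j) z) - f (radial_point j z))"
      by (subst sum_lessThan_telescope) (simp add: radial_point_def)
    then have eq: "f z = f 0 + (f z - f (radial_point n z)) + (\<Sum>j<n. f (radial_point (Suc j) z) - f (radial_point j z))"
      by (simp add: algebra_simps)
    have tri: "cmod (a + b + c) \<le> cmod a + cmod b + cmod c" for a b c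
      using norm_triangle_ineq[of "a + b" c] norm_triangle_ineq[of a b] by linarith
    have "cmod (f z) \<le> cmod (f 0) + cmod (f z - f (radial_point n z)) +
        cmod (\<Sum>j<n. f (radial_point (Suc j) z) - f (radial_point j z))"
      by (rule ord_eq_le_trans[OF arg_cong[of _ _ cmod, OF eq] tri])
    also have "\<dots> \<le> B + d n + (\<Sum>j<n. d j)"
      using f0 by (intro add_mono order_trans[OF norm_sum] sum_mono) (auto simp: d_def)
    also have "\<dots> = B + (\<Sum>j<Suc n. d j)" by simp
    also have "(\<Sum>j<Suc n. d j) = (\<Sum>j<m. d j) + (\<Sum>j\<in>{m..n}. d j)"
    proof -
      have "{..<Suc n} = {..<m} \<union> {m..n}" using m by auto
      then have "(\<Sum>j<Suc n. d j) = (\<Sum>j\<in>{..<m} \<union> {m..n}. d j)" by (simp only:)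
      also have "\<dots> = (\<Sum>j<m. d j) + (\<Sum>j\<in>{m..n}. d j)" by (rule sum.union_disjoint) auto
      finally show ?thesis .
    qed
    finally show ?thesis by simp
  qed
  show ?thesis
    by (rule that[of d]) (use E bound total in \<open>auto simp: d_def\<close>)
qed

text \<open>Members of $Q_p$ grow at most logarithmically; in particular, bounded sets in $Q_p$ are locally
bounded, as Montel's theorem requires.\<close>

lemma Qp_growth:
  assumes f: "Qp_bounded_by p f B" and "0 \<le> p" and N: "(1 / 2) ^ Suc N < 1 - cmod z"
  shows "cmod (f z) \<le> (1 + 2 * 6 powr p) * (real N + 2) * B"
proof -
  have B: "0 \<le> B" using f by (simp add: Qp_bounded_by_def)
  have "(1 / 2 :: real) ^ Suc N > 0" by simp
  then have z: "cmod z < 1" using N by linarith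
  obtain n where n: "(1 / 2) ^ Suc n < 1 - cmod z" "1 - cmod z \<le> (1 / 2) ^ n"
    by (rule exists_dyadic_scale[of "1 - cmod z"]) (use z in auto)
  have "(1 / 2 :: real) ^ Suc N < (1 / 2) ^ n" using n N by linarith
  then have nN: "n \<le> N" by (simp add: power_strict_decreasing_iff del: power_Suc)
  obtain d where d: "\<And>j. j \<le> n \<Longrightarrow> d j \<le> 2 * 6 powr p * B"
    "\<And>m. m \<le> n \<Longrightarrow> cmod (f z) \<le> B + (\<Sum>j<m. d j) + (\<Sum>j\<in>{m..n}. d j)"
    using radial_chain[OF f \<open>0 \<le> p\<close> z n] by metis
  have "cmod (f z) \<le> B + (\<Sum>j\<in>{0..n}. d j)" using d(2)[of 0] by simp
  moreover have "(\<Sum>j\<in>{0..n}. d j) \<le> (\<Sum>j\<in>{0..n}. 2 * 6 powr p * B)"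
    using d(1) by (intro sum_mono) auto
  moreover have "\<dots> \<le> (real N + 2) * (2 * 6 powr p * B)"
    using nN B by (simp add: mult_right_mono)
  moreover have "B \<le> (real N + 2) * B" using B mult_right_mono[of 1 "real N + 2" B] by simp
  ultimately have "cmod (f z) \<le> (real N + 2) * B + (real N + 2) * (2 * 6 powr p * B)" by linarith
  then show ?thesis by (simp add: algebra_simps)
qed

text \<open>The coarse increments, with $j < m$, are summed with their individual bounds and give the first
term. The fine ones are treated by the Cauchy-Schwarz inequality with the weights $(j+1)^2$.\<close>

lemma square_le_dyadic_energies:
  assumes f: "Qp_bounded_by p f B" and "0 \<le> p"
    and z: "cmod z < 1" and m: "1 - cmod z \<le> (1 / 2) ^ m"
  shows "ennreal ((cmod (f z))\<^sup>2) \<le> ennreal (2 * ((1 + 2 * 6 powr p) * (real m + 1) * B)\<^sup>2) +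
    (\<Sum>j. ennreal (16 / pi * (real j + 1)\<^sup>2) *
      (if m \<le> j \<and> 1 - cmod z \<le> (1 / 2) ^ j then dyadic_energy f j z else 0))"
proof -
  have B: "0 \<le> B" using f by (simp add: Qp_bounded_by_def)
  obtain n where n: "(1 / 2) ^ Suc n < 1 - cmod z" "1 - cmod z \<le> (1 / 2) ^ n"
    by (rule exists_dyadic_scale[of "1 - cmod z"]) (use z in auto)
  have "(1 / 2 :: real) ^ Suc n < (1 / 2) ^ m" using n m by linarith
  then have mn: "m \<le> n" by (simp add: power_strict_decreasing_iff del: power_Suc)
  obtain d where d0: "\<And>j. 0 \<le> d j"
    and dE: "\<And>j. j \<le> n \<Longrightarrow> ennreal ((d j)\<^sup>2) \<le> ennreal (4 / pi) * dyadic_energy f j z"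
    and dB: "\<And>j. j \<le> n \<Longrightarrow> d j \<le> 2 * 6 powr p * B"
    and tot: "\<And>m. m \<le> n \<Longrightarrow> cmod (f z) \<le> B + (\<Sum>j<m. d j) + (\<Sum>j\<in>{m..n}. d j)"
    using radial_chain[OF f \<open>0 \<le> p\<close> z n] by metis
  define S where "S = (\<Sum>j\<in>{m..n}. d j)"
  define L where "L = (1 + 2 * 6 powr p) * (real m + 1) * B"
  have L: "0 \<le> L" using B by (simp add: L_def)
  have S: "0 \<le> S" using d0 by (simp add: S_def sum_nonneg)
  have "(\<Sum>j<m. d j) \<le> (\<Sum>j<m. 2 * 6 powr p * B)" using dB mn by (intro sum_mono) auto
  then have "B + (\<Sum>j<m. d j) \<le> B + real m * (2 * 6 powr p * B)" by simp
  also have "\<dots> \<le> L"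
    unfolding L_def using B by (simp add: algebra_simps)
  finally have "cmod (f z) \<le> L + S" using tot[OF mn] by (simp add: S_def)
  then have "(cmod (f z))\<^sup>2 \<le> (L + S)\<^sup>2" by (intro power_mono) auto
  also have "\<dots> \<le> 2 * L\<^sup>2 + 2 * S\<^sup>2"
    using zero_le_power2[of "L - S"] by (simp add: power2_eq_square algebra_simps)
  also have "S\<^sup>2 \<le> 2 * (\<Sum>j\<in>{m..n}. ((real j + 1) * d j)\<^sup>2)"
  proof -
    have "S = (\<Sum>j\<in>{m..n}. 1 / (real j + 1) * ((real j + 1) * d j))"
      unfolding S_def by (intro sum.cong) (auto simp: field_simps)
    then have "S\<^sup>2 \<le> (\<Sum>j\<in>{m..n}. (1 / (real j + 1))\<^sup>2) * (\<Sum>j\<in>{m..n}. ((real j + 1) * d j)\<^sup>2)"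
      by (metis Cauchy_Schwarz_ineq_sum)
    also have "\<dots> \<le> 2 * (\<Sum>j\<in>{m..n}. ((real j + 1) * d j)\<^sup>2)"
      by (intro mult_right_mono sum_inverse_squares_le sum_nonneg) auto
    finally show ?thesis .
  qed
  finally have "(cmod (f z))\<^sup>2 \<le> 2 * L\<^sup>2 + (\<Sum>j\<in>{m..n}. 4 * (real j + 1)\<^sup>2 * (d j)\<^sup>2)"
    by (simp add: power_mult_distrib sum_distrib_left mult_ac)
  then have "ennreal ((cmod (f z))\<^sup>2) \<le> ennreal (2 * L\<^sup>2) + (\<Sum>j\<in>{m..n}. ennreal (4 * (real j + 1)\<^sup>2 * (d j)\<^sup>2))"
    by (subst sum_ennreal) (auto simp flip: ennreal_plus simp: sum_nonneg intro: ennreal_leI)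
  also have "(\<Sum>j\<in>{m..n}. ennreal (4 * (real j + 1)\<^sup>2 * (d j)\<^sup>2)) \<le>
      (\<Sum>j\<in>{m..n}. ennreal (16 / pi * (real j + 1)\<^sup>2) *
        (if m \<le> j \<and> 1 - cmod z \<le> (1 / 2) ^ j then dyadic_energy f j z else 0))"
  proof (rule sum_mono)
    fix j assume j: "j \<in> {m..n}"
    have "(1 / 2 :: real) ^ n \<le> (1 / 2) ^ j" using j by (intro power_decreasing) auto
    then have "1 - cmod z \<le> (1 / 2) ^ j" using n(2) by linarith
    moreover have "ennreal (4 * (real j + 1)\<^sup>2 * (d j)\<^sup>2) \<le>
        ennreal (4 * (real j + 1)\<^sup>2) * (ennreal (4 / pi) * dyadic_energy f j z)"
      using dE[of j] j by (subst ennreal_mult') (auto intro!: mult_left_mono)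
    moreover have "\<dots> = ennreal (16 / pi * (real j + 1)\<^sup>2) * dyadic_energy f j z"
      by (simp add: mult.assoc[symmetric] ennreal_mult'[symmetric] mult_ac)
    ultimately show "ennreal (4 * (real j + 1)\<^sup>2 * (d j)\<^sup>2) \<le> ennreal (16 / pi * (real j + 1)\<^sup>2) *
        (if m \<le> j \<and> 1 - cmod z \<le> (1 / 2) ^ j then dyadic_energy f j z else 0)"
      using j by simp
  qed
  also have "\<dots> \<le> (\<Sum>j. ennreal (16 / pi * (real j + 1)\<^sup>2) *
        (if m \<le> j \<and> 1 - cmod z \<le> (1 / 2) ^ j then dyadic_energy f j z else 0))"
    by (intro sum_le_suminf) auto
  finally show ?thesis by (simp add: L_def add_left_mono)
qed

section \<open>The embedding for logarithmic Carleson measures\<close>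

abbreviation (input) disk_borel :: "complex measure" where
  "disk_borel \<equiv> restrict_space borel unit_disk"

abbreviation (input) dyadic_ball :: "complex \<Rightarrow> nat \<Rightarrow> complex set" where
  "dyadic_ball \<xi> j \<equiv> unit_disk \<inter> cball \<xi> (8 * (1 / 2) ^ j)"

abbreviation (input) log_scale :: "real \<Rightarrow> real \<Rightarrow> nat \<Rightarrow> ennreal" where
  "log_scale p K j \<equiv> ennreal (K * ((1 / 2) ^ j) powr p / (real j + 1)\<^sup>2)"

text \<open>The logarithmic $p$-Carleson condition on balls: $j + 1$ is comparable to the logarithm of
$2/|I|$ for an arc $I$ of length $2^{-j}$. For $j = 0$ the ball contains the disk, so the condition bounds the
total mass.\<close>

definition dyadic_log_carleson :: "real \<Rightarrow> complex measure \<Rightarrow> real \<Rightarrow> bool" where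
  "dyadic_log_carleson p M K \<longleftrightarrow> 0 \<le> K \<and> (\<forall>\<xi> j. cmod \<xi> = 1 \<longrightarrow>
     emeasure M (dyadic_ball \<xi> j) \<le>
       log_scale p K j)"

text \<open>A measurable set of size $2^{-m}$ that contains every Carleson square of comparable size at
$\<xi>$; its points lie at height at most $2^{-m}$, as the telescoping from height $2^{-m}$ requires.\<close>

definition dyadic_box :: "complex \<Rightarrow> nat \<Rightarrow> complex set" where
  "dyadic_box \<xi> m = {z \<in> unit_disk. 1 - cmod z \<le> (1 / 2) ^ m \<and> cmod (z - \<xi>) \<le> 8 * (1 / 2) ^ m}"

lemma half_powr_less_one: "0 < p \<Longrightarrow> (1 / 2 :: real) powr p < 1"
  using powr_less_mono2[of p "1 / 2" 1] by simp

text \<open>A geometric sum is comparable to its largest term.\<close>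

lemma suminf_dyadic_powr_le:
  fixes p x :: real
  assumes "0 < p" "0 < x"
  shows "(\<Sum>j. if (1 / 2) ^ j < 4 * x then ennreal (((1 / 2) ^ j) powr p) else 0) \<le>
    ennreal (4 powr p / (1 - (1 / 2) powr p) * x powr p)"
proof -
  define q :: real where "q = (1 / 2) powr p"
  have q: "0 < q" "q < 1" using assms by (auto simp: q_def half_powr_less_one)
  have qj: "((1 / 2 :: real) ^ j) powr p = q ^ j" for j
    unfolding q_def by (simp add: powr_realpow[symmetric] powr_powr mult.commute)
  obtain k0 where "(1 / 2 :: real) ^ k0 < 4 * x"
    using real_arch_pow_inv[of "4 * x" "1 / 2"] assms by auto
  define k where "k = (LEAST j. (1 / 2 :: real) ^ j < 4 * x)"
  have k: "(1 / 2 :: real) ^ k < 4 * x"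
    unfolding k_def by (rule LeastI[of _ k0]) fact
  have least: "k \<le> j" if "(1 / 2 :: real) ^ j < 4 * x" for j
    unfolding k_def using that by (rule Least_le)
  have "(\<Sum>j<n. if k \<le> j then q ^ j else 0) * (1 - q) = (if k \<le> n then q ^ k - q ^ n else 0)" for n
  proof (induction n)
    case (Suc n)
    have "(\<Sum>j<Suc n. if k \<le> j then q ^ j else 0) * (1 - q) =
        (\<Sum>j<n. if k \<le> j then q ^ j else 0) * (1 - q) + (if k \<le> n then q ^ n else 0) * (1 - q)"
      by (simp only: sum.lessThan_Suc distrib_right)
    then show ?case
      unfolding Suc.IH by (cases "k \<le> n"; cases "k = Suc n") (auto simp: right_diff_distrib)
  qed auto
  then have part: "(\<Sum>j<n. if k \<le> j then q ^ j else 0) \<le> q ^ k / (1 - q)" for n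
    using q by (simp add: pos_le_divide_eq)
  have "(\<Sum>j. if (1 / 2) ^ j < 4 * x then ennreal (((1 / 2) ^ j) powr p) else 0) \<le> ennreal (q ^ k / (1 - q))"
  proof (rule suminf_le_const)
    fix n
    have "(\<Sum>j<n. if (1 / 2) ^ j < 4 * x then ennreal (((1 / 2) ^ j) powr p) else 0) \<le>
        (\<Sum>j<n. ennreal (if k \<le> j then q ^ j else 0))"
      using least by (intro sum_mono) (auto simp: qj)
    also have "\<dots> = ennreal (\<Sum>j<n. if k \<le> j then q ^ j else 0)"
      using q by (subst sum_ennreal) auto
    also have "\<dots> \<le> ennreal (q ^ k / (1 - q))" by (intro ennreal_leI part)
    finally show "(\<Sum>j<n. if (1 / 2) ^ j < 4 * x then ennreal (((1 / 2) ^ j) powr p) else 0) \<le> ennreal (q ^ k / (1 - q))" .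
  qed auto
  also have "q ^ k / (1 - q) \<le> 4 powr p / (1 - q) * x powr p"
  proof -
    have "q ^ k \<le> (4 * x) powr p" unfolding qj[symmetric] using k assms by (intro powr_mono2) auto
    also have "\<dots> = 4 powr p * x powr p" using assms by (simp add: powr_mult)
    finally show ?thesis using q by (simp add: divide_right_mono)
  qed
  finally show ?thesis by (simp add: q_def ennreal_leI)
qed

lemma radial_point_measurable [measurable]: "radial_point j \<in> borel_measurable borel"
  unfolding radial_point_def sgn_div_norm by measurable

text \<open>Measures in the statement have the disk as their underlying space; the four parts transfer
measurability from the plane.\<close>

lemma disk_measure_measurable:
  assumes "sets M = sets disk_borel"
  shows "space M = unit_disk" "(\<lambda>z. z) \<in> M \<rightarrow>\<^sub>M borel"
    "A \<in> sets borel \<Longrightarrow> A \<subseteq> unit_disk \<Longrightarrow> A \<in> sets M"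
    "A \<in> sets borel \<Longrightarrow> unit_disk \<inter> A \<in> sets M"
proof -
  show "space M = unit_disk"
    using sets_eq_imp_space_eq[OF assms] by (simp add: space_restrict_space)
  have "(\<lambda>z. z) \<in> restrict_space borel unit_disk \<rightarrow>\<^sub>M (borel :: complex measure)"
    by (rule measurable_restrict_space1) simp
  then show "(\<lambda>z. z) \<in> M \<rightarrow>\<^sub>M borel"
    unfolding measurable_cong_sets[OF assms refl] .
  show "A \<in> sets borel \<Longrightarrow> A \<subseteq> unit_disk \<Longrightarrow> A \<in> sets M"
    unfolding assms by (subst sets_restrict_space_iff) auto
  show "A \<in> sets borel \<Longrightarrow> unit_disk \<inter> A \<in> sets M"
    unfolding assms by (auto simp: sets_restrict_space)
qed

lemma dyadic_box_in_sets:
  assumes "sets M = sets disk_borel"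
  shows "dyadic_box \<xi> m \<in> sets M"
proof -
  have "dyadic_box \<xi> m = unit_disk \<inter> ({z. 1 - cmod z \<le> (1 / 2) ^ m} \<inter> {z. cmod (z - \<xi>) \<le> 8 * (1 / 2) ^ m})"
    by (auto simp: dyadic_box_def)
  also have "\<dots> \<in> sets M" by (intro disk_measure_measurable(4)[OF assms]) measurable
  finally show ?thesis .
qed

lemma dyadic_log_carleson_finite:
  assumes "sets M = sets disk_borel" "dyadic_log_carleson p M K"
  shows "finite_measure M"
proof
  have "unit_disk \<inter> cball (1::complex) (8 * (1 / 2) ^ 0) = unit_disk"
  proof -
    have "unit_disk \<subseteq> cball (1::complex) 8"
    proof
      fix z :: complex assume "z \<in> unit_disk"
      then show "z \<in> cball 1 8" using norm_triangle_ineq4[of 1 z] by (simp add: dist_norm)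
    qed
    then show ?thesis by auto
  qed
  then have "emeasure M (space M) \<le> log_scale p K 0"
    using assms(2) disk_measure_measurable(1)[OF assms(1)] unfolding dyadic_log_carleson_def
    by (metis norm_one)
  then show "emeasure M (space M) \<noteq> \<infinity>" by (auto simp: top_unique)
qed

text \<open>The exchange of integrals at the scale $2^{-j}$. A point $\<eta>$ is charged with the measure of
the set of those $z$ whose radial point at this scale is close to $\<eta>$. This set is contained in a ball of
radius $8 \cdot 2^{-j}$ around the point of the circle nearest to $\<eta>$, and it is empty unless $\<eta>$ has
height more than $2^{-j}/4$ and lies within $10 \cdot 2^{-m}$ of $\<xi>$.\<close>

lemma single_scale:
  fixes m j :: nat
  assumes f: "f holomorphic_on unit_disk"
    and M: "sets M = sets disk_borel"
    and H: "dyadic_log_carleson p M K" and \<xi>: "cmod \<xi> = 1"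
  defines "T \<equiv> \<lambda>z. (if m \<le> j \<and> 1 - cmod z \<le> (1 / 2) ^ j then dyadic_energy f j z else 0) *
      indicator (dyadic_box \<xi> m) z"
  shows "T \<in> borel_measurable M"
    and "(\<integral>\<^sup>+z. T z \<partial>M) \<le> log_scale p K j *
      (\<integral>\<^sup>+\<eta>. (if (1 / 2) ^ j < 4 * (1 - cmod \<eta>) then ennreal ((cmod (deriv f \<eta>))\<^sup>2) else 0) *
        indicator (unit_disk \<inter> cball \<xi> (10 * (1 / 2) ^ m)) \<eta> \<partial>lborel)"
proof -
  define h :: real where "h = (1 / 2) ^ j"
  have h0: "0 < h" by (simp add: h_def)
  define g where "g \<eta> = ennreal ((cmod (deriv f \<eta>))\<^sup>2) * indicator unit_disk \<eta>" for \<eta>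
  have g[measurable]: "g \<in> borel_measurable borel"
    unfolding g_def by (intro borel_measurable_indicator_disk continuous_intros continuous_on_deriv_disk f)
  define G where "G = unit_disk \<inter> cball \<xi> (10 * (1 / 2) ^ m)"
  have [measurable]: "G \<in> sets borel" unfolding G_def by auto
  have gG: "(\<lambda>\<eta>. (if h < 4 * (1 - cmod \<eta>) then g \<eta> else 0) * indicator G \<eta>) \<in> borel_measurable lborel"
    by measurable
  have id[measurable]: "(\<lambda>z. z) \<in> M \<rightarrow>\<^sub>M borel" by (rule disk_measure_measurable(2)[OF M])
  have rad[measurable]: "radial_point j \<in> M \<rightarrow>\<^sub>M borel"
    using measurable_compose[OF id radial_point_measurable] .
  define Q where "Q z \<eta> \<longleftrightarrow> m \<le> j \<and> 1 - cmod z \<le> h \<and> z \<in> dyadic_box \<xi> m \<and>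
    dist (radial_point j z) \<eta> < 3 / 4 * h" for z \<eta>
  define S where "S = {x \<in> space (M \<Otimes>\<^sub>M lborel). Q (fst x) (snd x)}"
  have [measurable]: "dyadic_box \<xi> m \<in> sets M" by (rule dyadic_box_in_sets[OF M])
  have cm[measurable]: "cmod \<in> borel_measurable M" using measurable_compose[OF id, of cmod borel] by simp
  have S[measurable]: "S \<in> sets (M \<Otimes>\<^sub>M (lborel :: complex measure))"
    unfolding S_def Q_def by measurable
  \<comment> \<open>Tonelli's theorem needs a sigma-finite measure\<close>
  interpret M: finite_measure M by (rule dyadic_log_carleson_finite[OF M H])
  interpret pair_sigma_finite M "lborel :: complex measure" ..
  have space: "space M = unit_disk" by (rule disk_measure_measurable(1)[OF M])
  have T: "T z = (\<integral>\<^sup>+\<eta>. g \<eta> * indicator S (z, \<eta>) \<partial>lborel)" if z: "z \<in> space M" for z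
  proof (cases "m \<le> j \<and> 1 - cmod z \<le> h \<and> z \<in> dyadic_box \<xi> m")
    case True
    have sub: "ball (radial_point j z) (3 / 4 * h) \<subseteq> unit_disk"
    proof
      fix x assume x: "x \<in> ball (radial_point j z) (3 / 4 * h)"
      have "cmod (radial_point j z) = 1 - h"
        unfolding h_def using True by (intro cmod_radial_point) (auto simp: h_def)
      then show "x \<in> unit_disk" using x h0 norm_triangle_ineq2[of x "radial_point j z"]
        by (simp add: dist_norm norm_minus_commute)
    qed
    have "T z = (\<integral>\<^sup>+\<eta>. ennreal ((cmod (deriv f \<eta>))\<^sup>2) * indicator (ball (radial_point j z) (3 / 4 * h)) \<eta> \<partial>lborel)"
      using True by (simp add: T_def dyadic_energy_def h_def)
    also have "\<dots> = (\<integral>\<^sup>+\<eta>. g \<eta> * indicator S (z, \<eta>) \<partial>lborel)"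
      using True sub z by (intro nn_integral_cong)
        (auto simp: g_def S_def Q_def indicator_def space_pair_measure)
    finally show ?thesis .
  next
    case False
    then have "T z = 0" by (auto simp: T_def h_def indicator_def)
    moreover have "(\<integral>\<^sup>+\<eta>. g \<eta> * indicator S (z, \<eta>) \<partial>lborel) = (\<integral>\<^sup>+\<eta>. 0 \<partial>(lborel :: complex measure))"
      using False by (intro nn_integral_cong) (auto simp: S_def Q_def indicator_def)
    ultimately show ?thesis by simp
  qed
  have meas2: "(\<lambda>(z, \<eta>). g \<eta> * indicator S (z, \<eta>)) \<in> borel_measurable (M \<Otimes>\<^sub>M lborel)"
    by measurable
  have "(\<lambda>z. \<integral>\<^sup>+\<eta>. g \<eta> * indicator S (z, \<eta>) \<partial>lborel) \<in> borel_measurable M"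
    using meas2 by measurable
  then show "T \<in> borel_measurable M"
    using T by (subst measurable_cong[where g = "\<lambda>z. \<integral>\<^sup>+\<eta>. g \<eta> * indicator S (z, \<eta>) \<partial>lborel"]) auto
  define c where "c = ennreal (K * h powr p / (real j + 1)\<^sup>2)"
  have slice: "g \<eta> * emeasure M {z \<in> space M. Q z \<eta>} \<le>
      c * ((if h < 4 * (1 - cmod \<eta>) then ennreal ((cmod (deriv f \<eta>))\<^sup>2) else 0) * indicator G \<eta>)" for \<eta>
  proof (cases "\<eta> \<in> unit_disk \<and> {z \<in> space M. Q z \<eta>} \<noteq> {}")
    case False
    then consider "\<eta> \<notin> unit_disk" | "{z \<in> space M. Q z \<eta>} = {}" by blast
    then show ?thesis
    proof cases
      case 1
      then show ?thesis by (simp add: g_def)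
    next
      case 2
      show ?thesis unfolding 2 by simp
    qed
  next
    case True
    then have \<eta>: "cmod \<eta> < 1" by simp
    have close: "cmod (z - \<eta>) \<le> 7 / 4 * h" "1 - cmod \<eta> \<le> 7 / 4 * h" "h < 4 * (1 - cmod \<eta>)"
      if "z \<in> unit_disk" "Q z \<eta>" for z
    proof -
      have z: "1 - cmod z \<le> h" "cmod (radial_point j z - \<eta>) < 3 / 4 * h" "cmod z < 1"
        using that by (auto simp: Q_def dist_norm)
      have r: "cmod (radial_point j z) = 1 - h" using cmod_radial_point[of z j] z by (simp add: h_def)
      have d: "cmod (z - radial_point j z) \<le> h" using cmod_sub_radial_point[of z j] z by (simp add: h_def)
      have "cmod (z - \<eta>) \<le> cmod (z - radial_point j z) + cmod (radial_point j z - \<eta>)" by norm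
      then show "cmod (z - \<eta>) \<le> 7 / 4 * h" using d z by linarith
      have "cmod (radial_point j z) \<le> cmod (radial_point j z - \<eta>) + cmod \<eta>" by norm
      then show "1 - cmod \<eta> \<le> 7 / 4 * h" using r z by linarith
      have "cmod \<eta> \<le> cmod (radial_point j z - \<eta>) + cmod (radial_point j z)" by norm
      then have "cmod \<eta> < 1 - h / 4" using r z(2) by (simp add: field_simps)
      then show "h < 4 * (1 - cmod \<eta>)" by simp
    qed
    obtain z0 where z0: "z0 \<in> unit_disk" "Q z0 \<eta>" using True space by auto
    have "h \<le> (1 / 2) ^ m" unfolding h_def using z0 by (intro power_decreasing) (auto simp: Q_def)
    moreover have "cmod (z0 - \<xi>) \<le> 8 * (1 / 2) ^ m" using z0 by (auto simp: Q_def dyadic_box_def)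
    moreover have "cmod (\<xi> - \<eta>) \<le> cmod (z0 - \<xi>) + cmod (z0 - \<eta>)" by norm
    moreover note close(1)[OF z0]
    moreover have "x \<le> 10 * a" if "h \<le> a" "y \<le> 8 * a" "x \<le> y + w" "w \<le> 7 / 4 * h" for x y w a :: real
      using that h0 by linarith
    ultimately have "cmod (\<xi> - \<eta>) \<le> 10 * (1 / 2) ^ m" by blast
    then have inG: "\<eta> \<in> G" using \<eta> by (simp add: G_def dist_norm)
    obtain \<zeta> where \<zeta>: "cmod \<zeta> = 1" and d\<zeta>: "cmod (\<zeta> - \<eta>) = 1 - cmod \<eta>"
      using nearest_circle_point[OF \<eta>] .
    have "{z \<in> space M. Q z \<eta>} \<subseteq> unit_disk \<inter> cball \<zeta> (8 * h)"
    proof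
      fix z assume "z \<in> {z \<in> space M. Q z \<eta>}"
      then have z: "z \<in> unit_disk" "Q z \<eta>" using space by auto
      have "cmod (\<zeta> - z) \<le> cmod (\<zeta> - \<eta>) + cmod (z - \<eta>)" by norm
      then show "z \<in> unit_disk \<inter> cball \<zeta> (8 * h)"
        using close[OF z] d\<zeta> z h0 by (simp add: dist_norm)
    qed
    then have "emeasure M {z \<in> space M. Q z \<eta>} \<le> emeasure M (unit_disk \<inter> cball \<zeta> (8 * h))"
      by (intro emeasure_mono disk_measure_measurable(4)[OF M]) auto
    also have "\<dots> \<le> c" using H \<zeta> by (auto simp: dyadic_log_carleson_def c_def h_def)
    finally have "g \<eta> * emeasure M {z \<in> space M. Q z \<eta>} \<le> g \<eta> * c" by (intro mult_left_mono) auto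
    then show ?thesis using inG close(3)[OF z0] True by (simp add: g_def mult.commute)
  qed
  have "(\<integral>\<^sup>+z. T z \<partial>M) = (\<integral>\<^sup>+z. \<integral>\<^sup>+\<eta>. g \<eta> * indicator S (z, \<eta>) \<partial>lborel \<partial>M)"
    using T by (intro nn_integral_cong) auto
  also have "\<dots> = (\<integral>\<^sup>+\<eta>. \<integral>\<^sup>+z. g \<eta> * indicator S (z, \<eta>) \<partial>M \<partial>lborel)"
    using Fubini'[OF meas2] by simp
  also have "\<dots> = (\<integral>\<^sup>+\<eta>. g \<eta> * emeasure M {z \<in> space M. Q z \<eta>} \<partial>lborel)"
  proof (intro nn_integral_cong)
    fix \<eta> :: complex
    have "(\<integral>\<^sup>+z. g \<eta> * indicator S (z, \<eta>) \<partial>M) = (\<integral>\<^sup>+z. g \<eta> * indicator {z \<in> space M. Q z \<eta>} z \<partial>M)"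
      by (intro nn_integral_cong) (auto simp: S_def indicator_def space_pair_measure)
    also have "\<dots> = g \<eta> * emeasure M {z \<in> space M. Q z \<eta>}"
      unfolding Q_def by (intro nn_integral_cmult_indicator) measurable
    finally show "(\<integral>\<^sup>+z. g \<eta> * indicator S (z, \<eta>) \<partial>M) = g \<eta> * emeasure M {z \<in> space M. Q z \<eta>}" .
  qed
  also have "\<dots> \<le> (\<integral>\<^sup>+\<eta>. c * ((if h < 4 * (1 - cmod \<eta>) then ennreal ((cmod (deriv f \<eta>))\<^sup>2) else 0) * indicator G \<eta>) \<partial>lborel)"
    by (intro nn_integral_mono slice)
  also have "\<dots> = c * (\<integral>\<^sup>+\<eta>. (if h < 4 * (1 - cmod \<eta>) then ennreal ((cmod (deriv f \<eta>))\<^sup>2) else 0) * indicator G \<eta> \<partial>lborel)"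
  proof (intro nn_integral_cmult)
    have eq: "(if h < 4 * (1 - cmod \<eta>) then g \<eta> else 0) * indicator G \<eta> =
      (if h < 4 * (1 - cmod \<eta>) then ennreal ((cmod (deriv f \<eta>))\<^sup>2) else 0) * indicator G \<eta>" for \<eta>
      by (auto simp: g_def G_def indicator_def)
    show "(\<lambda>\<eta>. (if h < 4 * (1 - cmod \<eta>) then ennreal ((cmod (deriv f \<eta>))\<^sup>2) else 0) * indicator G \<eta>) \<in> borel_measurable lborel"
      using gG unfolding eq .
  qed
  finally show "(\<integral>\<^sup>+z. T z \<partial>M) \<le> log_scale p K j *
      (\<integral>\<^sup>+\<eta>. (if (1 / 2) ^ j < 4 * (1 - cmod \<eta>) then ennreal ((cmod (deriv f \<eta>))\<^sup>2) else 0) *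
        indicator (unit_disk \<inter> cball \<xi> (10 * (1 / 2) ^ m)) \<eta> \<partial>lborel)"
    by (simp add: c_def G_def h_def)
qed

text \<open>The first term comes from the coarse increments, the second from the fine ones: Cauchy-Schwarz,
geometric sum and Carleson property of the energy.\<close>

definition embedding_const :: "real \<Rightarrow> real" where
  "embedding_const p = 2 * (1 + 2 * 6 powr p)\<^sup>2 + 16 / pi * (4 powr p / (1 - (1 / 2) powr p)) * 121 powr p"

lemma embedding_const_pos: "0 < p \<Longrightarrow> 0 < embedding_const p"
proof -
  assume p: "0 < p"
  have "(1 / 2 :: real) powr p < 1" using p by (rule half_powr_less_one)
  then show ?thesis unfolding embedding_const_def
    by (intro add_pos_nonneg mult_nonneg_nonneg divide_nonneg_nonneg mult_pos_pos zero_less_power) (auto intro!: add_pos_pos)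
qed

text \<open>The embedding inequality. Summing the estimate of a single scale with the weights
$(j+1)^2$ cancels the logarithmic gain of the measure against these weights and leaves a geometric sum.\<close>

lemma box_embedding:
  assumes f: "Qp_bounded_by p f B" and p: "0 < p"
    and M: "sets M = sets disk_borel"
    and H: "dyadic_log_carleson p M K" and \<xi>: "cmod \<xi> = 1"
  shows "(\<integral>\<^sup>+z\<in>dyadic_box \<xi> m. ennreal ((cmod (f z))\<^sup>2) \<partial>M) \<le>
    ennreal (embedding_const p * K * ((1 / 2) ^ m) powr p * B\<^sup>2)"
proof -
  have hol: "f holomorphic_on unit_disk" and B: "0 \<le> B" using f by (auto simp: Qp_bounded_by_def)
  have K: "0 \<le> K" using H by (simp add: dyadic_log_carleson_def)
  define h :: "nat \<Rightarrow> real" where "h j = (1 / 2) ^ j" for j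
  define Z where "Z = dyadic_box \<xi> m"
  define T where "T j z = (if m \<le> j \<and> 1 - cmod z \<le> (1 / 2) ^ j then dyadic_energy f j z else 0) * indicator Z z" for j z
  define L where "L = 2 * ((1 + 2 * 6 powr p) * (real m + 1) * B)\<^sup>2"
  define c where "c j = ennreal (16 / pi * (real j + 1)\<^sup>2)" for j :: nat
  define G where "G = unit_disk \<inter> cball \<xi> (10 * (1 / 2) ^ m)"
  define u where "u \<eta> = ennreal ((cmod (deriv f \<eta>))\<^sup>2) * indicator G \<eta>" for \<eta>
  define \<gamma> where "\<gamma> = 4 powr p / (1 - (1 / 2) powr p)"
  have \<gamma>: "0 \<le> \<gamma>" using half_powr_less_one[OF p] by (simp add: \<gamma>_def)
  have T[measurable]: "T j \<in> borel_measurable M" for j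
    unfolding T_def Z_def by (rule single_scale(1)[OF hol M H \<xi>])
  have Z[measurable]: "Z \<in> sets M" unfolding Z_def by (rule dyadic_box_in_sets[OF M])
  have [measurable]: "G \<in> sets borel" unfolding G_def by auto
  have u[measurable]: "u \<in> borel_measurable borel"
  proof -
    have "(\<lambda>\<eta>. ennreal ((cmod (deriv f \<eta>))\<^sup>2) * indicator unit_disk \<eta>) \<in> borel_measurable borel"
      by (intro borel_measurable_indicator_disk continuous_intros continuous_on_deriv_disk hol)
    then have "(\<lambda>\<eta>. ennreal ((cmod (deriv f \<eta>))\<^sup>2) * indicator unit_disk \<eta> * indicator G \<eta>) \<in> borel_measurable borel"
      by measurable
    moreover have "ennreal ((cmod (deriv f \<eta>))\<^sup>2) * indicator unit_disk \<eta> * indicator G \<eta> = u \<eta>" for \<eta>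
      by (auto simp: u_def G_def indicator_def)
    ultimately show ?thesis by simp
  qed
  have one: "c j * (\<integral>\<^sup>+z. T j z \<partial>M) \<le>
      (\<integral>\<^sup>+\<eta>. ennreal (16 / pi * K) * u \<eta> * (if h j < 4 * (1 - cmod \<eta>) then ennreal (h j powr p) else 0) \<partial>lborel)" for j
  proof -
    have "c j * (\<integral>\<^sup>+z. T j z \<partial>M) \<le> c j * (ennreal (K * h j powr p / (real j + 1)\<^sup>2) *
        (\<integral>\<^sup>+\<eta>. (if h j < 4 * (1 - cmod \<eta>) then ennreal ((cmod (deriv f \<eta>))\<^sup>2) else 0) * indicator G \<eta> \<partial>lborel))"
      using single_scale(2)[OF hol M H \<xi>, of m j]
      by (intro mult_left_mono) (auto simp: T_def Z_def G_def h_def)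
    also have "(\<integral>\<^sup>+\<eta>. (if h j < 4 * (1 - cmod \<eta>) then ennreal ((cmod (deriv f \<eta>))\<^sup>2) else 0) * indicator G \<eta> \<partial>lborel) =
        (\<integral>\<^sup>+\<eta>. u \<eta> * (if h j < 4 * (1 - cmod \<eta>) then 1 else 0) \<partial>lborel)"
      by (intro nn_integral_cong) (auto simp: u_def)
    also have "c j * (ennreal (K * h j powr p / (real j + 1)\<^sup>2) * \<dots>) = ennreal (16 / pi * K * h j powr p) * \<dots>"
    proof -
      have "16 / pi * (real j + 1)\<^sup>2 * (K * h j powr p / (real j + 1)\<^sup>2) = 16 / pi * K * h j powr p"
        by (simp add: field_simps)
      then show ?thesis unfolding c_def using K by (simp add: mult.assoc[symmetric] ennreal_mult'[symmetric])
    qed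
    also have "\<dots> = (\<integral>\<^sup>+\<eta>. ennreal (16 / pi * K * h j powr p) * (u \<eta> * (if h j < 4 * (1 - cmod \<eta>) then 1 else 0)) \<partial>lborel)"
      by (intro nn_integral_cmult[symmetric]) measurable
    also have "\<dots> = (\<integral>\<^sup>+\<eta>. ennreal (16 / pi * K) * u \<eta> * (if h j < 4 * (1 - cmod \<eta>) then ennreal (h j powr p) else 0) \<partial>lborel)"
    proof -
      have "ennreal (16 / pi * K * h j powr p) = ennreal (16 / pi * K) * ennreal (h j powr p)"
        by (rule ennreal_mult'') simp
      then show ?thesis by (intro nn_integral_cong) (simp add: mult_ac)
    qed
    finally show ?thesis .
  qed
  have "(\<integral>\<^sup>+z\<in>Z. ennreal ((cmod (f z))\<^sup>2) \<partial>M) \<le> (\<integral>\<^sup>+z. ennreal L * indicator Z z + (\<Sum>j. c j * T j z) \<partial>M)"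
  proof (rule nn_integral_mono)
    fix z
    show "ennreal ((cmod (f z))\<^sup>2) * indicator Z z \<le> ennreal L * indicator Z z + (\<Sum>j. c j * T j z)"
    proof (cases "z \<in> Z")
      case True
      then show ?thesis
        using square_le_dyadic_energies[OF f less_imp_le[OF p], of z m]
        by (simp add: Z_def T_def dyadic_box_def c_def L_def cong: if_cong)
    qed simp
  qed
  also have "\<dots> = ennreal L * emeasure M Z + (\<Sum>j. c j * (\<integral>\<^sup>+z. T j z \<partial>M))"
    by (subst nn_integral_add) (auto simp: nn_integral_suminf nn_integral_cmult)
  also have "ennreal L * emeasure M Z \<le> ennreal (2 * (1 + 2 * 6 powr p)\<^sup>2 * K * h m powr p * B\<^sup>2)"
  proof -
    have "emeasure M Z \<le> emeasure M (dyadic_ball \<xi> m)"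
      by (intro emeasure_mono disk_measure_measurable(4)[OF M])
        (auto simp: Z_def dyadic_box_def dist_norm norm_minus_commute)
    also have "\<dots> \<le> ennreal (K * h m powr p / (real m + 1)\<^sup>2)"
      using H \<xi> by (auto simp: dyadic_log_carleson_def h_def)
    finally have "ennreal L * emeasure M Z \<le> ennreal L * ennreal (K * h m powr p / (real m + 1)\<^sup>2)"
      by (intro mult_left_mono) auto
    also have "\<dots> = ennreal (L * (K * h m powr p / (real m + 1)\<^sup>2))"
      by (subst ennreal_mult') (auto simp: L_def)
    also have "L * (K * h m powr p / (real m + 1)\<^sup>2) = 2 * (1 + 2 * 6 powr p)\<^sup>2 * K * h m powr p * B\<^sup>2"
      by (simp add: L_def power_mult_distrib)
    finally show ?thesis .
  qed
  also have "(\<Sum>j. c j * (\<integral>\<^sup>+z. T j z \<partial>M)) \<le> (\<Sum>j. \<integral>\<^sup>+\<eta>. ennreal (16 / pi * K) * u \<eta> *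
      (if h j < 4 * (1 - cmod \<eta>) then ennreal (h j powr p) else 0) \<partial>lborel)"
    by (intro suminf_le one) auto
  also have "\<dots> = (\<integral>\<^sup>+\<eta>. (\<Sum>j. ennreal (16 / pi * K) * u \<eta> *
      (if h j < 4 * (1 - cmod \<eta>) then ennreal (h j powr p) else 0)) \<partial>lborel)"
    by (intro nn_integral_suminf[symmetric]) measurable
  also have "\<dots> \<le> (\<integral>\<^sup>+\<eta>. ennreal (16 / pi * K * \<gamma>) * (ennreal ((cmod (deriv f \<eta>))\<^sup>2 * (1 - cmod \<eta>) powr p) * indicator G \<eta>) \<partial>lborel)"
  proof (rule nn_integral_mono)
    fix \<eta> :: complex
    show "(\<Sum>j. ennreal (16 / pi * K) * u \<eta> * (if h j < 4 * (1 - cmod \<eta>) then ennreal (h j powr p) else 0)) \<le>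
      ennreal (16 / pi * K * \<gamma>) * (ennreal ((cmod (deriv f \<eta>))\<^sup>2 * (1 - cmod \<eta>) powr p) * indicator G \<eta>)"
    proof (cases "\<eta> \<in> G")
      case True
      have "(\<Sum>j. ennreal (16 / pi * K) * u \<eta> * (if h j < 4 * (1 - cmod \<eta>) then ennreal (h j powr p) else 0)) =
         ennreal (16 / pi * K) * u \<eta> * (\<Sum>j. if h j < 4 * (1 - cmod \<eta>) then ennreal (h j powr p) else 0)"
        by (rule ennreal_suminf_cmult)
      also have "\<dots> \<le> ennreal (16 / pi * K) * u \<eta> * ennreal (\<gamma> * (1 - cmod \<eta>) powr p)"
        unfolding h_def \<gamma>_def using True p by (intro mult_left_mono suminf_dyadic_powr_le) (auto simp: G_def)
      also have "\<dots> = ennreal (16 / pi * K * \<gamma>) * (ennreal ((cmod (deriv f \<eta>))\<^sup>2 * (1 - cmod \<eta>) powr p) * indicator G \<eta>)"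
      proof -
        have "ennreal (16 / pi * K * \<gamma>) = ennreal (16 / pi * K) * ennreal \<gamma>"
          using \<gamma> by (rule ennreal_mult'')
        moreover have "ennreal (\<gamma> * (1 - cmod \<eta>) powr p) = ennreal \<gamma> * ennreal ((1 - cmod \<eta>) powr p)"
          by (rule ennreal_mult'') simp
        moreover have "ennreal ((cmod (deriv f \<eta>))\<^sup>2 * (1 - cmod \<eta>) powr p) =
            ennreal ((cmod (deriv f \<eta>))\<^sup>2) * ennreal ((1 - cmod \<eta>) powr p)"
          by (rule ennreal_mult'') simp
        ultimately show ?thesis using True by (simp add: u_def mult_ac)
      qed
      finally show ?thesis .
    qed (simp add: u_def)
  qed
  also have "\<dots> = ennreal (16 / pi * K * \<gamma>) * (\<integral>\<^sup>+\<eta>\<in>G. ennreal ((cmod (deriv f \<eta>))\<^sup>2 * (1 - cmod \<eta>) powr p) \<partial>lborel)"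
  proof (rule nn_integral_cmult)
    have "ennreal ((cmod (deriv f \<eta>))\<^sup>2 * (1 - cmod \<eta>) powr p) * indicator G \<eta> = u \<eta> * ennreal ((1 - cmod \<eta>) powr p)" for \<eta>
      by (auto simp: u_def ennreal_mult' indicator_def)
    then show "(\<lambda>\<eta>. ennreal ((cmod (deriv f \<eta>))\<^sup>2 * (1 - cmod \<eta>) powr p) * indicator G \<eta>) \<in> borel_measurable lborel"
      by simp
  qed
  also have "\<dots> \<le> ennreal (16 / pi * K * \<gamma>) * ennreal ((121 * h m) powr p * B\<^sup>2)"
    unfolding G_def h_def using p \<xi> by (intro mult_left_mono carleson_energy_le[OF f]) (auto simp: power_le_one)
  also have "\<dots> = ennreal (16 / pi * \<gamma> * 121 powr p * K * h m powr p * B\<^sup>2)"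
    using K \<gamma> by (simp add: ennreal_mult'[symmetric] powr_mult h_def mult_ac)
  finally have "(\<integral>\<^sup>+z\<in>Z. ennreal ((cmod (f z))\<^sup>2) \<partial>M) \<le> ennreal (2 * (1 + 2 * 6 powr p)\<^sup>2 * K * h m powr p * B\<^sup>2) +
     ennreal (16 / pi * \<gamma> * 121 powr p * K * h m powr p * B\<^sup>2)"
    by (auto intro: add_mono)
  also have "\<dots> = ennreal (embedding_const p * K * h m powr p * B\<^sup>2)"
    unfolding embedding_const_def \<gamma>_def[symmetric]
    using K \<gamma> by (subst ennreal_plus[symmetric]) (auto simp: algebra_simps)
  finally show ?thesis by (simp add: Z_def h_def)
qed

section \<open>Logarithmic functions have bounded norm in $Q_p$\<close>

text \<open>With $q = \min(p, 1)$ and $d = 1 - |a|$, translates of this radial function dominate the integrand in the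
energy of a logarithm at the point $a$. It behaves like $d^{-q} x^{q-2}$ near the origin and like $d^q x^{-q-2}$
at infinity, and it equals $d^{-2}$ times a fixed function of $x/d$; its integral over the plane is therefore
bounded independently of $d$.\<close>

definition bump :: "real \<Rightarrow> real \<Rightarrow> real \<Rightarrow> real" where
  "bump q d x = x powr (q - 2) * d powr q * (max x d) powr (- 2 * q)"

lemma powr_minus_two: "0 < (x::real) \<Longrightarrow> x powr (q - 2) = x powr q / x\<^sup>2"
  by (simp add: powr_diff)

lemma powr_minus_double: "0 < (x::real) \<Longrightarrow> x powr (- 2 * q) = 1 / (x powr q)\<^sup>2"
proof -
  assume "0 < x"
  have "x powr (- 2 * q) = x powr (- q + - q)" by simp
  also have "\<dots> = 1 / (x powr q)\<^sup>2"
    unfolding powr_add powr_minus by (simp add: power2_eq_square divide_simps)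
  finally show ?thesis .
qed

text \<open>On each dyadic annulus inside and outside the circle of radius $d$, the monotone function is
bounded by its value on the inner boundary.\<close>

lemma bump_dyadic_majorant:
  assumes q: "0 < q" "q \<le> 1" and d: "0 < d" and x: "0 < x"
  shows "\<exists>k. (x \<le> d * (1 / 2) ^ k \<and> bump q d x \<le> 4 / (d * (1 / 2) ^ k)\<^sup>2 * ((1 / 2) powr q) ^ k) \<or>
    (x \<le> 2 * d / (1 / 2) ^ k \<and> bump q d x \<le> ((1 / 2) ^ k / d)\<^sup>2 * ((1 / 2) powr q) ^ k)"
proof -
  have qk: "((1 / 2) powr q) ^ k = ((1 / 2) ^ k) powr q" for k
    by (simp add: powr_realpow[symmetric] powr_powr mult.commute)
  define D where "D = d powr q"
  have D: "0 < D" using d by (simp add: D_def)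
  show ?thesis
  proof (cases "x \<le> d")
    case True
    obtain k where k: "(1 / 2) ^ Suc k < x / d" "x / d \<le> (1 / 2) ^ k"
      by (rule exists_dyadic_scale[of "x / d"]) (use x d True in auto)
    define t :: real where "t = (1 / 2) ^ k"
    have t: "0 < t" "d * (t / 2) < x" "x \<le> d * t" using k d by (auto simp: t_def field_simps)
    have "bump q d x = x powr (q - 2) / D"
      using True d D unfolding bump_def max_absorb2[OF True] powr_minus_double[OF d] D_def[symmetric]
      by (simp add: power2_eq_square)
    also have "\<dots> \<le> (d * (t / 2)) powr (q - 2) / D"
      using t d q D by (intro divide_right_mono powr_mono2') auto
    also have "\<dots> = (t / 2) powr q * (4 / (d * t)\<^sup>2)"
    proof -
      have "(d * (t / 2)) powr q = D * (t / 2) powr q" unfolding D_def by (rule powr_mult)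
      then have "(d * (t / 2)) powr (q - 2) = D * (t / 2) powr q / (d * (t / 2))\<^sup>2"
        using powr_minus_two[of "d * (t / 2)" q] d t by simp
      then show ?thesis using D by (simp add: power_mult_distrib power_divide)
    qed
    also have "\<dots> \<le> t powr q * (4 / (d * t)\<^sup>2)"
      using t q by (intro mult_right_mono powr_mono2) auto
    finally have "bump q d x \<le> 4 / (d * t)\<^sup>2 * t powr q" by (simp only: mult.commute)
    then show ?thesis using t unfolding qk t_def by blast
  next
    case False
    obtain k where k: "(1 / 2) ^ Suc k < d / x" "d / x \<le> (1 / 2) ^ k"
      by (rule exists_dyadic_scale[of "d / x"]) (use x d False in auto)
    define t :: real where "t = (1 / 2) ^ k"
    have t: "0 < t" "x \<le> 2 * d / t" "d / t \<le> x" using k d x by (auto simp: t_def field_simps)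
    have m: "max x d = x" using False by simp
    have "bump q d x = D / (x powr q * x\<^sup>2)"
      unfolding bump_def m powr_minus_double[OF x] powr_minus_two[OF x] D_def[symmetric]
      using x by (simp add: power2_eq_square)
    also have "\<dots> \<le> D / ((d / t) powr q * (d / t)\<^sup>2)"
    proof -
      have "0 < d / t" using d t by simp
      then show ?thesis using t(3) x q D
        by (intro divide_left_mono mult_mono powr_mono2 power_mono mult_pos_pos) auto
    qed
    also have "(d / t) powr q = D / t powr q" using d t by (simp add: powr_divide D_def)
    also have "D / (D / t powr q * (d / t)\<^sup>2) = (t / d)\<^sup>2 * t powr q"
      using D d t by (simp add: power_divide)
    finally show ?thesis using t unfolding qk t_def by blast
  qed
qed

lemma emeasure_cball_complex: "0 \<le> r \<Longrightarrow> emeasure lborel (cball (c::complex) r) = ennreal (pi * r\<^sup>2)"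
  by (simp add: emeasure_cball unit_ball_vol_2)

text \<open>In either family of disks of the majorant, the $k$-th height times the $k$-th area is a constant times
$2^{-kq}$.\<close>

lemma nn_integral_bump_le:
  assumes q: "0 < q" "q \<le> 1" and d: "0 < d"
  shows "(\<integral>\<^sup>+z. ennreal (bump q d (cmod (z - c))) \<partial>lborel) \<le> ennreal (8 * pi / (1 - (1 / 2) powr q))"
proof -
  define r :: real where "r = (1 / 2) powr q"
  have r: "0 < r" "r < 1" using q half_powr_less_one by (auto simp: r_def)
  define F where "F k z = ennreal (4 / (d * (1 / 2) ^ k)\<^sup>2 * r ^ k) * indicator (cball c (d * (1 / 2) ^ k)) z +
     ennreal (((1 / 2) ^ k / d)\<^sup>2 * r ^ k) * indicator (cball c (2 * d / (1 / 2) ^ k)) z" for k :: nat and z :: complex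
  have [measurable]: "cball c \<rho> \<in> sets borel" for \<rho> by auto
  have F: "(\<integral>\<^sup>+z. F k z \<partial>lborel) = ennreal (8 * pi * r ^ k)" for k
  proof -
    have "(\<integral>\<^sup>+z. F k z \<partial>lborel) =
        ennreal (4 / (d * (1 / 2) ^ k)\<^sup>2 * r ^ k) * ennreal (pi * (d * (1 / 2) ^ k)\<^sup>2) +
        ennreal (((1 / 2) ^ k / d)\<^sup>2 * r ^ k) * ennreal (pi * (2 * d / (1 / 2) ^ k)\<^sup>2)"
    proof -
      have "(\<integral>\<^sup>+z. ennreal b * indicator (cball c \<rho>) z \<partial>lborel) = ennreal b * ennreal (pi * \<rho>\<^sup>2)"
        if "0 \<le> \<rho>" for b \<rho>
        using that by (subst nn_integral_cmult_indicator) (auto simp: emeasure_cball_complex)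
      moreover have "(\<lambda>z. ennreal b * indicator (cball c \<rho>) z) \<in> borel_measurable lborel" for b \<rho>
        by measurable
      ultimately show ?thesis unfolding F_def using d by (subst nn_integral_add) auto
    qed
    also have "\<dots> = ennreal (4 / (d * (1 / 2) ^ k)\<^sup>2 * r ^ k * (pi * (d * (1 / 2) ^ k)\<^sup>2)) +
        ennreal (((1 / 2) ^ k / d)\<^sup>2 * r ^ k * (pi * (2 * d / (1 / 2) ^ k)\<^sup>2))"
    proof -
      have "ennreal b * ennreal (pi * \<rho>\<^sup>2) = ennreal (b * (pi * \<rho>\<^sup>2))" for b \<rho>
        by (rule ennreal_mult''[symmetric]) simp
      then show ?thesis by (simp only:)
    qed
    also have "4 / (d * (1 / 2) ^ k)\<^sup>2 * r ^ k * (pi * (d * (1 / 2) ^ k)\<^sup>2) = 4 * pi * r ^ k"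
      using d by simp
    also have "((1 / 2) ^ k / d)\<^sup>2 * r ^ k * (pi * (2 * d / (1 / 2) ^ k)\<^sup>2) = 4 * pi * r ^ k"
      using d by (simp add: power_divide power_mult_distrib)
    finally show ?thesis using r by (simp flip: ennreal_plus)
  qed
  have "(\<integral>\<^sup>+z. ennreal (bump q d (cmod (z - c))) \<partial>lborel) \<le> (\<integral>\<^sup>+z. (\<Sum>k. F k z) \<partial>lborel)"
  proof (rule nn_integral_mono)
    fix z
    show "ennreal (bump q d (cmod (z - c))) \<le> (\<Sum>k. F k z)"
    proof (cases "z = c")
      case False
      then obtain k where "(cmod (z - c) \<le> d * (1 / 2) ^ k \<and> bump q d (cmod (z - c)) \<le> 4 / (d * (1 / 2) ^ k)\<^sup>2 * r ^ k) \<or>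
          (cmod (z - c) \<le> 2 * d / (1 / 2) ^ k \<and> bump q d (cmod (z - c)) \<le> ((1 / 2) ^ k / d)\<^sup>2 * r ^ k)"
        using bump_dyadic_majorant[OF q d, of "cmod (z - c)"] by (auto simp: r_def)
      then have "ennreal (bump q d (cmod (z - c))) \<le> F k z"
      proof
        assume *: "cmod (z - c) \<le> d * (1 / 2) ^ k \<and> bump q d (cmod (z - c)) \<le> 4 / (d * (1 / 2) ^ k)\<^sup>2 * r ^ k"
        then have "ennreal (bump q d (cmod (z - c))) \<le> ennreal (4 / (d * (1 / 2) ^ k)\<^sup>2 * r ^ k) * indicator (cball c (d * (1 / 2) ^ k)) z"
          by (simp add: dist_norm norm_minus_commute ennreal_leI)
        then show ?thesis unfolding F_def by (rule order_trans) simp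
      next
        assume *: "cmod (z - c) \<le> 2 * d / (1 / 2) ^ k \<and> bump q d (cmod (z - c)) \<le> ((1 / 2) ^ k / d)\<^sup>2 * r ^ k"
        then have "ennreal (bump q d (cmod (z - c))) \<le> ennreal (((1 / 2) ^ k / d)\<^sup>2 * r ^ k) * indicator (cball c (2 * d / (1 / 2) ^ k)) z"
          by (simp add: dist_norm norm_minus_commute ennreal_leI)
        then show ?thesis unfolding F_def by (rule order_trans) simp
      qed
      also have "F k z \<le> (\<Sum>k. F k z)"
        using sum_le_suminf[of "\<lambda>k. F k z" "{k}"] by auto
      finally show ?thesis .
    qed (simp add: bump_def)
  qed
  also have "\<dots> = (\<Sum>k. \<integral>\<^sup>+z. F k z \<partial>lborel)"
    unfolding F_def by (intro nn_integral_suminf) measurable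
  also have "\<dots> = ennreal (\<Sum>k. 8 * pi * r ^ k)"
    unfolding F using r by (intro suminf_ennreal2) (auto intro!: summable_mult summable_geometric)
  also have "(\<Sum>k. 8 * pi * r ^ k) = 8 * pi / (1 - r)"
    using r by (subst suminf_mult) (auto simp: suminf_geometric summable_geometric)
  finally show ?thesis by (simp add: r_def)
qed

text \<open>Let $R = |1 - \bar w z|$ and $S = |1 - \bar a z|$. Both dominate the height of $z$,
and they dominate $|z - w|$ and $|z - a|$ respectively because the involutions map the disk into itself;
moreover $S \ge 1 - |a|$. So the Moebius weight is at most $4 (1-|a|) \min(R,S) / S^2$, and a power $q \le 1$
of it makes the integrand a decreasing function of $\min(R,S)$ and of $S$. Whichever of $R$ and $S$ is smaller
decides which of the two translates is used.\<close>

lemma log_energy_integrand_le: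
  assumes w: "cmod w < 1" and a: "cmod a < 1" and z: "cmod z < 1" "z \<noteq> w" "z \<noteq> a"
    and q: "0 < q" "q \<le> 1" "q \<le> p"
  shows "(1 / cmod (1 - cnj w * z))\<^sup>2 * (1 - (cmod (disk_involution a z))\<^sup>2) powr p \<le>
    4 powr q * (bump q (1 - cmod a) (cmod (z - w)) + bump q (1 - cmod a) (cmod (z - a)))"
proof -
  define R where "R = cmod (1 - cnj w * z)"
  define S where "S = cmod (1 - cnj a * z)"
  define d where "d = 1 - cmod a"
  define E where "E = min R S"
  have d: "0 < d" using a by (simp add: d_def)
  have dist_le: "cmod (z - v) \<le> cmod (1 - cnj v * z)" if v: "cmod v < 1" for v
  proof -
    have "(cmod (disk_involution v z))\<^sup>2 < 1" using mobius_defect_pos[OF v z(1)] by simp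
    then have "cmod (disk_involution v z) < 1" by (simp add: abs_square_less_1)
    then show ?thesis using mobius_defect(2)[OF v z(1)]
      by (simp add: disk_involution_def norm_divide norm_minus_commute)
  qed
  have R: "cmod (z - w) \<le> R" "1 - cmod z \<le> R" using dist_le[OF w] cmod_one_minus_cnj_mult_ge[OF w z(1)] by (auto simp: R_def)
  have S: "cmod (z - a) \<le> S" "1 - cmod z \<le> S" "d \<le> S" using dist_le[OF a] cmod_one_minus_cnj_mult_ge[OF a z(1)]
    by (auto simp: S_def d_def)
  have pos: "0 < R" "0 < S" "0 < E" using R S z d by (auto simp: E_def)
  have sq: "1 - (cmod v)\<^sup>2 \<le> 2 * (1 - cmod v)" if "cmod v < 1" for v
    using zero_le_power2[of "1 - cmod v"] by (simp add: power2_eq_square algebra_simps)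
  define V where "V = 1 - (cmod (disk_involution a z))\<^sup>2"
  have V: "0 < V" "V \<le> 1" using mobius_defect_pos[OF a z(1)] by (auto simp: V_def)
  have "V = (1 - (cmod a)\<^sup>2) * (1 - (cmod z)\<^sup>2) / S\<^sup>2"
    unfolding V_def S_def by (rule mobius_defect(1)[OF a z(1)])
  also have "\<dots> \<le> (2 * d) * (2 * E) / S\<^sup>2"
  proof -
    have "1 - (cmod a)\<^sup>2 \<le> 2 * d" using sq[OF a] by (simp add: d_def)
    moreover have "1 - (cmod z)\<^sup>2 \<le> 2 * E" using sq[OF z(1)] R S by (simp add: E_def)
    ultimately show ?thesis using a z d by (intro divide_right_mono mult_mono) (auto simp: abs_square_le_1)
  qed
  finally have VE: "V \<le> 4 * d * E / S\<^sup>2" by simp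
  have "V powr p \<le> V powr q" using V q by (intro powr_mono') auto
  also have "\<dots> \<le> (4 * d * E / S\<^sup>2) powr q" using V VE q by (intro powr_mono2) auto
  also have "\<dots> = 4 powr q * d powr q * E powr q * S powr (- 2 * q)"
  proof -
    have "S\<^sup>2 = S powr 2" using pos by simp
    then have "(S\<^sup>2) powr q = S powr (2 * q)" by (simp only: powr_powr)
    then show ?thesis using d pos by (simp add: powr_divide powr_mult powr_minus field_simps)
  qed
  finally have "(1 / R)\<^sup>2 * V powr p \<le> (1 / E)\<^sup>2 * (4 powr q * d powr q * E powr q * S powr (- 2 * q))"
    using pos by (intro mult_mono power_mono) (auto simp: E_def frac_le)
  also have "\<dots> = 4 powr q * (E powr (q - 2) * d powr q * S powr (- 2 * q))"
    using pos by (simp add: powr_diff power_divide field_simps)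
  also have "\<dots> \<le> 4 powr q * (bump q d (cmod (z - w)) + bump q d (cmod (z - a)))"
  proof (rule mult_left_mono)
    have *: "E powr (q - 2) * d powr q * S powr (- 2 * q) \<le> bump q d x"
      if "0 < x" "x \<le> E" for x
    proof -
      have "max x d \<le> S" using that S by (auto simp: E_def)
      then have "S powr (- 2 * q) \<le> (max x d) powr (- 2 * q)"
        using that q by (intro powr_mono2') auto
      moreover have "E powr (q - 2) \<le> x powr (q - 2)" using that q by (intro powr_mono2') auto
      ultimately show ?thesis unfolding bump_def by (intro mult_mono) auto
    qed
    have nonneg: "0 \<le> bump q d x" for x by (simp add: bump_def)
    show "E powr (q - 2) * d powr q * S powr (- 2 * q) \<le> bump q d (cmod (z - w)) + bump q d (cmod (z - a))"
    proof (cases "R \<le> S")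
      case True
      then have "E powr (q - 2) * d powr q * S powr (- 2 * q) \<le> bump q d (cmod (z - w))"
        using R z by (intro *) (auto simp: E_def)
      then show ?thesis using nonneg[of "cmod (z - a)"] by linarith
    next
      case False
      then have "E powr (q - 2) * d powr q * S powr (- 2 * q) \<le> bump q d (cmod (z - a))"
        using S z by (intro *) (auto simp: E_def)
      then show ?thesis using nonneg[of "cmod (z - w)"] by linarith
    qed
  qed simp
  finally show ?thesis by (simp add: R_def V_def d_def)
qed

text \<open>The summand 1 accounts for the value at the origin.\<close>

definition log_test_const :: "real \<Rightarrow> real" where
  "log_test_const p = 1 + sqrt (4 powr min p 1 * (2 * (8 * pi / (1 - (1 / 2) powr min p 1))))"

lemma log_test_const_ge_1:
  assumes "0 < p"
  shows "1 \<le> log_test_const p"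
  using half_powr_less_one[of "min p 1"] assms by (simp add: log_test_const_def)

text \<open>The class of functions whose derivative has at most the size of that of a logarithm with
singularity near $w$; the bound is independent of $w$.\<close>

lemma Qp_bounded_by_log_type:
  assumes p: "0 < p" and f: "f holomorphic_on unit_disk" and w: "cmod w < 1" and "0 \<le> A"
    and f0: "cmod (f 0) \<le> A"
    and f': "\<And>z. cmod z < 1 \<Longrightarrow> cmod (deriv f z) \<le> A / cmod (1 - cnj w * z)"
  shows "Qp_bounded_by p f (log_test_const p * A)"
proof -
  define q where "q = min p 1"
  define I where "I = 8 * pi / (1 - (1 / 2) powr q)"
  have q: "0 < q" "q \<le> 1" "q \<le> p" using p by (auto simp: q_def)
  have I: "0 \<le> I" using half_powr_less_one[OF q(1)] by (simp add: I_def)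
  have bmeas: "(\<lambda>z. ennreal (bump q d (cmod (z - c)))) \<in> borel_measurable borel" for d and c :: complex
    unfolding bump_def by measurable
  have "Qp_energy p f a \<le> ennreal ((log_test_const p * A)\<^sup>2)" if a: "a \<in> unit_disk" for a
  proof -
    have a1: "cmod a < 1" using a by simp
    let ?b = "\<lambda>c z. ennreal (bump q (1 - cmod a) (cmod (z - c)))"
    have "Qp_energy p f a \<le> (\<integral>\<^sup>+z. ennreal (A\<^sup>2 * 4 powr q) * (?b w z + ?b a z) \<partial>lborel)"
      unfolding Qp_energy_def
    proof (rule nn_integral_mono_AE)
      \<comment> \<open>at its centre the majorant has the default value 0 and does not dominate\<close>
      have "AE z in lborel. z \<noteq> w \<and> z \<noteq> a" by (intro AE_conjI AE_lborel_singleton)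
      then show "AE z in lborel. ennreal ((cmod (deriv f z))\<^sup>2 * (1 - (cmod (disk_involution a z))\<^sup>2) powr p) *
          indicator unit_disk z \<le> ennreal (A\<^sup>2 * 4 powr q) * (?b w z + ?b a z)"
      proof eventually_elim
        case (elim z)
        show ?case
        proof (cases "z \<in> unit_disk")
          case True
          then have z: "cmod z < 1" by simp
          let ?V = "(1 - (cmod (disk_involution a z))\<^sup>2) powr p"
          have "(cmod (deriv f z))\<^sup>2 * ?V \<le> (A / cmod (1 - cnj w * z))\<^sup>2 * ?V"
            using f'[OF z] by (intro mult_right_mono power_mono) auto
          also have "\<dots> = A\<^sup>2 * ((1 / cmod (1 - cnj w * z))\<^sup>2 * ?V)" by (simp add: power_divide)
          also have "\<dots> \<le> A\<^sup>2 * (4 powr q * (bump q (1 - cmod a) (cmod (z - w)) + bump q (1 - cmod a) (cmod (z - a))))"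
            using elim by (intro mult_left_mono log_energy_integrand_le w a1 z q) auto
          finally have "ennreal ((cmod (deriv f z))\<^sup>2 * ?V) \<le> ennreal (A\<^sup>2 * 4 powr q *
              (bump q (1 - cmod a) (cmod (z - w)) + bump q (1 - cmod a) (cmod (z - a))))"
            by (intro ennreal_leI) (simp add: mult.assoc)
          also have "\<dots> = ennreal (A\<^sup>2 * 4 powr q) * (?b w z + ?b a z)"
            by (subst ennreal_plus[symmetric]) (auto simp: bump_def ennreal_mult')
          finally show ?thesis using True by simp
        qed simp
      qed
    qed
    also have "\<dots> = ennreal (A\<^sup>2 * 4 powr q) * ((\<integral>\<^sup>+z. ?b w z \<partial>lborel) + (\<integral>\<^sup>+z. ?b a z \<partial>lborel))"
      using bmeas by (subst nn_integral_cmult) (auto simp: nn_integral_add)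
    also have "\<dots> \<le> ennreal (A\<^sup>2 * 4 powr q) * (ennreal I + ennreal I)"
      unfolding I_def using a1 by (intro mult_left_mono add_mono nn_integral_bump_le q) auto
    also have "\<dots> = ennreal (A\<^sup>2 * (4 powr q * (2 * I)))"
      using I by (simp flip: ennreal_plus ennreal_mult' add: mult_ac)
    also have "\<dots> \<le> ennreal ((log_test_const p * A)\<^sup>2)"
    proof (rule ennreal_leI)
      have "4 powr q * (2 * I) = (sqrt (4 powr q * (2 * I)))\<^sup>2" using I by simp
      also have "\<dots> \<le> (log_test_const p)\<^sup>2"
        unfolding log_test_const_def q_def[symmetric] I_def[symmetric] using I by (intro power_mono) auto
      finally show "A\<^sup>2 * (4 powr q * (2 * I)) \<le> (log_test_const p * A)\<^sup>2"
        by (simp add: power_mult_distrib mult.commute mult_left_mono)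
    qed
    finally show ?thesis .
  qed
  moreover have "A \<le> log_test_const p * A"
    using mult_right_mono[OF log_test_const_ge_1[OF p] \<open>0 \<le> A\<close>] by simp
  ultimately show ?thesis
    using f f0 \<open>0 \<le> A\<close> unfolding Qp_bounded_by_def by auto
qed

text \<open>The constant 18 makes the real part at least $\log(2/|I|)$ on $S(I)$, where
$|1 - \bar w z|$ is at most $9 |I|$ for the point $w$ used there.\<close>

definition log_test :: "complex \<Rightarrow> complex \<Rightarrow> complex" where
  "log_test w z = of_real (ln 18) - Ln (1 - cnj w * z)"

lemma log_test_basics:
  assumes w: "cmod w < 1" and z: "cmod z < 1"
  shows "(log_test w has_field_derivative cnj w / (1 - cnj w * z)) (at z)"
    and "Re (log_test w z) = ln (18 / cmod (1 - cnj w * z))"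
    and "cmod (log_test w z) \<le> ln (18 / (1 - cmod w)) + pi"
    and "cmod (log_test w z) \<le> ln (18 / (1 - cmod z)) + pi"
proof -
  define u where "u = 1 - cnj w * z"
  have "cmod (cnj w * z) < 1"
    using assms mult_strict_mono[of "cmod w" 1 "cmod z" 1] by (cases "w = 0") (auto simp: norm_mult)
  then have "\<bar>Re (cnj w * z)\<bar> < 1" using abs_Re_le_cmod[of "cnj w * z"] by linarith
  then have Re: "0 < Re u" by (simp add: u_def)
  then have nz: "u \<noteq> 0" and nonpos: "u \<notin> \<real>\<^sub>\<le>\<^sub>0" by (auto simp: complex_nonpos_Reals_iff)
  show "(log_test w has_field_derivative cnj w / (1 - cnj w * z)) (at z)"
  proof -
    have "((\<lambda>z. 1 - cnj w * z) has_field_derivative - cnj w) (at z)"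
      by (auto intro!: derivative_eq_intros)
    moreover have "(Ln has_field_derivative inverse u) (at (1 - cnj w * z))"
      using has_field_derivative_Ln[OF nonpos] by (simp add: u_def)
    ultimately have "((\<lambda>z. Ln (1 - cnj w * z)) has_field_derivative inverse u * (- cnj w)) (at z)"
      by (intro DERIV_chain2)
    from DERIV_diff[OF DERIV_const this, of "of_real (ln 18)"] show ?thesis
      unfolding log_test_def[abs_def] by (simp add: u_def divide_inverse mult.commute)
  qed
  have re: "Re (log_test w z) = ln 18 - ln (cmod u)" using nz by (simp add: log_test_def u_def)
  then show "Re (log_test w z) = ln (18 / cmod (1 - cnj w * z))"
    using nz by (simp add: u_def ln_div)
  have "\<bar>Im (log_test w z)\<bar> \<le> pi"
    using nz mpi_less_Im_Ln[of u] Im_Ln_le_pi[of u] by (simp add: log_test_def u_def)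
  moreover have "0 \<le> Re (log_test w z)"
  proof -
    have "cmod u \<le> 2" using \<open>cmod (cnj w * z) < 1\<close> norm_triangle_ineq4[of 1 "cnj w * z"] by (simp add: u_def)
    then show ?thesis unfolding re using nz by simp
  qed
  moreover have "cmod (log_test w z) \<le> \<bar>Re (log_test w z)\<bar> + \<bar>Im (log_test w z)\<bar>" by (rule cmod_le)
  ultimately have le: "cmod (log_test w z) \<le> ln 18 - ln (cmod u) + pi" unfolding re by linarith
  have "1 - cmod w \<le> cmod u" "1 - cmod z \<le> cmod u"
    unfolding u_def by (rule cmod_one_minus_cnj_mult_ge[OF w z])+
  then have "ln (1 - cmod w) \<le> ln (cmod u)" "ln (1 - cmod z) \<le> ln (cmod u)"
    using w z by (auto simp: ln_mono)
  then show "cmod (log_test w z) \<le> ln (18 / (1 - cmod w)) + pi"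
    "cmod (log_test w z) \<le> ln (18 / (1 - cmod z)) + pi"
    using le w z by (auto simp: ln_div)
qed

section \<open>From Carleson squares to balls, and the boundedness criterion\<close>

lemma ennreal_divide_le_iff:
  assumes "0 < b" "0 \<le> k"
  shows "a / ennreal b \<le> ennreal k \<longleftrightarrow> a \<le> ennreal (k * b)"
proof (cases a)
  case (real r)
  then show ?thesis using assms by (simp add: divide_ennreal pos_divide_le_eq)
next
  case top
  then show ?thesis using assms by (simp add: ennreal_top_divide top_unique)
qed

lemma ennreal_powr_minus_mult_le_iff:
  assumes "0 < l" "0 \<le> k"
  shows "ennreal (l powr (- p)) * a \<le> ennreal k \<longleftrightarrow> a \<le> ennreal (k * l powr p)"
proof -
  have "ennreal (l powr (- p)) = inverse (ennreal (l powr p))"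
    using assms by (simp add: powr_minus inverse_ennreal)
  then have "ennreal (l powr (- p)) * a = a / ennreal (l powr p)"
    by (simp add: divide_ennreal_def mult.commute)
  then show ?thesis using assms by (simp add: ennreal_divide_le_iff)
qed

lemma subarc_arc_len: "subarc I \<Longrightarrow> 0 < arc_len I" "arc_len I \<le> 1"
  by (auto simp: subarc_def arc_len_le_1)

lemma subarc_nonempty:
  assumes "subarc I"
  obtains \<xi> where "\<xi> \<in> I" "cmod \<xi> = 1"
proof -
  have "I \<noteq> {}" using assms by (auto simp: subarc_def arc_len_def)
  then obtain \<xi> where "\<xi> \<in> I" by auto
  moreover then have "cmod \<xi> = 1" using assms by (auto simp: subarc_def)
  ultimately show ?thesis using that by blast
qed

lemma ln_two_le_ln_two_div: "0 < (l::real) \<Longrightarrow> l \<le> 1 \<Longrightarrow> ln 2 \<le> ln (2 / l)"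
  by (subst ln_le_cancel_iff) (auto simp: field_simps)

text \<open>Division-free forms of the ratio and of the tent norm, for use with real bounds.\<close>

lemma log_carleson_ratio_le_iff:
  assumes "subarc I" "0 \<le> k"
  shows "log_carleson_ratio p M I \<le> ennreal k \<longleftrightarrow>
    emeasure M (carleson_square I) \<le> ennreal (k * (arc_len I powr p / (ln (2 / arc_len I))\<^sup>2))"
proof -
  note l = subarc_arc_len(1)[OF assms(1)] subarc_arc_len(2)[of I]
  have "0 < ln (2 / arc_len I)" using ln_two_le_ln_two_div[OF l] ln_gt_zero[of 2] by linarith
  moreover have "ln (2 / arc_len I) powi (-2) = 1 / (ln (2 / arc_len I))\<^sup>2"
    by (simp add: power_int_minus divide_inverse)
  ultimately show ?thesis
    unfolding log_carleson_ratio_def using l assms by (subst ennreal_divide_le_iff) auto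
qed

lemma tent_norm_le_iff:
  assumes "0 \<le> c"
  shows "tent_norm p M f \<le> ennreal c \<longleftrightarrow> (\<forall>I. subarc I \<longrightarrow>
    (\<integral>\<^sup>+z\<in>carleson_square I. ennreal ((cmod (f z))\<^sup>2) \<partial>M) \<le> ennreal (c\<^sup>2 * arc_len I powr p))"
  unfolding tent_norm_def SUP_le_iff nn_integral_completion
  using assms by (auto simp: esqrt_le_iff ennreal_powr_minus_mult_le_iff subarc_arc_len)

definition arc_const :: "real \<Rightarrow> real" where
  "arc_const p = 64 powr p * (7 / ln 2)\<^sup>2"

lemma arc_const_pos: "0 < arc_const p"
  by (simp add: arc_const_def)

text \<open>An arc of length at most $64 \cdot 2^{-j}$ has $\log(2/|I|) \ge (j - 5) \log 2$, and at
least $\log 2$ as $|I| \le 1$; together these dominate $(j+1) (\log 2)/7$.\<close>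

lemma dyadic_log_scale_le:
  assumes l: "0 < l" "l \<le> min 1 (64 * (1 / 2) ^ j)" and p: "0 < p"
  shows "l powr p / (ln (2 / l))\<^sup>2 \<le> arc_const p * ((1 / 2) ^ j) powr p / (real j + 1)\<^sup>2"
proof -
  have l2: "0 < ln (2::real)" by simp
  have 1: "ln 2 \<le> ln (2 / l)" using l by (intro ln_two_le_ln_two_div) auto
  have 2: "(real j - 5) * ln 2 \<le> ln (2 / l)"
  proof -
    have "2 / (64 * (1 / 2) ^ j) \<le> 2 / l" using l by (intro divide_left_mono) auto
    moreover have "2 / (64 * (1 / 2) ^ j) = (2::real) ^ j / 2 ^ 5" by (simp add: power_one_over)
    ultimately have "ln ((2::real) ^ j / 2 ^ 5) \<le> ln (2 / l)" by (intro ln_mono) auto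
    moreover have "ln ((2::real) ^ j / 2 ^ 5) = real j * ln 2 - 5 * ln 2"
    proof -
      have "ln ((2::real) ^ j / 2 ^ 5) = ln (2 ^ j) - ln (2 ^ 5)"
        by (rule ln_divide_pos) simp_all
      moreover have "ln ((2::real) ^ j) = real j * ln 2" by (rule ln_realpow)
      moreover have "ln ((2::real) ^ 5) = real 5 * ln 2" by (rule ln_realpow)
      ultimately show ?thesis by (simp only:)
    qed
    ultimately show ?thesis by (simp add: algebra_simps)
  qed
  have 3: "(real j + 1) * (ln 2 / 7) \<le> ln (2 / l)"
  proof (cases "j \<le> 6")
    case True
    then have "(real j + 1) * (ln 2 / 7) \<le> 7 * (ln 2 / 7)" using l2 by (intro mult_right_mono) auto
    then show ?thesis using 1 by linarith
  next
    case False
    then have "(real j + 1) * (ln 2 / 7) \<le> (7 * (real j - 5)) * (ln 2 / 7)" using l2 by (intro mult_right_mono) auto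
    also have "\<dots> = (real j - 5) * ln 2" by simp
    also note 2
    finally show ?thesis .
  qed
  have "l powr p / (ln (2 / l))\<^sup>2 \<le> (64 * (1 / 2) ^ j) powr p / ((real j + 1) * (ln 2 / 7))\<^sup>2"
    using l p l2 3 by (intro frac_le powr_mono2 power_mono) auto
  also have "(64 * (1 / 2 :: real) ^ j) powr p = 64 powr p * ((1 / 2) ^ j) powr p" by (rule powr_mult)
  also have "64 powr p * ((1 / 2) ^ j) powr p / ((real j + 1) * (ln 2 / 7))\<^sup>2 =
      arc_const p * ((1 / 2) ^ j) powr p / (real j + 1)\<^sup>2"
    by (simp add: arc_const_def power_mult_distrib power_divide mult_ac)
  finally show ?thesis .
qed

text \<open>Only arcs of length at most $64 \cdot 2^{-j}$ are used for the ball of scale $j$; this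
uniformity is what the vanishing condition needs.\<close>

lemma ball_emeasure_le_of_arcs:
  assumes M: "sets M = sets disk_borel" and p: "0 < p" and "0 \<le> k"
    and \<xi>: "cmod \<xi> = 1"
    and arcs: "\<And>J. subarc J \<Longrightarrow> arc_len J \<le> 64 * (1 / 2) ^ j \<Longrightarrow> log_carleson_ratio p M J \<le> ennreal k"
  shows "emeasure M (dyadic_ball \<xi> j) \<le>
    log_scale p (k * arc_const p) j"
proof -
  obtain J where J: "subarc J" "arc_len J \<le> min 1 (8 * (8 * (1 / 2) ^ j))"
    "dyadic_ball \<xi> j \<subseteq> carleson_square J" "carleson_square J \<in> sets borel"
    using exists_arc_around_point[OF \<xi>, of "8 * (1 / 2) ^ j"] by auto
  then have l: "0 < arc_len J" "arc_len J \<le> min 1 (64 * (1 / 2) ^ j)" by (auto simp: subarc_arc_len)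
  have "carleson_square J \<subseteq> unit_disk" using J by (intro carleson_square_subset_disk) (auto simp: subarc_def)
  then have "carleson_square J \<in> sets M" using J by (intro disk_measure_measurable(3)[OF M]) auto
  then have "emeasure M (dyadic_ball \<xi> j) \<le> emeasure M (carleson_square J)"
    using J by (intro emeasure_mono)
  also have "\<dots> \<le> ennreal (k * (arc_len J powr p / (ln (2 / arc_len J))\<^sup>2))"
    using arcs[OF J(1)] l log_carleson_ratio_le_iff[OF J(1) \<open>0 \<le> k\<close>] by auto
  also have "\<dots> \<le> ennreal (k * (arc_const p * ((1 / 2) ^ j) powr p / (real j + 1)\<^sup>2))"
    using \<open>0 \<le> k\<close> by (intro ennreal_leI mult_left_mono dyadic_log_scale_le[OF l p])
  finally show ?thesis by (simp add: mult_ac)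
qed

lemma subarc_dyadic_box:
  assumes "subarc I"
  obtains \<xi> m where "cmod \<xi> = 1" "carleson_square I \<subseteq> dyadic_box \<xi> m" "(1 / 2) ^ m \<le> 2 * arc_len I"
proof -
  obtain \<xi> where \<xi>: "\<xi> \<in> I" "cmod \<xi> = 1" using subarc_nonempty[OF assms] .
  obtain m where m: "(1 / 2) ^ Suc m < arc_len I" "arc_len I \<le> (1 / 2) ^ m"
    by (rule exists_dyadic_scale[of "arc_len I"]) (use assms in \<open>auto simp: subarc_arc_len\<close>)
  have "carleson_square I \<subseteq> dyadic_box \<xi> m"
  proof
    fix z assume "z \<in> carleson_square I"
    note z = carleson_square_near_point[OF assms \<xi>(1) this]
    have "1 - cmod z \<le> (1 / 2) ^ m" using z(2) m(2) by (rule order_trans)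
    moreover have "8 * arc_len I \<le> 8 * (1 / 2) ^ m" using m(2) by (intro mult_left_mono) auto
    then have "cmod (z - \<xi>) \<le> 8 * (1 / 2) ^ m" using z(3) by (rule order_trans[rotated])
    ultimately show "z \<in> dyadic_box \<xi> m" using z(1) by (simp add: dyadic_box_def)
  qed
  then show ?thesis using that[OF \<xi>(2)] m(1) by auto
qed

lemma carleson_square_energy_le:
  assumes f: "Qp_bounded_by p f B" and p: "0 < p"
    and M: "sets M = sets disk_borel"
    and H: "dyadic_log_carleson p M K" and I: "subarc I"
  shows "(\<integral>\<^sup>+z\<in>carleson_square I. ennreal ((cmod (f z))\<^sup>2) \<partial>M) \<le>
    ennreal (embedding_const p * 2 powr p * K * B\<^sup>2 * arc_len I powr p)"
proof -
  obtain \<xi> m where \<xi>: "cmod \<xi> = 1" "carleson_square I \<subseteq> dyadic_box \<xi> m" "(1 / 2) ^ m \<le> 2 * arc_len I"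
    using subarc_dyadic_box[OF I] .
  have K: "0 \<le> K" using H by (simp add: dyadic_log_carleson_def)
  have "(\<integral>\<^sup>+z\<in>carleson_square I. ennreal ((cmod (f z))\<^sup>2) \<partial>M) \<le> (\<integral>\<^sup>+z\<in>dyadic_box \<xi> m. ennreal ((cmod (f z))\<^sup>2) \<partial>M)"
    using \<xi>(2) by (intro nn_integral_mono) (auto simp: indicator_def)
  also have "\<dots> \<le> ennreal (embedding_const p * K * ((1 / 2) ^ m) powr p * B\<^sup>2)"
    by (rule box_embedding[OF f p M H \<xi>(1)])
  also have "\<dots> \<le> ennreal (embedding_const p * K * (2 powr p * arc_len I powr p) * B\<^sup>2)"
  proof -
    have "((1 / 2) ^ m) powr p \<le> (2 * arc_len I) powr p" using \<xi>(3) p by (intro powr_mono2) auto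
    also have "\<dots> = 2 powr p * arc_len I powr p" by (rule powr_mult)
    finally show ?thesis
      using K embedding_const_pos[OF p] by (intro ennreal_leI mult_right_mono mult_left_mono) auto
  qed
  finally show ?thesis by (simp add: mult_ac)
qed

lemma holomorphic_measurable_completion:
  assumes "f holomorphic_on unit_disk" "sets M = sets disk_borel"
  shows "f \<in> borel_measurable M" "f \<in> borel_measurable (completion M)"
proof -
  have "f \<in> borel_measurable (restrict_space borel unit_disk)"
    by (intro borel_measurable_continuous_on_restrict holomorphic_on_imp_continuous_on assms)
  then show "f \<in> borel_measurable M" unfolding measurable_cong_sets[OF assms(2) refl] .
  then show "f \<in> borel_measurable (completion M)" by (rule measurable_completion)
qed

lemma Qp_obtain_bound:
  assumes "f \<in> Qp p"
  obtains B where "0 \<le> B" "Qp_norm p f = ennreal B" "Qp_bounded_by p f B"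
proof -
  obtain B where B: "0 \<le> B" "Qp_norm p f = ennreal B"
    using assms by (cases "Qp_norm p f") (auto simp: Qp_def)
  then show ?thesis using that Qp_norm_le_imp_bounded_by[OF assms, of B] by auto
qed

lemma bounded_operator_of_dyadic:
  assumes p: "0 < p" and M: "sets M = sets disk_borel"
    and H: "dyadic_log_carleson p M K"
  shows "bounded_operator (Qp p) (Qp_norm p) (tent_space p M) (tent_norm p M) (\<lambda>f. f)"
proof -
  define C where "C = sqrt (embedding_const p * 2 powr p * K)"
  have K: "0 \<le> K" using H by (simp add: dyadic_log_carleson_def)
  then have C: "0 \<le> C" "C\<^sup>2 = embedding_const p * 2 powr p * K"
    using embedding_const_pos[OF p] by (auto simp: C_def)
  have le: "tent_norm p M f \<le> ennreal C * Qp_norm p f" if f: "f \<in> Qp p" for f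
  proof -
    obtain B where B: "0 \<le> B" "Qp_norm p f = ennreal B" "Qp_bounded_by p f B"
      using Qp_obtain_bound[OF f] .
    have "tent_norm p M f \<le> ennreal (C * B)"
      using C B(1) carleson_square_energy_le[OF B(3) p M H]
      by (subst tent_norm_le_iff) (auto simp: power_mult_distrib)
    then show ?thesis using B(2) C by (simp add: ennreal_mult')
  qed
  have "f \<in> tent_space p M" if f: "f \<in> Qp p" for f
  proof -
    have "ennreal C * Qp_norm p f < \<infinity>" using f by (auto simp: Qp_def ennreal_mult_less_top)
    then have "tent_norm p M f < \<infinity>" using le[OF f] by (rule le_less_trans[rotated])
    then show ?thesis using f holomorphic_measurable_completion(2)[OF _ M, of f] by (auto simp: tent_space_def Qp_def)
  qed
  then show ?thesis unfolding bounded_operator_def using le C(1) by auto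
qed

text \<open>Testing: a function that is large on $S(I)$ but has a small tent norm forces $S(I)$ to have
small measure. If $S(I)$ is not measurable, its measure is 0 by convention.\<close>

lemma log_carleson_ratio_le_of_lower_bound:
  assumes I: "subarc I" and f: "f \<in> borel_measurable M"
    and lower: "\<And>z. z \<in> carleson_square I \<Longrightarrow> ln (2 / arc_len I) \<le> a * cmod (f z)"
    and tent: "tent_norm p M f \<le> ennreal c" and "0 \<le> a" "0 \<le> c"
  shows "log_carleson_ratio p M I \<le> ennreal ((a * c)\<^sup>2)"
proof (cases "carleson_square I \<in> sets M")
  case False
  then show ?thesis by (simp add: log_carleson_ratio_def emeasure_notin_sets)
next
  case True
  define l where "l = arc_len I"
  define L where "L = ln (2 / l)"
  have l: "0 < l" "l \<le> 1" using I subarc_arc_len by (auto simp: l_def)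
  have L: "0 < L" using ln_two_le_ln_two_div[OF l] ln_gt_zero[of 2] unfolding L_def by linarith
  have "ennreal (L\<^sup>2) * emeasure M (carleson_square I) = (\<integral>\<^sup>+z. ennreal (L\<^sup>2) * indicator (carleson_square I) z \<partial>M)"
    using True by (simp add: nn_integral_cmult_indicator)
  also have "\<dots> \<le> (\<integral>\<^sup>+z. ennreal (a\<^sup>2) * (ennreal ((cmod (f z))\<^sup>2) * indicator (carleson_square I) z) \<partial>M)"
  proof (intro nn_integral_mono)
    fix z
    show "ennreal (L\<^sup>2) * indicator (carleson_square I) z \<le> ennreal (a\<^sup>2) * (ennreal ((cmod (f z))\<^sup>2) * indicator (carleson_square I) z)"
    proof (cases "z \<in> carleson_square I")
      case True
      have "L\<^sup>2 \<le> (a * cmod (f z))\<^sup>2" using lower[OF True] L by (intro power_mono) (auto simp: L_def l_def)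
      then have "ennreal (L\<^sup>2) \<le> ennreal (a\<^sup>2 * (cmod (f z))\<^sup>2)" by (intro ennreal_leI) (simp add: power_mult_distrib)
      then show ?thesis using True by (simp add: ennreal_mult')
    qed simp
  qed
  also have "\<dots> \<le> ennreal (a\<^sup>2) * ennreal (c\<^sup>2 * l powr p)"
  proof -
    have "(\<integral>\<^sup>+z. ennreal (a\<^sup>2) * (ennreal ((cmod (f z))\<^sup>2) * indicator (carleson_square I) z) \<partial>M) \<le>
       ennreal (a\<^sup>2) * (\<integral>\<^sup>+z\<in>carleson_square I. ennreal ((cmod (f z))\<^sup>2) \<partial>M)"
      using True f by (subst nn_integral_cmult) (auto intro!: borel_measurable_times_ennreal)
    also have "\<dots> \<le> ennreal (a\<^sup>2) * ennreal (c\<^sup>2 * l powr p)"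
      using tent I \<open>0 \<le> c\<close> by (intro mult_left_mono) (auto simp: tent_norm_le_iff l_def)
    finally show ?thesis .
  qed
  finally have le: "ennreal (L\<^sup>2) * emeasure M (carleson_square I) \<le> ennreal ((a * c)\<^sup>2 * l powr p)"
    by (simp add: ennreal_mult'[symmetric] power_mult_distrib mult_ac)
  have "emeasure M (carleson_square I) \<le> ennreal ((a * c)\<^sup>2 * l powr p / L\<^sup>2)"
  proof (cases "emeasure M (carleson_square I)")
    case (real e)
    then show ?thesis using le L by (simp add: ennreal_mult'[symmetric] field_simps)
  next
    case top
    then show ?thesis using le L by (simp add: ennreal_mult_top top_unique)
  qed
  then show ?thesis
    by (subst log_carleson_ratio_le_iff[OF I]) (simp_all add: l_def L_def)
qed

text \<open>The upper bound serves for the values of the test functions at the origin; the lower one absorbs the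
bound $\pi$ for imaginary parts of logarithms.\<close>

lemma ln_18_bounds: "2 \<le> ln (18::real)" "ln (18::real) \<le> 17"
proof -
  have "exp (2::real) = exp 1 * exp 1" by (simp flip: exp_add)
  also have "\<dots> \<le> 3 * 3" using exp_le by (intro mult_mono) auto
  finally have "exp (2::real) \<le> 18" by simp
  then show "2 \<le> ln (18::real)" by (subst ln_ge_iff) auto
  show "ln (18::real) \<le> 17" using ln_le_minus_one[of "18::real"] by simp
qed

lemma log_test_Qp:
  assumes p: "0 < p" and w: "cmod w < 1"
  shows "Qp_bounded_by p (log_test w) (log_test_const p * 17)"
proof (rule Qp_bounded_by_log_type[OF p _ w])
  show "log_test w holomorphic_on unit_disk"
    using log_test_basics(1)[OF w] by (subst holomorphic_on_open) (auto, blast)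
  show "cmod (log_test w 0) \<le> 17"
    using ln_18_bounds by (simp add: log_test_def)
  fix z assume z: "cmod z < 1"
  have "deriv (log_test w) z = cnj w / (1 - cnj w * z)"
    by (rule DERIV_imp_deriv[OF log_test_basics(1)[OF w z]])
  then show "cmod (deriv (log_test w) z) \<le> 17 / cmod (1 - cnj w * z)"
    using w by (simp add: norm_divide divide_right_mono)
qed simp

text \<open>The testing point $w$ lies above a point of the arc at height $|I|$; it is the origin when
the arc has full length.\<close>

lemma log_test_ge_on_square:
  assumes I: "subarc I" and \<xi>: "\<xi> \<in> I" and z: "z \<in> carleson_square I"
  shows "ln (2 / arc_len I) \<le> cmod (log_test (of_real (1 - arc_len I) * \<xi>) z)"
    and "cmod (of_real (1 - arc_len I) * \<xi>) = 1 - arc_len I"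
proof -
  define l where "l = arc_len I"
  define w where "w = of_real (1 - l) * \<xi>"
  have l: "0 < l" "l \<le> 1" using I subarc_arc_len by (auto simp: l_def)
  have n\<xi>: "cmod \<xi> = 1" using I \<xi> by (auto simp: subarc_def)
  have w: "cmod w = 1 - l" using l n\<xi> by (simp add: w_def norm_mult del: of_real_diff)
  then show "cmod (of_real (1 - arc_len I) * \<xi>) = 1 - arc_len I" by (simp add: w_def l_def)
  note near = carleson_square_near_point[OF I \<xi> z]
  have "\<xi> - w = of_real l * \<xi>" by (simp add: w_def algebra_simps)
  then have "cmod (\<xi> - w) = l" using l n\<xi> by (simp add: norm_mult)
  then have le: "cmod (1 - cnj w * z) \<le> 9 * l"
    using cmod_one_minus_cnj_mult_le[OF n\<xi>, of z w] near by (simp add: l_def norm_minus_commute)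
  have pos: "0 < cmod (1 - cnj w * z)" using mobius_defect(2)[of w z] w l near(1) by auto
  have "2 / l \<le> 18 / cmod (1 - cnj w * z)" using le pos l by (simp add: field_simps)
  then have "ln (2 / l) \<le> ln (18 / cmod (1 - cnj w * z))" using l pos by (intro ln_mono) auto
  also have "\<dots> = Re (log_test w z)" using log_test_basics(2)[of w z] w l near(1) by auto
  also have "\<dots> \<le> cmod (log_test w z)" by (rule complex_Re_le_cmod)
  finally show "ln (2 / arc_len I) \<le> cmod (log_test (of_real (1 - arc_len I) * \<xi>) z)"
    by (simp add: w_def l_def)
qed

lemma bounded_iff_LCM:
  assumes p: "0 < p" and M: "sets M = sets disk_borel"
  shows "bounded_operator (Qp p) (Qp_norm p) (tent_space p M) (tent_norm p M) (\<lambda>f. f)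
    \<longleftrightarrow> LCM_norm p M < \<infinity>"
proof
  assume "LCM_norm p M < \<infinity>"
  then obtain b where b: "0 \<le> b" "LCM_norm p M = ennreal b" by (cases "LCM_norm p M") auto
  have ratio: "log_carleson_ratio p M J \<le> ennreal (b\<^sup>2)" if "subarc J" for J
  proof -
    have "esqrt (log_carleson_ratio p M J) \<le> LCM_norm p M"
      unfolding LCM_norm_def using that by (intro SUP_upper) auto
    then show ?thesis using b by (simp add: esqrt_le_iff)
  qed
  have "dyadic_log_carleson p M (b\<^sup>2 * arc_const p)"
    unfolding dyadic_log_carleson_def
    using ball_emeasure_le_of_arcs[OF M p, of "b\<^sup>2"] ratio less_imp_le[OF arc_const_pos[of p]] by auto
  then show "bounded_operator (Qp p) (Qp_norm p) (tent_space p M) (tent_norm p M) (\<lambda>f. f)"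
    by (rule bounded_operator_of_dyadic[OF p M])
next
  assume "bounded_operator (Qp p) (Qp_norm p) (tent_space p M) (tent_norm p M) (\<lambda>f. f)"
  then obtain C where C: "0 \<le> C" "\<And>f. f \<in> Qp p \<Longrightarrow> tent_norm p M f \<le> ennreal C * Qp_norm p f"
    unfolding bounded_operator_def by auto
  define c where "c = C * (2 * (log_test_const p * 17))"
  have c: "0 \<le> c" using C log_test_const_ge_1[OF p] by (simp add: c_def)
  have "esqrt (log_carleson_ratio p M I) \<le> ennreal c" if I: "subarc I" for I
  proof -
    obtain \<xi> where \<xi>: "\<xi> \<in> I" "cmod \<xi> = 1" using subarc_nonempty[OF I] .
    define w where "w = of_real (1 - arc_len I) * \<xi>"
    have w: "cmod w < 1"
      using subarc_arc_len[of I] I \<xi> by (simp add: w_def norm_mult del: of_real_diff)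
    note Q = bounded_by_imp_Qp[OF log_test_Qp[OF p w]]
    have "tent_norm p M (log_test w) \<le> ennreal C * Qp_norm p (log_test w)" by (rule C(2)[OF Q(1)])
    also have "\<dots> \<le> ennreal C * ennreal (2 * (log_test_const p * 17))" by (intro mult_left_mono Q(2)) auto
    also have "\<dots> = ennreal c" using C by (simp add: c_def ennreal_mult')
    finally have "log_carleson_ratio p M I \<le> ennreal ((1 * c)\<^sup>2)"
      using log_test_ge_on_square(1)[OF I \<xi>(1)] c
      using holomorphic_measurable_completion(1)[OF _ M, of "log_test w"] Q(1)
      by (intro log_carleson_ratio_le_of_lower_bound[OF I]) (auto simp: w_def Qp_def)
    then show ?thesis using c by (simp add: esqrt_le_iff)
  qed
  then have "LCM_norm p M \<le> ennreal c" unfolding LCM_norm_def by (intro SUP_least) auto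
  then show "LCM_norm p M < \<infinity>" by (rule le_less_trans) simp
qed

section \<open>The compactness criterion\<close>

lemma Qp_bounded_by_diff:
  assumes f: "Qp_bounded_by p f B" and g: "Qp_bounded_by p g B"
  shows "Qp_bounded_by p (\<lambda>z. f z - g z) (2 * B)"
proof -
  have B: "0 \<le> B" and hf: "f holomorphic_on unit_disk" and hg: "g holomorphic_on unit_disk"
    using f g by (auto simp: Qp_bounded_by_def)
  have "Qp_energy p (\<lambda>z. f z - g z) w \<le> ennreal ((2 * B)\<^sup>2)" if w: "w \<in> unit_disk" for w
  proof -
    have w1: "cmod w < 1" using w by simp
    define V where "V z = (1 - (cmod (disk_involution w z))\<^sup>2) powr p" for z
    let ?I = "\<lambda>f z. ennreal ((cmod (deriv f z))\<^sup>2 * V z) * indicator unit_disk z"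
    have meas: "?I f \<in> borel_measurable borel" "?I g \<in> borel_measurable borel"
      unfolding V_def using Qp_integrand_measurable[OF hf w1] Qp_integrand_measurable[OF hg w1] by auto
    have "Qp_energy p (\<lambda>z. f z - g z) w \<le> (\<integral>\<^sup>+z. ennreal 2 * ?I f z + ennreal 2 * ?I g z \<partial>lborel)"
      unfolding Qp_energy_def V_def[symmetric]
    proof (rule nn_integral_mono)
      fix z
      show "ennreal ((cmod (deriv (\<lambda>z. f z - g z) z))\<^sup>2 * V z) * indicator unit_disk z \<le>
          ennreal 2 * ?I f z + ennreal 2 * ?I g z"
      proof (cases "z \<in> unit_disk")
        case True
        then have d: "deriv (\<lambda>z. f z - g z) z = deriv f z - deriv g z"
          using hf hg by (intro deriv_diff) (auto simp: holomorphic_on_imp_differentiable_at)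
        have V: "0 \<le> V z" by (simp add: V_def)
        have "(cmod (deriv f z - deriv g z))\<^sup>2 \<le> (cmod (deriv f z) + cmod (deriv g z))\<^sup>2"
          by (intro power_mono norm_triangle_ineq4) auto
        also have "\<dots> \<le> 2 * (cmod (deriv f z))\<^sup>2 + 2 * (cmod (deriv g z))\<^sup>2"
          using zero_le_power2[of "cmod (deriv f z) - cmod (deriv g z)"]
          by (simp add: power2_eq_square algebra_simps)
        finally have "(cmod (deriv f z - deriv g z))\<^sup>2 * V z \<le>
            2 * ((cmod (deriv f z))\<^sup>2 * V z) + 2 * ((cmod (deriv g z))\<^sup>2 * V z)"
          using mult_right_mono[OF _ V] by (fastforce simp: algebra_simps)
        then have "ennreal ((cmod (deriv f z - deriv g z))\<^sup>2 * V z) \<le>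
            ennreal (2 * ((cmod (deriv f z))\<^sup>2 * V z) + 2 * ((cmod (deriv g z))\<^sup>2 * V z))"
          by (rule ennreal_leI)
        also have "\<dots> = ennreal 2 * ennreal ((cmod (deriv f z))\<^sup>2 * V z) + ennreal 2 * ennreal ((cmod (deriv g z))\<^sup>2 * V z)"
          using V by (subst ennreal_plus) (auto simp: ennreal_mult)
        finally show ?thesis using True d by simp
      qed simp
    qed
    also have "\<dots> = ennreal 2 * Qp_energy p f w + ennreal 2 * Qp_energy p g w"
      using meas unfolding Qp_energy_def V_def[symmetric]
      by (subst nn_integral_add) (auto simp: nn_integral_cmult)
    also have "\<dots> \<le> ennreal 2 * ennreal (B\<^sup>2) + ennreal 2 * ennreal (B\<^sup>2)"
      using f g w by (intro add_mono mult_left_mono) (auto simp: Qp_bounded_by_def)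
    also have "\<dots> = ennreal (2 * B\<^sup>2 + 2 * B\<^sup>2)" by (subst ennreal_plus) (auto simp: ennreal_mult)
    also have "2 * B\<^sup>2 + 2 * B\<^sup>2 = (2 * B)\<^sup>2" by (simp add: power2_eq_square)
    finally show ?thesis .
  qed
  moreover have "cmod (f 0 - g 0) \<le> 2 * B"
    using f g norm_triangle_ineq4[of "f 0" "g 0"] by (auto simp: Qp_bounded_by_def)
  ultimately show ?thesis
    using B hf hg unfolding Qp_bounded_by_def by (auto intro!: holomorphic_intros)
qed

text \<open>Lower semicontinuity of the norm, by Fatou's lemma.\<close>

lemma Qp_bounded_by_limit:
  assumes s: "\<And>n. Qp_bounded_by p (s n) B" and g: "g holomorphic_on unit_disk"
    and lim0: "(\<lambda>n. s n 0) \<longlonglongrightarrow> g 0"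
    and lim: "\<And>z. z \<in> unit_disk \<Longrightarrow> (\<lambda>n. deriv (s n) z) \<longlonglongrightarrow> deriv g z"
  shows "Qp_bounded_by p g B"
proof -
  have B: "0 \<le> B" using s by (auto simp: Qp_bounded_by_def)
  have "Qp_energy p g w \<le> ennreal (B\<^sup>2)" if w: "w \<in> unit_disk" for w
  proof -
    let ?I = "\<lambda>f z. ennreal ((cmod (deriv f z))\<^sup>2 * (1 - (cmod (disk_involution w z))\<^sup>2) powr p) * indicator unit_disk z"
    have "liminf (\<lambda>n. ?I (s n) z) = ?I g z" for z
    proof (cases "z \<in> unit_disk")
      case True
      have "(\<lambda>n. ennreal ((cmod (deriv (s n) z))\<^sup>2 * (1 - (cmod (disk_involution w z))\<^sup>2) powr p)) \<longlonglongrightarrow>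
          ennreal ((cmod (deriv g z))\<^sup>2 * (1 - (cmod (disk_involution w z))\<^sup>2) powr p)"
        by (intro tendsto_intros tendsto_ennrealI lim True)
      then show ?thesis using True by (intro lim_imp_Liminf) auto
    next
      case False
      then show ?thesis by (simp add: Liminf_const)
    qed
    then have "Qp_energy p g w = (\<integral>\<^sup>+z. liminf (\<lambda>n. ?I (s n) z) \<partial>lborel)"
      unfolding Qp_energy_def by simp
    also have "\<dots> \<le> liminf (\<lambda>n. \<integral>\<^sup>+z. ?I (s n) z \<partial>lborel)"
      using s w by (intro nn_integral_liminf) (auto simp: Qp_bounded_by_def intro!: Qp_integrand_measurable)
    also have "\<dots> \<le> liminf (\<lambda>n::nat. ennreal (B\<^sup>2))"
      using s w by (intro Liminf_mono always_eventually) (auto simp: Qp_bounded_by_def Qp_energy_def)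
    also have "\<dots> = ennreal (B\<^sup>2)" by (simp add: Liminf_const)
    finally show ?thesis .
  qed
  moreover have "cmod (g 0) \<le> B"
    using s by (intro tendsto_upperbound[OF tendsto_norm[OF lim0]]) (auto simp: Qp_bounded_by_def)
  ultimately show ?thesis using B g by (simp add: Qp_bounded_by_def)
qed

lemma Qp_subsequence:
  fixes s :: "nat \<Rightarrow> complex \<Rightarrow> complex"
  assumes s: "\<And>n. Qp_bounded_by p (s n) B" and p: "0 \<le> p"
  obtains r g where "strict_mono r" "Qp_bounded_by p g B"
    "\<forall>K. compact K \<longrightarrow> K \<subseteq> unit_disk \<longrightarrow> uniform_limit K (\<lambda>n. s (r n)) g sequentially"
proof -
  have hol: "s n holomorphic_on unit_disk" for n using s by (auto simp: Qp_bounded_by_def)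
  have B: "0 \<le> B" using s by (auto simp: Qp_bounded_by_def)
  have bound: "\<exists>b. \<forall>h\<in>range s. \<forall>z\<in>K. cmod (h z) \<le> b" if K: "compact K" "K \<subseteq> unit_disk" for K
  proof (cases "K = {}")
    case False
    obtain z0 where z0: "z0 \<in> K" "\<And>z. z \<in> K \<Longrightarrow> cmod z \<le> cmod z0"
      using continuous_attains_sup[OF K(1) False, of cmod] by (auto intro: continuous_intros)
    then have "cmod z0 < 1" using K(2) by auto
    then have "0 < 1 - cmod z0" "1 - cmod z0 \<le> 1" by auto
    then obtain N where N: "(1 / 2 :: real) ^ Suc N < 1 - cmod z0"
      using exists_dyadic_scale[of "1 - cmod z0"] by blast
    have "cmod (s n z) \<le> (1 + 2 * 6 powr p) * (real N + 2) * B" if "z \<in> K" for n z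
    proof (rule Qp_growth[OF s p])
      show "(1 / 2) ^ Suc N < 1 - cmod z" using N z0(2)[OF that] by linarith
    qed
    then show ?thesis by blast
  qed auto
  obtain g r where g: "g holomorphic_on unit_disk" and r: "strict_mono r"
    and pt: "\<And>z. z \<in> unit_disk \<Longrightarrow> (\<lambda>n. s (r n) z) \<longlonglongrightarrow> g z"
    and unif: "\<And>K. compact K \<Longrightarrow> K \<subseteq> unit_disk \<Longrightarrow> uniform_limit K (s \<circ> r) g sequentially"
  proof (rule Montel[of unit_disk "range s" s])
    show "h holomorphic_on unit_disk" if "h \<in> range s" for h using that hol by auto
    show "\<exists>b. \<forall>h\<in>range s. \<forall>z\<in>K. cmod (h z) \<le> b" if "compact K" "K \<subseteq> unit_disk" for K
      by (rule bound[OF that])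
  qed (use that in blast)+
  have "(\<lambda>n. deriv (s (r n)) z) \<longlonglongrightarrow> deriv g z" if z: "z \<in> unit_disk" for z
  proof (rule deriv_complex_uniform_limit[where A = "ball z ((1 - cmod z) / 2)"])
    have sub: "cball z ((1 - cmod z) / 2) \<subseteq> unit_disk"
    proof
      fix x assume "x \<in> cball z ((1 - cmod z) / 2)"
      then show "x \<in> unit_disk" using norm_triangle_ineq2[of x z] z by (simp add: dist_norm norm_minus_commute field_simps)
    qed
    show "uniform_limit (ball z ((1 - cmod z) / 2)) (\<lambda>n. s (r n)) g sequentially"
      by (rule uniform_limit_on_subset[OF unif[unfolded o_def] ball_subset_cball]) (use sub in auto)
    show "\<forall>\<^sub>F n in sequentially. s (r n) holomorphic_on ball z ((1 - cmod z) / 2)"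
      using sub ball_subset_cball by (intro always_eventually allI holomorphic_on_subset[OF hol]) blast
  qed (use z in auto)
  then have "Qp_bounded_by p g B"
    using pt[of 0] by (intro Qp_bounded_by_limit[where s = "\<lambda>n. s (r n)", OF s g]) auto
  then show ?thesis using that[OF r] unif by (simp add: o_def)
qed

text \<open>The vanishing condition says that the constant in the Carleson condition is small at small
scales.\<close>

lemma vanishing_small_balls:
  assumes p: "0 < p" and M: "sets M = sets disk_borel"
    and van: "(log_carleson_ratio p M \<longlongrightarrow> 0) shrinking_arcs" and \<kappa>: "0 < \<kappa>"
  obtains J where "\<And>j \<xi>. J \<le> j \<Longrightarrow> cmod \<xi> = 1 \<Longrightarrow>
    emeasure M (dyadic_ball \<xi> j) \<le> log_scale p \<kappa> j"
proof -
  define k where "k = \<kappa> / arc_const p"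
  have k: "0 < k" using \<kappa> arc_const_pos[of p] by (simp add: k_def)
  have "eventually (\<lambda>I. log_carleson_ratio p M I < ennreal k) shrinking_arcs"
    using van k by (intro order_tendstoD) auto
  then obtain \<delta> where \<delta>: "0 < \<delta>" "\<And>I. subarc I \<Longrightarrow> arc_len I < \<delta> \<Longrightarrow> log_carleson_ratio p M I < ennreal k"
    unfolding eventually_shrinking_arcs by blast
  obtain J where J: "(1 / 2 :: real) ^ J < \<delta> / 64" using real_arch_pow_inv[of "\<delta> / 64" "1 / 2"] \<delta>(1) by auto
  show ?thesis
  proof (rule that[of J])
    fix j and \<xi> :: complex assume j: "J \<le> j" and \<xi>: "cmod \<xi> = 1"
    have "(1 / 2 :: real) ^ j \<le> (1 / 2) ^ J" using j by (intro power_decreasing) auto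
    then have "64 * (1 / 2) ^ j < \<delta>" using J by linarith
    then have "emeasure M (dyadic_ball \<xi> j) \<le>
        log_scale p (k * arc_const p) j"
      using k \<delta>(2) by (intro ball_emeasure_le_of_arcs[OF M p _ \<xi>]) (auto intro: less_imp_le)
    then show "emeasure M (dyadic_ball \<xi> j) \<le> log_scale p \<kappa> j"
      using arc_const_pos[of p] by (simp add: k_def)
  qed
qed

text \<open>An annulus next to the circle is covered by finitely many balls of finite measure, and local
finiteness handles the rest of the disk.\<close>

lemma vanishing_finite_measure:
  assumes p: "0 < p" and M: "sets M = sets disk_borel"
    and van: "(log_carleson_ratio p M \<longlongrightarrow> 0) shrinking_arcs"
    and loc: "\<And>K. compact K \<Longrightarrow> K \<subseteq> unit_disk \<Longrightarrow> emeasure M K < \<infinity>"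
  shows "finite_measure M"
proof
  obtain J where J: "\<And>j \<xi>. J \<le> j \<Longrightarrow> cmod \<xi> = 1 \<Longrightarrow>
    emeasure M (dyadic_ball \<xi> j) \<le> log_scale p 1 j"
    using vanishing_small_balls[OF p M van, of 1] by auto
  define h :: real where "h = 8 * (1 / 2) ^ J"
  have h: "0 < h" by (simp add: h_def)
  have "\<exists>k. finite k \<and> k \<subseteq> sphere (0::complex) 1 \<and> sphere 0 1 \<subseteq> (\<Union>x\<in>k. ball x (h / 2))"
    using seq_compact_imp_totally_bounded[OF compact_imp_seq_compact[OF compact_sphere[of 0 1]],
        rule_format, of "h / 2"] h by simp
  then obtain k where k: "finite k" "k \<subseteq> sphere (0::complex) 1" "sphere 0 1 \<subseteq> (\<Union>x\<in>k. ball x (h / 2))"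
    by blast
  have sub: "cball 0 (1 - h / 2) \<subseteq> unit_disk"
    using h by (intro subsetI) simp
  have K: "cball 0 (1 - h / 2) \<in> fmeasurable M"
    using loc[of "cball 0 (1 - h / 2)"] sub by (intro fmeasurableI disk_measure_measurable(3)[OF M]) auto
  have F: "unit_disk \<inter> cball \<xi> h \<in> fmeasurable M" if "\<xi> \<in> k" for \<xi>
  proof (intro fmeasurableI disk_measure_measurable(4)[OF M])
    have "cmod \<xi> = 1" using that k(2) by auto
    then show "emeasure M (unit_disk \<inter> cball \<xi> h) < \<infinity>"
      unfolding h_def by (intro le_less_trans[OF J[OF order_refl]]) auto
  qed auto
  have fm: "cball 0 (1 - h / 2) \<union> (\<Union>\<xi>\<in>k. unit_disk \<inter> cball \<xi> h) \<in> fmeasurable M"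
    using K F k(1) by (intro fmeasurable.Un fmeasurable.finite_UN) auto
  have "unit_disk \<subseteq> cball 0 (1 - h / 2) \<union> (\<Union>\<xi>\<in>k. unit_disk \<inter> cball \<xi> h)"
  proof
    fix z :: complex assume z: "z \<in> unit_disk"
    show "z \<in> cball 0 (1 - h / 2) \<union> (\<Union>\<xi>\<in>k. unit_disk \<inter> cball \<xi> h)"
    proof (cases "cmod z \<le> 1 - h / 2")
      case False
      obtain \<zeta> where \<zeta>: "cmod \<zeta> = 1" "cmod (\<zeta> - z) = 1 - cmod z"
        using nearest_circle_point[of z] z by auto
      then have d: "cmod (\<zeta> - z) < h / 2" using False by simp
      obtain \<xi> where \<xi>: "\<xi> \<in> k" "cmod (\<xi> - \<zeta>) < h / 2" using k(3) \<zeta>(1) by (force simp: dist_norm)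
      have "cmod (\<xi> - z) \<le> cmod (\<xi> - \<zeta>) + cmod (\<zeta> - z)" by norm
      then have "z \<in> cball \<xi> h" using d \<xi>(2) by (simp add: dist_norm)
      then show ?thesis using z \<xi>(1) by blast
    qed simp
  qed
  then have "emeasure M (space M) \<le> emeasure M (cball 0 (1 - h / 2) \<union> (\<Union>\<xi>\<in>k. unit_disk \<inter> cball \<xi> h))"
    using fm by (intro emeasure_mono) (auto simp: disk_measure_measurable(1)[OF M] fmeasurable_def)
  also have "\<dots> < \<infinity>" using fm by (simp add: fmeasurable_def)
  finally show "emeasure M (space M) \<noteq> \<infinity>" by simp
qed

text \<open>At the finitely many coarse scales the Carleson condition is only a bound on the total
mass.\<close>

lemma dyadic_log_carleson_of_tail:
  assumes "0 \<le> \<kappa>" and M: "sets M = sets disk_borel" and p: "0 < p"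
    and tail: "\<And>j \<xi>. J \<le> j \<Longrightarrow> cmod \<xi> = 1 \<Longrightarrow>
      emeasure M (dyadic_ball \<xi> j) \<le> log_scale p \<kappa> j"
    and total: "emeasure M (space M) \<le> ennreal (\<kappa> * (((1 / 2) ^ J) powr p / (real J + 1)\<^sup>2))"
  shows "dyadic_log_carleson p M \<kappa>"
  unfolding dyadic_log_carleson_def
proof (intro conjI allI impI \<open>0 \<le> \<kappa>\<close>)
  fix \<xi> :: complex and j assume \<xi>: "cmod \<xi> = 1"
  show "emeasure M (dyadic_ball \<xi> j) \<le> log_scale p \<kappa> j"
  proof (cases "J \<le> j")
    case False
    have "emeasure M (dyadic_ball \<xi> j) \<le> emeasure M (space M)"
      by (rule emeasure_space)
    also note total
    also have "ennreal (\<kappa> * (((1 / 2) ^ J) powr p / (real J + 1)\<^sup>2)) \<le> ennreal (\<kappa> * (((1 / 2) ^ j) powr p / (real j + 1)\<^sup>2))"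
    proof -
      have "(1 / 2 :: real) ^ J \<le> (1 / 2) ^ j" using False by (intro power_decreasing) auto
      then have "((1 / 2 :: real) ^ J) powr p \<le> ((1 / 2) ^ j) powr p" using p by (intro powr_mono2) auto
      moreover have "(real j + 1)\<^sup>2 \<le> (real J + 1)\<^sup>2" using False by (intro power_mono) auto
      ultimately have "((1 / 2) ^ J) powr p / (real J + 1)\<^sup>2 \<le> ((1 / 2) ^ j) powr p / (real j + 1)\<^sup>2"
        by (intro frac_le) auto
      then show ?thesis using \<open>0 \<le> \<kappa>\<close> by (intro ennreal_leI mult_left_mono)
    qed
    finally show ?thesis by simp
  qed (use tail \<xi> in auto)
qed

lemma vanishing_imp_dyadic:
  assumes p: "0 < p" and M: "sets M = sets disk_borel"
    and van: "(log_carleson_ratio p M \<longlongrightarrow> 0) shrinking_arcs"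
    and fin: "finite_measure M"
  shows "\<exists>K. dyadic_log_carleson p M K"
proof -
  interpret finite_measure M by fact
  obtain J where J: "\<And>j \<xi>. J \<le> j \<Longrightarrow> cmod \<xi> = 1 \<Longrightarrow>
    emeasure M (dyadic_ball \<xi> j) \<le> log_scale p 1 j"
    using vanishing_small_balls[OF p M van, of 1] by auto
  define b where "b = ((1 / 2) ^ J) powr p / (real J + 1)\<^sup>2"
  have b: "0 < b" by (simp add: b_def)
  define K where "K = max 1 (measure M (space M) / b)"
  have K: "1 \<le> K" "measure M (space M) \<le> K * b"
    using b by (auto simp: K_def pos_divide_le_eq[symmetric])
  have "dyadic_log_carleson p M K"
  proof (rule dyadic_log_carleson_of_tail[OF _ M p, of _ J])
    fix j and \<xi> :: complex assume j: "J \<le> j" "cmod \<xi> = 1"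
    have "log_scale p 1 j \<le> log_scale p K j"
      using K by (intro ennreal_leI divide_right_mono mult_right_mono) auto
    with J[OF j] show "emeasure M (dyadic_ball \<xi> j) \<le> log_scale p K j"
      by (rule order_trans)
  next
    show "emeasure M (space M) \<le> ennreal (K * (((1 / 2) ^ J) powr p / (real J + 1)\<^sup>2))"
      using K unfolding b_def[symmetric] emeasure_eq_measure by (intro ennreal_leI)
  qed (use K in auto)
  then show ?thesis by blast
qed

definition outer_part :: "real \<Rightarrow> complex measure \<Rightarrow> complex measure" where
  "outer_part \<rho> M = density M (indicator {z \<in> unit_disk. \<rho> \<le> cmod z})"

lemma outer_set_in_sets:
  assumes "sets M = sets disk_borel"
  shows "{z \<in> unit_disk. \<rho> \<le> cmod z} \<in> sets M"
proof -
  have "{z \<in> unit_disk. \<rho> \<le> cmod z} = unit_disk \<inter> {z. \<rho> \<le> cmod z}" by auto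
  also have "\<dots> \<in> sets M" by (intro disk_measure_measurable(4)[OF assms]) measurable
  finally show ?thesis .
qed

text \<open>Small scales are handled by the vanishing condition. Once these are fixed, the annulus can be
chosen so thin that its total mass meets the finitely many remaining conditions. Covering large squares by small
ones instead would lose a power of the scale when $p < 1$.\<close>

lemma vanishing_outer_part:
  assumes p: "0 < p" and M: "sets M = sets disk_borel"
    and van: "(log_carleson_ratio p M \<longlongrightarrow> 0) shrinking_arcs"
    and fin: "finite_measure M" and \<kappa>: "0 < \<kappa>"
  shows "\<exists>\<rho>. 0 \<le> \<rho> \<and> \<rho> < 1 \<and> dyadic_log_carleson p (outer_part \<rho> M) \<kappa>"
proof -
  interpret finite_measure M by fact
  obtain J where J: "\<And>j \<xi>. J \<le> j \<Longrightarrow> cmod \<xi> = 1 \<Longrightarrow>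
    emeasure M (dyadic_ball \<xi> j) \<le> log_scale p \<kappa> j"
    using vanishing_small_balls[OF p M van \<kappa>] by auto
  define b where "b = ((1 / 2) ^ J) powr p / (real J + 1)\<^sup>2"
  have b: "0 < b" by (simp add: b_def)
  define A where "A k = {z \<in> unit_disk. 1 - 1 / (real k + 1) \<le> cmod z}" for k :: nat
  have As: "A k \<in> sets M" for k unfolding A_def by (rule outer_set_in_sets[OF M])
  have dec: "decseq A"
  proof (rule decseq_SucI)
    fix k
    have "1 / (real (Suc k) + 1) \<le> 1 / (real k + 1)" by (intro divide_left_mono) auto
    then show "A (Suc k) \<subseteq> A k" by (auto simp: A_def)
  qed
  have "(\<Inter>k. A k) = {}"
  proof (rule ccontr)
    assume "(\<Inter>k. A k) \<noteq> {}"
    then obtain z where z: "\<And>k. z \<in> A k" by auto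
    then have "0 < 1 - cmod z" by (auto simp: A_def)
    then obtain k where "inverse (real (Suc k)) < 1 - cmod z" using reals_Archimedean by blast
    then show False using z[of k] by (simp add: A_def inverse_eq_divide add.commute)
  qed
  then have "(\<lambda>k. emeasure M (A k)) \<longlonglongrightarrow> 0"
    using Lim_emeasure_decseq[of A M] As dec by (auto simp: image_subset_iff)
  then have "eventually (\<lambda>k. emeasure M (A k) < ennreal (\<kappa> * b)) sequentially"
    using \<kappa> b by (intro order_tendstoD) auto
  then obtain k where k: "emeasure M (A k) < ennreal (\<kappa> * b)" by (auto simp: eventually_sequentially)
  define \<rho> where "\<rho> = 1 - 1 / (real k + 1)"
  have \<rho>: "0 \<le> \<rho>" "\<rho> < 1" by (auto simp: \<rho>_def)
  have Ak: "{z \<in> unit_disk. \<rho> \<le> cmod z} = A k" by (simp add: A_def \<rho>_def)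
  have em: "emeasure (outer_part \<rho> M) X = emeasure M (A k \<inter> X)" if "X \<in> sets M" for X
    unfolding outer_part_def Ak using As that by (rule emeasure_restricted)
  have setsN: "sets (outer_part \<rho> M) = sets M" by (simp add: outer_part_def)
  have "dyadic_log_carleson p (outer_part \<rho> M) \<kappa>"
  proof (rule dyadic_log_carleson_of_tail[OF _ _ p, of _ _ J])
    fix j and \<xi> :: complex assume j: "J \<le> j" "cmod \<xi> = 1"
    have X: "dyadic_ball \<xi> j \<in> sets M" by (rule disk_measure_measurable(4)[OF M]) auto
    have "emeasure (outer_part \<rho> M) (dyadic_ball \<xi> j) \<le> emeasure M (dyadic_ball \<xi> j)"
      unfolding em[OF X] using X by (intro emeasure_mono) auto
    with J[OF j] show "emeasure (outer_part \<rho> M) (dyadic_ball \<xi> j) \<le> log_scale p \<kappa> j"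
      by (rule order_trans[rotated])
  next
    have "emeasure (outer_part \<rho> M) (space (outer_part \<rho> M)) = emeasure M (A k \<inter> space M)"
      using em[of "space M"] by (simp add: outer_part_def)
    also have "\<dots> \<le> emeasure M (A k)" using As by (intro emeasure_mono) auto
    also have "\<dots> \<le> ennreal (\<kappa> * b)" using k by simp
    finally show "emeasure (outer_part \<rho> M) (space (outer_part \<rho> M)) \<le> ennreal (\<kappa> * (((1 / 2) ^ J) powr p / (real J + 1)\<^sup>2))"
      by (simp add: b_def)
  qed (use \<kappa> M setsN in auto)
  then show ?thesis using \<rho> by blast
qed

text \<open>Near the circle the embedding inequality is applied to the outer part of the measure, with its
small constant; elsewhere $f$ itself is small.\<close>

lemma split_energy_le:
  assumes f: "Qp_bounded_by p f B" and p: "0 < p"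
    and M: "sets M = sets disk_borel"
    and H: "dyadic_log_carleson p M K" and H': "dyadic_log_carleson p (outer_part \<rho> M) \<kappa>"
    and small: "\<And>z. cmod z \<le> \<rho> \<Longrightarrow> cmod z < 1 \<Longrightarrow> cmod (f z) \<le> \<eta>" and I: "subarc I"
  shows "(\<integral>\<^sup>+z\<in>carleson_square I. ennreal ((cmod (f z))\<^sup>2) \<partial>M) \<le>
    ennreal (2 powr p * (embedding_const p * \<kappa> * B\<^sup>2 + K * \<eta>\<^sup>2) * arc_len I powr p)"
proof -
  obtain \<xi> m where \<xi>: "cmod \<xi> = 1" "carleson_square I \<subseteq> dyadic_box \<xi> m" "(1 / 2) ^ m \<le> 2 * arc_len I"
    using subarc_dyadic_box[OF I] .
  have K: "0 \<le> K" and \<kappa>: "0 \<le> \<kappa>" using H H' by (auto simp: dyadic_log_carleson_def)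
  have hol: "f holomorphic_on unit_disk" using f by (simp add: Qp_bounded_by_def)
  define A where "A = {z \<in> unit_disk. \<rho> \<le> cmod z}"
  define Z where "Z = dyadic_box \<xi> m"
  have [measurable]: "A \<in> sets M" "Z \<in> sets M"
    unfolding A_def Z_def by (rule outer_set_in_sets[OF M], rule dyadic_box_in_sets[OF M])
  have fm[measurable]: "f \<in> borel_measurable M" by (rule holomorphic_measurable_completion(1)[OF hol M])
  have "(\<integral>\<^sup>+z\<in>carleson_square I. ennreal ((cmod (f z))\<^sup>2) \<partial>M) \<le>
      (\<integral>\<^sup>+z. indicator A z * (ennreal ((cmod (f z))\<^sup>2) * indicator Z z) + ennreal (\<eta>\<^sup>2) * indicator Z z \<partial>M)"
  proof (rule nn_integral_mono)
    fix z
    show "ennreal ((cmod (f z))\<^sup>2) * indicator (carleson_square I) z \<le>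
      indicator A z * (ennreal ((cmod (f z))\<^sup>2) * indicator Z z) + ennreal (\<eta>\<^sup>2) * indicator Z z"
    proof (cases "z \<in> carleson_square I")
      case True
      then have z: "z \<in> Z" "cmod z < 1" using \<xi>(2) by (auto simp: Z_def dyadic_box_def)
      show ?thesis
      proof (cases "\<rho> \<le> cmod z")
        case False
        then have "(cmod (f z))\<^sup>2 \<le> \<eta>\<^sup>2" using small[of z] z by (intro power_mono) auto
        then show ?thesis using z True False by (simp add: A_def ennreal_leI)
      qed (use z True in \<open>simp add: A_def\<close>)
    qed simp
  qed
  also have "\<dots> = (\<integral>\<^sup>+z\<in>Z. ennreal ((cmod (f z))\<^sup>2) \<partial>outer_part \<rho> M) + ennreal (\<eta>\<^sup>2) * emeasure M Z"
    unfolding outer_part_def A_def[symmetric]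
    by (subst nn_integral_add) (auto simp: nn_integral_density nn_integral_cmult_indicator)
  also have "(\<integral>\<^sup>+z\<in>Z. ennreal ((cmod (f z))\<^sup>2) \<partial>outer_part \<rho> M) \<le> ennreal (embedding_const p * \<kappa> * ((1 / 2) ^ m) powr p * B\<^sup>2)"
    unfolding Z_def by (rule box_embedding[OF f p _ H' \<xi>(1)]) (simp add: outer_part_def M)
  also have "ennreal (\<eta>\<^sup>2) * emeasure M Z \<le> ennreal (\<eta>\<^sup>2) * ennreal (K * ((1 / 2) ^ m) powr p)"
  proof (rule mult_left_mono)
    have "emeasure M Z \<le> emeasure M (dyadic_ball \<xi> m)"
      by (intro emeasure_mono disk_measure_measurable(4)[OF M])
        (auto simp: Z_def dyadic_box_def dist_norm norm_minus_commute)
    also have "\<dots> \<le> log_scale p K m"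
      using H \<xi> by (auto simp: dyadic_log_carleson_def)
    also have "\<dots> \<le> ennreal (K * ((1 / 2) ^ m) powr p)"
    proof (intro ennreal_leI)
      have "K * ((1 / 2) ^ m) powr p / (real m + 1)\<^sup>2 \<le> K * ((1 / 2) ^ m) powr p / 1"
        using K by (intro divide_left_mono) auto
      then show "K * ((1 / 2) ^ m) powr p / (real m + 1)\<^sup>2 \<le> K * ((1 / 2) ^ m) powr p" by simp
    qed
    finally show "emeasure M Z \<le> ennreal (K * ((1 / 2) ^ m) powr p)" .
  qed simp
  also have "ennreal (embedding_const p * \<kappa> * ((1 / 2) ^ m) powr p * B\<^sup>2) + ennreal (\<eta>\<^sup>2) * ennreal (K * ((1 / 2) ^ m) powr p)
      = ennreal ((embedding_const p * \<kappa> * B\<^sup>2 + K * \<eta>\<^sup>2) * ((1 / 2) ^ m) powr p)"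
    using K \<kappa> embedding_const_pos[OF p]
    by (simp add: ennreal_mult'[symmetric] ennreal_plus[symmetric] algebra_simps del: ennreal_plus)
  also have "\<dots> \<le> ennreal ((embedding_const p * \<kappa> * B\<^sup>2 + K * \<eta>\<^sup>2) * (2 powr p * arc_len I powr p))"
  proof (intro ennreal_leI mult_left_mono)
    have "((1 / 2) ^ m) powr p \<le> (2 * arc_len I) powr p" using \<xi>(3) p by (intro powr_mono2) auto
    also have "\<dots> = 2 powr p * arc_len I powr p" by (rule powr_mult)
    finally show "((1 / 2) ^ m) powr p \<le> 2 powr p * arc_len I powr p" .
    show "0 \<le> embedding_const p * \<kappa> * B\<^sup>2 + K * \<eta>\<^sup>2" using K \<kappa> embedding_const_pos[OF p] by simp
  qed
  finally show ?thesis by (simp add: mult_ac add_right_mono add_left_mono)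
qed

lemma ennreal_pos_obtain_real:
  fixes a :: ennreal
  assumes "0 < a"
  obtains e where "0 < e" "ennreal e < a"
proof (cases a)
  case (real x)
  then show ?thesis using that[of "x / 2"] assms by (simp add: ennreal_less_iff)
next
  case top
  then show ?thesis using that[of 1] by simp
qed

lemma tendsto_zero_ennreal_of_le:
  fixes X :: "nat \<Rightarrow> ennreal"
  assumes "\<And>\<epsilon>. 0 < \<epsilon> \<Longrightarrow> eventually (\<lambda>n. X n \<le> ennreal \<epsilon>) sequentially"
  shows "X \<longlonglongrightarrow> 0"
proof (rule order_tendstoI)
  fix a :: ennreal assume "0 < a"
  then obtain e where e: "0 < e" "ennreal e < a" by (rule ennreal_pos_obtain_real)
  from assms[OF e(1)] show "eventually (\<lambda>n. X n < a) sequentially"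
    by eventually_elim (use e(2) in \<open>simp add: le_less_trans\<close>)
qed simp

text \<open>The limit of the subsequence is the locally uniform one. The two error terms, from the annulus
and from the rest of the disk, are each made at most half of the square of the given bound.\<close>

lemma compact_of_vanishing:
  assumes p: "0 < p" and M: "sets M = sets disk_borel"
    and van: "(log_carleson_ratio p M \<longlongrightarrow> 0) shrinking_arcs"
    and loc: "\<And>K. compact K \<Longrightarrow> K \<subseteq> unit_disk \<Longrightarrow> emeasure M K < \<infinity>"
  shows "compact_operator (Qp p) (Qp_norm p) (tent_space p M) (tent_norm p M) (\<lambda>f. f)"
proof -
  have fin: "finite_measure M" by (rule vanishing_finite_measure[OF p M van loc])
  obtain K where K: "dyadic_log_carleson p M K" using vanishing_imp_dyadic[OF p M van fin] by blast
  have K0: "0 \<le> K" using K by (simp add: dyadic_log_carleson_def)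
  have sub: "Qp p \<subseteq> tent_space p M"
    using bounded_operator_of_dyadic[OF p M K] by (auto simp: bounded_operator_def)
  have "\<exists>y\<in>tent_space p M. \<exists>r. strict_mono r \<and> (\<lambda>n. tent_norm p M (s (r n) - y)) \<longlonglongrightarrow> 0"
    if s: "range s \<subseteq> Qp p" "\<forall>n. Qp_norm p (s n) \<le> ennreal B0" for s :: "nat \<Rightarrow> complex \<Rightarrow> complex" and B0
  proof -
    define B where "B = max B0 0"
    have B: "0 \<le> B" by (simp add: B_def)
    have sB: "Qp_bounded_by p (s n) B" for n
    proof (rule Qp_norm_le_imp_bounded_by)
      have "ennreal B0 \<le> ennreal B" by (intro ennreal_leI) (simp add: B_def)
      then show "Qp_norm p (s n) \<le> ennreal B" using s(2) by (meson order_trans)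
    qed (use s B in auto)
    obtain g r where r: "strict_mono r" and g: "Qp_bounded_by p g B"
      and unif: "\<forall>K. compact K \<longrightarrow> K \<subseteq> unit_disk \<longrightarrow> uniform_limit K (\<lambda>n. s (r n)) g sequentially"
      by (rule Qp_subsequence[where s = s, OF sB less_imp_le[OF p]])
    have "eventually (\<lambda>n. tent_norm p M (s (r n) - g) \<le> ennreal \<epsilon>) sequentially" if \<epsilon>: "0 < \<epsilon>" for \<epsilon>
    proof -
      \<comment> \<open>the summand 1 keeps the divisor positive when B is 0; likewise in K + 1 below\<close>
      define E where "E = embedding_const p * (2 * B)\<^sup>2 + 1"
      have E: "1 \<le> E" using embedding_const_pos[OF p] by (simp add: E_def)
      define c where "c = \<epsilon>\<^sup>2 / (2 * 2 powr p)"
      have c: "0 < c" using \<epsilon> by (simp add: c_def)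
      define \<kappa> where "\<kappa> = c / E"
      have \<kappa>: "0 < \<kappa>" using c E by (simp add: \<kappa>_def)
      define \<eta> where "\<eta> = sqrt (c / (K + 1))"
      have \<eta>: "0 < \<eta>" using c K0 by (simp add: \<eta>_def)
      obtain \<rho> where \<rho>: "0 \<le> \<rho>" "\<rho> < 1" "dyadic_log_carleson p (outer_part \<rho> M) \<kappa>"
        using vanishing_outer_part[OF p M van fin \<kappa>] by blast
      have "uniform_limit (cball 0 \<rho>) (\<lambda>n. s (r n)) g sequentially"
        using \<rho>(2) by (intro unif[rule_format]) auto
      then have "eventually (\<lambda>n. \<forall>z\<in>cball 0 \<rho>. dist (s (r n) z) (g z) < \<eta>) sequentially"
        using \<eta> by (simp add: uniform_limit_iff)
      then show ?thesis
      proof eventually_elim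
        case (elim n)
        define f where "f z = s (r n) z - g z" for z
        have fB: "Qp_bounded_by p f (2 * B)" unfolding f_def by (rule Qp_bounded_by_diff[OF sB g])
        have "2 powr p * (embedding_const p * \<kappa> * (2 * B)\<^sup>2 + K * \<eta>\<^sup>2) \<le> \<epsilon>\<^sup>2"
        proof -
          have "embedding_const p * \<kappa> * (2 * B)\<^sup>2 \<le> E * \<kappa>" using \<kappa> by (simp add: E_def algebra_simps)
          also have "\<dots> = c" using E by (simp add: \<kappa>_def)
          finally have 1: "embedding_const p * \<kappa> * (2 * B)\<^sup>2 \<le> c" .
          have "K * \<eta>\<^sup>2 = K * (c / (K + 1))" using c K0 by (simp add: \<eta>_def)
          also have "\<dots> \<le> c" using c K0 by (simp add: field_simps)
          finally have "2 powr p * (embedding_const p * \<kappa> * (2 * B)\<^sup>2 + K * \<eta>\<^sup>2) \<le> 2 powr p * (c + c)"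
            using 1 by (intro mult_left_mono add_mono) auto
          also have "\<dots> = \<epsilon>\<^sup>2" by (simp add: c_def)
          finally show ?thesis .
        qed
        moreover have "(\<integral>\<^sup>+z\<in>carleson_square I. ennreal ((cmod (f z))\<^sup>2) \<partial>M) \<le>
            ennreal (2 powr p * (embedding_const p * \<kappa> * (2 * B)\<^sup>2 + K * \<eta>\<^sup>2) * arc_len I powr p)" if I: "subarc I" for I
          using elim by (intro split_energy_le[OF fB p M K \<rho>(3) _ I]) (auto simp: f_def dist_norm intro: less_imp_le)
        ultimately have "\<forall>I. subarc I \<longrightarrow> (\<integral>\<^sup>+z\<in>carleson_square I. ennreal ((cmod (f z))\<^sup>2) \<partial>M) \<le> ennreal (\<epsilon>\<^sup>2 * arc_len I powr p)"
          by (meson ennreal_leI mult_right_mono order_trans powr_ge_zero)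
        then have "tent_norm p M f \<le> ennreal \<epsilon>" using \<epsilon> by (subst tent_norm_le_iff) auto
        then show ?case by (simp add: f_def[abs_def] fun_diff_def)
      qed
    qed
    then have "(\<lambda>n. tent_norm p M (s (r n) - g)) \<longlonglongrightarrow> 0"
      by (intro tendsto_zero_ennreal_of_le)
    moreover have "g \<in> tent_space p M" using bounded_by_imp_Qp(1)[OF g] sub by blast
    ultimately show ?thesis using r by blast
  qed
  then show ?thesis unfolding compact_operator_def using sub by auto
qed

text \<open>Squaring and dividing by the maximal size of the logarithm keeps the size on the square below
$w$ and the norm in $Q_p$, but makes the functions tend to 0 pointwise as $w$ tends to the circle.\<close>

definition log_square_test :: "complex \<Rightarrow> complex \<Rightarrow> complex" where
  "log_square_test w z = (log_test w z)\<^sup>2 / of_real (ln (18 / (1 - cmod w)))"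

lemma ln_18_div_ge:
  assumes "cmod w < 1"
  shows "2 \<le> ln (18 / (1 - cmod w))"
proof -
  have "18 \<le> 18 / (1 - cmod w)" using assms by (simp add: pos_le_divide_eq)
  then have "ln 18 \<le> ln (18 / (1 - cmod w))" by (intro ln_mono) auto
  then show ?thesis using ln_18_bounds by linarith
qed

lemma log_square_test_Qp:
  assumes p: "0 < p" and w: "cmod w < 1"
  shows "Qp_bounded_by p (log_square_test w) (log_test_const p * 17)"
proof (rule Qp_bounded_by_log_type[OF p _ w])
  define L where "L = ln (18 / (1 - cmod w))"
  have L: "2 \<le> L" unfolding L_def by (rule ln_18_div_ge[OF w])
  have der: "(log_square_test w has_field_derivative
      2 * log_test w z * (cnj w / (1 - cnj w * z)) / of_real L) (at z)" if z: "cmod z < 1" for z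
    unfolding log_square_test_def[abs_def] L_def[symmetric]
    by (rule DERIV_cdivide) (use DERIV_power[OF log_test_basics(1)[OF w z], of 2] in \<open>simp add: mult_ac\<close>)
  then show "log_square_test w holomorphic_on unit_disk"
    by (subst holomorphic_on_open) (auto, blast)
  have "cmod (log_square_test w 0) = (ln 18)\<^sup>2 / L"
    using L by (simp add: log_square_test_def log_test_def L_def[symmetric] norm_divide norm_power)
  also have "\<dots> \<le> (ln 18)\<^sup>2 / ln 18"
  proof -
    have "18 \<le> 18 / (1 - cmod w)" using w by (simp add: pos_le_divide_eq)
    then have "ln 18 \<le> L" unfolding L_def by (intro ln_mono) auto
    then show ?thesis using L ln_18_bounds by (intro divide_left_mono) auto
  qed
  also have "\<dots> \<le> 17" using ln_18_bounds by (simp add: power2_eq_square)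
  finally show "cmod (log_square_test w 0) \<le> 17" .
  fix z assume z: "cmod z < 1"
  define R where "R = cmod (1 - cnj w * z)"
  have R: "0 < R" unfolding R_def by (rule mobius_defect(2)[OF w z])
  have "cmod (log_test w z) \<le> L + pi" unfolding L_def by (rule log_test_basics(3)[OF w z])
  also have "\<dots> \<le> 3 * L" using L pi_less_4 by linarith
  finally have l: "cmod (log_test w z) \<le> 3 * L" .
  have "cmod (deriv (log_square_test w) z) = 2 * cmod (log_test w z) * (cmod w / R) / L"
    unfolding DERIV_imp_deriv[OF der[OF z]] using L by (simp add: norm_mult norm_divide R_def)
  also have "\<dots> \<le> 2 * (3 * L) * (1 / R) / L"
    using l L R w by (intro divide_right_mono mult_mono) auto
  also have "\<dots> = 6 / R" using L by simp
  also have "\<dots> \<le> 17 / R" using R by (intro divide_right_mono) auto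
  finally show "cmod (deriv (log_square_test w) z) \<le> 17 / cmod (1 - cnj w * z)" by (simp add: R_def)
qed simp

lemma log_square_test_ge_on_square:
  assumes I: "subarc I" and \<xi>: "\<xi> \<in> I" and z: "z \<in> carleson_square I"
  shows "ln (2 / arc_len I) \<le> 5 * cmod (log_square_test (of_real (1 - arc_len I) * \<xi>) z)"
proof -
  define l where "l = arc_len I"
  define w where "w = of_real (1 - l) * \<xi>"
  define N where "N = ln (2 / l)"
  define L where "L = ln (18 / l)"
  have l: "0 < l" "l \<le> 1" using I subarc_arc_len by (auto simp: l_def)
  have nw: "cmod w = 1 - l" using log_test_ge_on_square(2)[OF I \<xi> z] by (simp add: w_def l_def)
  have N: "ln 2 \<le> N" unfolding N_def by (rule ln_two_le_ln_two_div[OF l])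
  have N0: "0 < N" using N ln_gt_zero[of 2] by linarith
  have "L = ln 9 + N"
    unfolding L_def N_def using l by (subst ln_mult_pos[symmetric]) auto
  also have "ln 9 \<le> ln ((2::real) ^ 4)" by (intro ln_mono) auto
  also have "ln ((2::real) ^ 4) = real 4 * ln 2" by (rule ln_realpow)
  finally have L: "L \<le> 5 * N" using N by simp
  have L0: "0 < L" using ln_18_div_ge[of w] nw l by (simp add: L_def)
  have "N * L \<le> N * (5 * N)" using L N0 by (intro mult_left_mono) auto
  also have "\<dots> = 5 * N\<^sup>2" by (simp add: power2_eq_square)
  also have "\<dots> \<le> 5 * (cmod (log_test w z))\<^sup>2"
    using log_test_ge_on_square(1)[OF I \<xi> z] N0
    by (intro mult_left_mono power_mono) (auto simp: N_def w_def l_def)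
  finally have "N \<le> 5 * (cmod (log_test w z))\<^sup>2 / L" using L0 by (simp add: pos_le_divide_eq)
  moreover have "cmod (log_square_test w z) = (cmod (log_test w z))\<^sup>2 / L"
    using L0 by (simp add: log_square_test_def nw L_def norm_divide norm_power)
  ultimately show ?thesis by (simp add: N_def w_def l_def)
qed

lemma log_square_test_tendsto_0:
  assumes w: "\<And>n. cmod (w n) < 1" and lim: "(\<lambda>n. cmod (w n)) \<longlonglongrightarrow> 1" and z: "cmod z < 1"
  shows "(\<lambda>n. log_square_test (w n) z) \<longlonglongrightarrow> 0"
proof (rule Lim_null_comparison)
  define D where "D = (ln (18 / (1 - cmod z)) + pi)\<^sup>2"
  show "\<forall>\<^sub>F n in sequentially. cmod (log_square_test (w n) z) \<le> D / ln (18 / (1 - cmod (w n)))"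
  proof (intro always_eventually allI)
    fix n
    have L: "2 \<le> ln (18 / (1 - cmod (w n)))" by (rule ln_18_div_ge[OF w])
    have "(cmod (log_test (w n) z))\<^sup>2 \<le> D"
      unfolding D_def by (intro power_mono log_test_basics(4)[OF w z]) auto
    then show "cmod (log_square_test (w n) z) \<le> D / ln (18 / (1 - cmod (w n)))"
      using L by (simp add: log_square_test_def norm_divide norm_power divide_right_mono)
  qed
  have "((\<lambda>x::real. D / ln (18 / x)) \<longlongrightarrow> 0) (at_right 0)"
    by real_asymp
  moreover have "filterlim (\<lambda>n. 1 - cmod (w n)) (at_right 0) sequentially"
  proof (rule tendsto_imp_filterlim_at_right)
    show "(\<lambda>n. 1 - cmod (w n)) \<longlonglongrightarrow> 0" using tendsto_diff[OF tendsto_const lim, of 1] by simp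
  qed (use w in auto)
  ultimately show "(\<lambda>n. D / ln (18 / (1 - cmod (w n)))) \<longlonglongrightarrow> 0"
    by (rule filterlim_compose)
qed

text \<open>The full circle is an arc, so convergence in the tent norm implies convergence in
$L^2$; Fatou's lemma identifies the limit.\<close>

lemma tent_limit_of_pointwise_null:
  assumes M: "sets M = sets disk_borel"
    and f: "\<And>n. f n \<in> borel_measurable (completion M)" and y: "y \<in> borel_measurable (completion M)"
    and pt: "\<And>z. cmod z < 1 \<Longrightarrow> (\<lambda>n. f n z) \<longlonglongrightarrow> 0"
    and lim: "(\<lambda>n. tent_norm p M (f n - y)) \<longlonglongrightarrow> 0"
  shows "AE z in completion M. y z = 0"
proof -
  have space: "space (completion M) = unit_disk" by (simp add: disk_measure_measurable(1)[OF M])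
  define u where "u n z = ennreal ((cmod (f n z - y z))\<^sup>2)" for n z
  define Y where "Y = (\<integral>\<^sup>+z. ennreal ((cmod (y z))\<^sup>2) \<partial>completion M)"
  have "Y \<le> ennreal (\<epsilon>\<^sup>2)" if \<epsilon>: "0 < \<epsilon>" for \<epsilon>
  proof -
    have "liminf (\<lambda>n. u n z) = ennreal ((cmod (y z))\<^sup>2)" if "z \<in> space (completion M)" for z
    proof -
      have "(\<lambda>n. u n z) \<longlonglongrightarrow> ennreal ((cmod (0 - y z))\<^sup>2)"
        unfolding u_def using that space by (intro tendsto_ennrealI tendsto_intros pt) auto
      then show ?thesis by (intro lim_imp_Liminf) auto
    qed
    then have "Y = (\<integral>\<^sup>+z. liminf (\<lambda>n. u n z) \<partial>completion M)"
      unfolding Y_def by (intro nn_integral_cong) simp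
    also have "\<dots> \<le> liminf (\<lambda>n. \<integral>\<^sup>+z. u n z \<partial>completion M)"
      unfolding u_def using f y by (intro nn_integral_liminf) measurable
    also have "\<dots> \<le> liminf (\<lambda>n::nat. ennreal (\<epsilon>\<^sup>2))"
    proof (rule Liminf_mono)
      have "eventually (\<lambda>n. tent_norm p M (f n - y) < ennreal \<epsilon>) sequentially"
        using lim \<epsilon> by (intro order_tendstoD) auto
      then show "eventually (\<lambda>n. (\<integral>\<^sup>+z. u n z \<partial>completion M) \<le> ennreal (\<epsilon>\<^sup>2)) sequentially"
      proof eventually_elim
        case (elim n)
        then have "tent_norm p M (f n - y) \<le> ennreal \<epsilon>" by simp
        then have "(\<integral>\<^sup>+z\<in>unit_disk. ennreal ((cmod ((f n - y) z))\<^sup>2) \<partial>M) \<le> ennreal (\<epsilon>\<^sup>2)"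
          using \<epsilon> subarc_circle tent_norm_le_iff[of \<epsilon> p M "f n - y"]
          by (auto simp: carleson_square_circle[symmetric] arc_len_circle)
        moreover have "(\<integral>\<^sup>+z. u n z \<partial>M) = (\<integral>\<^sup>+z\<in>unit_disk. ennreal ((cmod ((f n - y) z))\<^sup>2) \<partial>M)"
          using space by (intro nn_integral_cong) (auto simp: u_def)
        ultimately show ?case by (simp add: nn_integral_completion)
      qed
    qed
    also have "\<dots> = ennreal (\<epsilon>\<^sup>2)" by (simp add: Liminf_const)
    finally show ?thesis .
  qed
  note small = this
  have "Y = 0"
  proof (rule ccontr)
    assume "Y \<noteq> 0"
    then have "0 < Y" by (simp add: zero_less_iff_neq_zero)
    then obtain e where e: "0 < e" "ennreal e < Y" by (rule ennreal_pos_obtain_real)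
    then show False using small[of "sqrt e"] by simp
  qed
  then have "AE z in completion M. ennreal ((cmod (y z))\<^sup>2) = 0"
    unfolding Y_def using y by (subst (asm) nn_integral_0_iff_AE) auto
  then show ?thesis by eventually_elim simp
qed

text \<open>Arcs violating the condition give a sequence of test functions tending to 0 pointwise; a
subsequence converges in the tent space, its limit is 0 almost everywhere, and testing contradicts the
choice of the arcs.\<close>

lemma vanishing_of_compact:
  assumes p: "0 < p" and M: "sets M = sets disk_borel"
    and cpt: "compact_operator (Qp p) (Qp_norm p) (tent_space p M) (tent_norm p M) (\<lambda>f. f)"
  shows "(log_carleson_ratio p M \<longlongrightarrow> 0) shrinking_arcs"
proof (rule order_tendstoI)
  fix a :: ennreal assume a: "0 < a"
  show "eventually (\<lambda>I. log_carleson_ratio p M I < a) shrinking_arcs"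
  proof (rule ccontr)
    assume "\<not> ?thesis"
    then have "\<exists>I. subarc I \<and> arc_len I < 1 / (real n + 1) \<and> a \<le> log_carleson_ratio p M I" for n :: nat
      unfolding eventually_shrinking_arcs by (force simp: not_less)
    then obtain I where I: "\<And>n. subarc (I n)" "\<And>n::nat. arc_len (I n) < 1 / (real n + 1)"
        "\<And>n. a \<le> log_carleson_ratio p M (I n)"
      by metis
    have "\<exists>\<xi>. \<xi> \<in> I n \<and> cmod \<xi> = 1" for n using subarc_nonempty[OF I(1)] by metis
    then obtain \<xi> where \<xi>: "\<And>n. \<xi> n \<in> I n" "\<And>n. cmod (\<xi> n) = 1" by metis
    define w where "w n = of_real (1 - arc_len (I n)) * \<xi> n" for n
    have nw: "cmod (w n) = 1 - arc_len (I n)" for n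
      using subarc_arc_len(2)[of "I n"] \<xi>(2) by (simp add: w_def norm_mult del: of_real_diff)
    have w: "cmod (w n) < 1" for n using subarc_arc_len(1)[OF I(1)] by (simp add: nw)
    have "(\<lambda>n. arc_len (I n)) \<longlonglongrightarrow> 0"
    proof (rule tendsto_sandwich[where f = "\<lambda>_. 0" and h = "\<lambda>n. 1 / (real n + 1)"])
      show "(\<lambda>n. 1 / (real n + 1)) \<longlonglongrightarrow> 0" by real_asymp
    qed (use I(2) subarc_arc_len(1)[OF I(1)] in \<open>auto intro!: always_eventually less_imp_le\<close>)
    then have lim: "(\<lambda>n. cmod (w n)) \<longlonglongrightarrow> 1"
      unfolding nw using tendsto_diff[OF tendsto_const, of "\<lambda>n. arc_len (I n)" 0 sequentially 1] by simp
    define s where "s n = log_square_test (w n)" for n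
    note Q = bounded_by_imp_Qp[OF log_square_test_Qp[OF p w]]
    have "range s \<subseteq> Qp p" using Q(1) by (auto simp: s_def)
    moreover have "\<forall>n. Qp_norm p (s n) \<le> ennreal (2 * (log_test_const p * 17))" using Q(2) by (auto simp: s_def)
    ultimately obtain y r where y: "y \<in> tent_space p M" and r: "strict_mono (r :: nat \<Rightarrow> nat)"
        and conv: "(\<lambda>n. tent_norm p M (s (r n) - y)) \<longlonglongrightarrow> 0"
      using cpt unfolding compact_operator_def by blast
    have meas: "s n \<in> borel_measurable M" "s n \<in> borel_measurable (completion M)" for n
      using holomorphic_measurable_completion[OF _ M, of "s n"] Q(1) by (auto simp: s_def Qp_def)
    have AE: "AE z in completion M. y z = 0"
    proof (rule tent_limit_of_pointwise_null[OF M, where f = "\<lambda>n. s (r n)" and p = p])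
      fix z :: complex assume z: "cmod z < 1"
      have "(\<lambda>n. s n z) \<longlonglongrightarrow> 0" unfolding s_def by (rule log_square_test_tendsto_0[OF w lim z])
      then show "(\<lambda>n. s (r n) z) \<longlonglongrightarrow> 0" using r by (rule LIMSEQ_subseq_LIMSEQ[unfolded o_def])
    qed (use meas y conv in \<open>auto simp: tent_space_def\<close>)
    have eq: "tent_norm p M (s n - y) = tent_norm p M (s n)" for n
    proof -
      have "(\<integral>\<^sup>+z\<in>carleson_square I. ennreal ((cmod ((s n - y) z))\<^sup>2) \<partial>completion M) =
          (\<integral>\<^sup>+z\<in>carleson_square I. ennreal ((cmod (s n z))\<^sup>2) \<partial>completion M)" for I
        by (rule nn_integral_cong_AE) (use AE in \<open>eventually_elim, simp\<close>)
      then show ?thesis unfolding tent_norm_def by simp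
    qed
    obtain e where e: "0 < e" "ennreal e < a" using a by (rule ennreal_pos_obtain_real)
    define \<epsilon> where "\<epsilon> = sqrt e / 5"
    have \<epsilon>: "0 < \<epsilon>" "(5 * \<epsilon>)\<^sup>2 = e" using e by (auto simp: \<epsilon>_def)
    have "eventually (\<lambda>n. tent_norm p M (s (r n) - y) < ennreal \<epsilon>) sequentially"
      using conv \<epsilon> by (intro order_tendstoD) auto
    then obtain n where "tent_norm p M (s (r n)) < ennreal \<epsilon>"
      unfolding eq by (auto simp: eventually_sequentially)
    then have "log_carleson_ratio p M (I (r n)) \<le> ennreal ((5 * \<epsilon>)\<^sup>2)"
      using log_square_test_ge_on_square[OF I(1) \<xi>(1)] meas \<epsilon>
      by (intro log_carleson_ratio_le_of_lower_bound[OF I(1), where f = "s (r n)"]) (auto simp: s_def w_def)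
    then have "a \<le> ennreal e" unfolding \<epsilon>(2) by (rule order_trans[OF I(3)])
    then show False using e(2) by simp
  qed
qed simp

theorem theorem1p1:
  fixes p :: real and M :: "complex measure"
  assumes "0 < p"
    and "sets M = sets (restrict_space borel unit_disk)"
  shows "(bounded_operator (Qp p) (Qp_norm p) (tent_space p M) (tent_norm p M) (\<lambda>f. f)
            \<longleftrightarrow> LCM_norm p M < \<infinity>) \<and>
         ((\<forall>K. compact K \<and> K \<subseteq> unit_disk \<longrightarrow> emeasure M K < \<infinity>) \<longrightarrow>
           (compact_operator (Qp p) (Qp_norm p) (tent_space p M) (tent_norm p M) (\<lambda>f. f)
            \<longleftrightarrow> (log_carleson_ratio p M \<longlongrightarrow> 0) shrinking_arcs))"
  using bounded_iff_LCM[OF assms] compact_of_vanishing[OF assms] vanishing_of_compact[OF assms] by blast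

end
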